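(* Let $1\le p,q\le\infty$ and $A\in GL(d,\mathbb{R})$. Then, for every $f\in M^{p,q}(\mathbb{R}^d)$, $$\|f_A\|_{M^{p,q}}\lesssim|\det A|^{-(1/p-1/q+1)}\bigl(\det(I+A^*A)\bigr)^{1/2}\|f\|_{M^{p,q}},$$ where the implied constant is independent of $A$ and $f$.
   Context: For $A\in GL(d,\mathbb{R})$, $f_A(t)=f(At)$ and $A^*$ is the transpose of $A$. Modulation space: fix a nonzero window $g\in\mathcal{S}(\mathbb{R}^d)$, and let $V_gf(z,\xi)=\int e^{-2\pi i\xi\cdot y}f(y)\overline{g(y-z)}\,dy$ be the short-time Fourier transform of a tempered distribution $f$. For $1\le p,q\le\infty$, $M^{p,q}(\mathbb{R}^d)$ is the space of tempered distributions $f$ with $\|f\|_{M^{p,q}}=\bigl\|\,\|V_gf(\cdot,\xi)\|_{L^p}\bigr\|_{L^q_\xi}<\infty$. Different windows give equivalent norms. *)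

theory Defs
  imports "HOL-Analysis.Analysis" "HOL-Probability.Essential_Supremum"
begin

section \<open>Schwartz functions and tempered distributions\<close>

text \<open>
  \<open>iter_deriv [v\<^sub>1, \<dots>, v\<^sub>m] \<phi>\<close> is the iterated directional derivative
  \<open>\<partial>\<^bsub>v\<^sub>1\<^esub> \<dots> \<partial>\<^bsub>v\<^sub>m\<^esub> \<phi>\<close>. Multi-indices are encoded as lists of vectors of \<open>Basis\<close>.
\<close>

fun iter_deriv :: "'a::euclidean_space list \<Rightarrow> ('a \<Rightarrow> complex) \<Rightarrow> 'a \<Rightarrow> complex" where
  "iter_deriv [] \<phi> = \<phi>"
| "iter_deriv (v # vs) \<phi> = (\<lambda>x. frechet_derivative (iter_deriv vs \<phi>) (at x) v)"

text \<open>
  Differentiability is demanded of the iterated partial derivatives of every order, so members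
  are \<open>C\<^sup>\<infinity>\<close> and \<^const>\<open>frechet_derivative\<close> is only ever evaluated where the derivative exists.
\<close>

definition schwartz_space :: "('a::euclidean_space \<Rightarrow> complex) set" where
  "schwartz_space = {\<phi>. \<forall>vs\<in>lists Basis.
     (\<forall>x. iter_deriv vs \<phi> differentiable (at x)) \<and>
     (\<forall>k. bounded (range (\<lambda>x. norm x ^ k *\<^sub>R iter_deriv vs \<phi> x)))}"

definition schwartz_seminorm :: "nat \<Rightarrow> 'a::euclidean_space list \<Rightarrow> ('a \<Rightarrow> complex) \<Rightarrow> real" where
  "schwartz_seminorm k vs \<phi> = (SUP x. norm x ^ k * cmod (iter_deriv vs \<phi> x))"

text \<open>
  A tempered distribution is a functional that is complex-linear on the Schwartz space and
  continuous for the topology generated by the seminorms above. Its values outside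
  \<open>schwartz_space\<close> are irrelevant and never used.
\<close>

definition tempered_distribution :: "(('a::euclidean_space \<Rightarrow> complex) \<Rightarrow> complex) \<Rightarrow> bool" where
  "tempered_distribution u \<longleftrightarrow>
     (\<forall>\<phi>\<in>schwartz_space. \<forall>\<psi>\<in>schwartz_space. u (\<lambda>x. \<phi> x + \<psi> x) = u \<phi> + u \<psi>) \<and>
     (\<forall>c. \<forall>\<phi>\<in>schwartz_space. u (\<lambda>x. c * \<phi> x) = c * u \<phi>) \<and>
     (\<exists>C N. \<forall>\<phi>\<in>schwartz_space.
        cmod (u \<phi>) \<le> C * (\<Sum>k\<le>N. \<Sum>vs | set vs \<subseteq> Basis \<and> length vs \<le> N. schwartz_seminorm k vs \<phi>))"

text \<open>
  \<open>f\<^sub>A(t) = f(A t)\<close> for a distribution: as the pairing is bilinear, the change of variables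
  gives \<open>\<langle>f\<^sub>A, \<phi>\<rangle> = \<integral> f(A t) \<phi>(t) dt = \<bar>det A\<bar>\<^sup>-\<^sup>1 \<langle>f, \<phi> \<circ> A\<^sup>-\<^sup>1\<rangle>\<close>.
\<close>

definition dilation ::
  "real^'n^'n \<Rightarrow> ((real^'n \<Rightarrow> complex) \<Rightarrow> complex) \<Rightarrow> (real^'n \<Rightarrow> complex) \<Rightarrow> complex" where
  "dilation A f = (\<lambda>\<phi>. f (\<lambda>t. \<phi> (matrix_inv A *v t)) / of_real \<bar>det A\<bar>)"


section \<open>Modulation spaces\<close>

text \<open>
  The integral \<open>\<integral> e\<^bsup>-2\<pi>i\<xi>\<cdot>y\<^esup> f(y) cnj (g(y - z)) dy\<close>, read as the (bilinear) pairing of the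
  distribution \<open>f\<close> with a Schwartz function of \<open>y\<close>.
\<close>

definition stft ::
  "('a::euclidean_space \<Rightarrow> complex) \<Rightarrow> (('a \<Rightarrow> complex) \<Rightarrow> complex) \<Rightarrow> 'a \<Rightarrow> 'a \<Rightarrow> complex" where
  "stft g f z \<xi> = f (\<lambda>y. exp (- 2 * of_real pi * \<i> * of_real (\<xi> \<bullet> y)) * cnj (g (y - z)))"

text \<open>Only exponents \<open>a > 0\<close> are used below.\<close>

definition ennreal_powr :: "ennreal \<Rightarrow> real \<Rightarrow> ennreal" where
  "ennreal_powr x a = (if x = \<infinity> then \<infinity> else ennreal (enn2real x powr a))"

definition eLp_norm :: "ennreal \<Rightarrow> 'a measure \<Rightarrow> ('a \<Rightarrow> ennreal) \<Rightarrow> ennreal" where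
  "eLp_norm p M F =
     (if p = \<infinity> then esssup M F
      else ennreal_powr (\<integral>\<^sup>+x. ennreal_powr (F x) (enn2real p) \<partial>M) (1 / enn2real p))"

definition modulation_norm ::
  "('a::euclidean_space \<Rightarrow> complex) \<Rightarrow> ennreal \<Rightarrow> ennreal \<Rightarrow> (('a \<Rightarrow> complex) \<Rightarrow> complex) \<Rightarrow> ennreal" where
  "modulation_norm g p q f =
     eLp_norm q lborel (\<lambda>\<xi>. eLp_norm p lborel (\<lambda>z. ennreal (cmod (stft g f z \<xi>))))"

definition modulation_space ::
  "('a::euclidean_space \<Rightarrow> complex) \<Rightarrow> ennreal \<Rightarrow> ennreal \<Rightarrow> (('a \<Rightarrow> complex) \<Rightarrow> complex) set" where
  "modulation_space g p q = {f. tempered_distribution f \<and> modulation_norm g p q f < \<infinity>}"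

end

theory Submission
  imports Defs "HOL-Probability.Probability"
begin

text \<open>
  If a window \<open>H\<close> is a superposition \<open>\<integral> a(w) M T G dw\<close> of time-frequency shifts of a window \<open>G\<close>, then
  Minkowski's inequality bounds the modulation norm with window \<open>H\<close> by \<open>\<parallel>a\<parallel>\<^sub>1\<close> times the one with window
  \<open>G\<close>. Dilating \<open>f\<close> by \<open>A\<close> amounts to dilating the window by \<open>B = A\<^sup>-\<^sup>1\<close>, up to the stated power of
  \<open>|det A|\<close>. By Fourier inversion any Schwartz window is a superposition of shifts of any nonzero one,
  with constants unaffected by \<open>B\<close>, so the window may be taken to be the Gaussian \<open>\<phi>\<close>. Finally
  \<open>\<phi> \<circ> B\<close> is reached from \<open>\<phi>\<close> in two steps: multiplication by \<open>\<phi> \<circ> B\<close> (a superposition of modulations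
  of total mass 1), and then a convolution with a Gaussian of mass \<open>det (I + A\<^sup>* A)\<^sup>1\<^sup>/\<^sup>2\<close>.
\<close>

section \<open>Schwartz functions and time-frequency shifts\<close>

text \<open>The obstacle is that \<open>f\<close> is only a functional on Schwartz functions, so an
  integral over windows cannot simply be moved through it. The integral is therefore discretised:
  finite combinations of shifts converge pointwise to the window and stay bounded in every seminorm,
  and this already forces convergence of the values of \<open>f\<close>. Accordingly, Minkowski's
  inequality takes the form of the triangle inequality for finite sums followed by Fatou's lemma.
  The price is that coefficient functions need finite moments of every order.

  The Gaussian is chosen because it is its own Fourier transform and the masses that occur reduce to
  determinants. With \<Delta> = det (I + A^T A), the convolution step has normalising factor |det B|
  \<Delta> and Gaussian mass |det A| / sqrt \<Delta>; since det A det B = 1, the total is sqrt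
  \<Delta>. The power of |det A| collects -1 from the pairing that defines the dilation, -1/p from
  the substitution in position and 1/q from the dual substitution in frequency.\<close>

abbreviation (input) \<S> :: "('a::euclidean_space \<Rightarrow> complex) set" where "\<S> \<equiv> schwartz_space"

abbreviation dir_deriv :: "'a::euclidean_space \<Rightarrow> ('a \<Rightarrow> complex) \<Rightarrow> 'a \<Rightarrow> complex" where
  "dir_deriv v \<phi> \<equiv> \<lambda>x. frechet_derivative \<phi> (at x) v"

text \<open>Families such as products or shifted functions are closed under differentiation only up
  to linear combinations, so \<open>schwartz_spanI\<close> works with their span.\<close>

inductive_set fspan :: "('a \<Rightarrow> complex) set \<Rightarrow> ('a \<Rightarrow> complex) set" for G where
  fspan_zero: "(\<lambda>_. 0) \<in> fspan G"
| fspan_step: "\<phi> \<in> G \<Longrightarrow> \<psi> \<in> fspan G \<Longrightarrow> (\<lambda>x. c * \<phi> x + \<psi> x) \<in> fspan G"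

lemma fspan_base: "\<phi> \<in> G \<Longrightarrow> \<phi> \<in> fspan G"
  using fspan_step[OF _ fspan_zero, of \<phi> G 1] by simp

lemma fspan_lincomb:
  assumes "\<phi> \<in> fspan G" "\<psi> \<in> fspan G"
  shows "(\<lambda>x. c * \<phi> x + \<psi> x) \<in> fspan G"
  using assms(1)
proof (induction \<phi> rule: fspan.induct)
  case fspan_zero
  then show ?case using assms(2) by simp
next
  case (fspan_step \<phi> \<rho> d)
  have "(\<lambda>x. (c * d) * \<phi> x + (c * \<rho> x + \<psi> x)) \<in> fspan G"
    using fspan_step by (intro fspan.fspan_step[of \<phi> G "\<lambda>x. c * \<rho> x + \<psi> x" "c * d"]) auto
  then show ?case by (simp add: algebra_simps)
qed

lemma fspan_add: "\<phi> \<in> fspan G \<Longrightarrow> \<psi> \<in> fspan G \<Longrightarrow> (\<lambda>x. \<phi> x + \<psi> x) \<in> fspan G"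
  using fspan_lincomb[of \<phi> G \<psi> 1] by simp

lemma fspan_cmult: "\<phi> \<in> fspan G \<Longrightarrow> (\<lambda>x. c * \<phi> x) \<in> fspan G"
  using fspan_lincomb[OF _ fspan_zero, of \<phi> G c] by simp

lemma fspan_sum:
  assumes "finite I" "\<And>i. i \<in> I \<Longrightarrow> \<phi> i \<in> fspan G"
  shows "(\<lambda>x. \<Sum>i\<in>I. c i * \<phi> i x) \<in> fspan G"
  using assms
  by (induction I rule: finite_induct) (auto intro!: fspan_zero fspan_lincomb)

lemma dir_derivI:
  assumes "\<And>x. (\<phi> has_derivative D x) (at x)"
  shows "dir_deriv v \<phi> = (\<lambda>x. D x v)"
  using frechet_derivative_at[OF assms] by metis

text \<open>Once one derivative of each generator lies in the span, the span is stable under all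
  iterated derivatives, and each of these inherits the zeroth-order decay. Thus nothing has to be
  checked beyond first order.\<close>

lemma schwartz_spanI:
  fixes G :: "('a::euclidean_space \<Rightarrow> complex) set"
  assumes diff: "\<And>\<phi> x. \<phi> \<in> G \<Longrightarrow> \<phi> differentiable (at x)"
    and der: "\<And>\<phi> b. \<phi> \<in> G \<Longrightarrow> b \<in> Basis \<Longrightarrow> dir_deriv b \<phi> \<in> fspan G"
    and bnd: "\<And>\<phi> k. \<phi> \<in> G \<Longrightarrow> \<exists>C. \<forall>x. norm x ^ k * cmod (\<phi> x) \<le> C"
  shows "fspan G \<subseteq> \<S>"
proof
  have 1: "(\<forall>x. \<phi> differentiable (at x)) \<and> (\<forall>b\<in>Basis. dir_deriv b \<phi> \<in> fspan G)
      \<and> (\<forall>k. \<exists>C. \<forall>x. norm x ^ k * cmod (\<phi> x) \<le> C)" if "\<phi> \<in> fspan G" for \<phi>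
    using that
  proof (induction \<phi> rule: fspan.induct)
    case fspan_zero
    then show ?case
      by (auto simp: dir_derivI[OF has_derivative_const] intro: fspan.fspan_zero)
  next
    case (fspan_step \<phi> \<psi> c)
    have "dir_deriv b (\<lambda>x. c * \<phi> x + \<psi> x) = (\<lambda>x. c * dir_deriv b \<phi> x + dir_deriv b \<psi> x)" for b
      by (rule dir_derivI)
        (use fspan_step diff in \<open>auto intro!: derivative_eq_intros simp flip: frechet_derivative_works\<close>)
    moreover have "\<exists>C. \<forall>x. norm x ^ k * cmod (c * \<phi> x + \<psi> x) \<le> C" for k
    proof -
      obtain C1 C2 where C: "\<And>x. norm x ^ k * cmod (\<phi> x) \<le> C1" "\<And>x. norm x ^ k * cmod (\<psi> x) \<le> C2"
        using bnd[OF fspan_step(1)] fspan_step by metis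
      have "norm x ^ k * cmod (c * \<phi> x + \<psi> x) \<le> cmod c * C1 + C2" for x
      proof -
        have "norm x ^ k * cmod (c * \<phi> x + \<psi> x) \<le> norm x ^ k * (cmod c * cmod (\<phi> x) + cmod (\<psi> x))"
          by (intro mult_left_mono) (auto simp: norm_mult[symmetric] norm_triangle_ineq)
        also have "\<dots> = cmod c * (norm x ^ k * cmod (\<phi> x)) + norm x ^ k * cmod (\<psi> x)"
          by (simp add: algebra_simps)
        also have "\<dots> \<le> cmod c * C1 + C2"
          using C by (intro add_mono mult_left_mono) auto
        finally show ?thesis .
      qed
      then show ?thesis by blast
    qed
    ultimately show ?case
      using fspan_step diff der by (auto intro!: fspan_lincomb derivative_intros)
  qed
  fix \<phi> assume \<phi>: "\<phi> \<in> fspan G"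
  have *: "iter_deriv vs \<phi> \<in> fspan G" if "vs \<in> lists Basis" for vs
    using that by (induction vs) (use 1 \<phi> in auto)
  then show "\<phi> \<in> \<S>"
    unfolding schwartz_space_def
  proof (clarify, intro conjI allI)
    fix vs :: "'a list" and x k assume "\<forall>b\<in>set vs. b \<in> (Basis::'a set)"
    then have vs: "iter_deriv vs \<phi> \<in> fspan G" using * by auto
    then show "iter_deriv vs \<phi> differentiable at x" using 1 by blast
    obtain C where "\<And>x. norm x ^ k * cmod (iter_deriv vs \<phi> x) \<le> C" using 1[OF vs] by metis
    then show "bounded (range (\<lambda>x. norm x ^ k *\<^sub>R iter_deriv vs \<phi> x))"
      by (auto simp: bounded_iff)
  qed
qed

section \<open>Calculus, decay and closure properties of Schwartz functions\<close>

lemma iter_deriv_append: "iter_deriv (us @ vs) \<phi> = iter_deriv us (iter_deriv vs \<phi>)"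
  by (induction us) auto

lemma schwartz_iter_deriv:
  assumes "\<phi> \<in> \<S>" "set vs \<subseteq> Basis"
  shows "iter_deriv vs \<phi> \<in> \<S>"
  unfolding schwartz_space_def
proof (clarsimp, intro conjI allI)
  fix us assume "\<forall>x\<in>set us. x \<in> (Basis::'a set)"
  then have "us @ vs \<in> lists Basis" using assms by auto
  then show "iter_deriv us (iter_deriv vs \<phi>) differentiable at x" 
      "bounded (range (\<lambda>x. norm x ^ k *\<^sub>R iter_deriv us (iter_deriv vs \<phi>) x))" for x k
    using assms(1) unfolding schwartz_space_def iter_deriv_append[symmetric] by auto
qed

lemma schwartz_dir_deriv:
  assumes "\<phi> \<in> \<S>" "b \<in> Basis"
  shows "dir_deriv b \<phi> \<in> \<S>"
  using schwartz_iter_deriv[OF assms(1), of "[b]"] assms(2) by simp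

lemma schwartz_differentiable: "\<phi> \<in> \<S> \<Longrightarrow> \<phi> differentiable (at x)"
  unfolding schwartz_space_def by (force dest: bspec[where x="[]"])

lemma schwartz_has_derivative:
  "\<phi> \<in> \<S> \<Longrightarrow> (\<phi> has_derivative frechet_derivative \<phi> (at x)) (at x)"
  using schwartz_differentiable frechet_derivative_works by blast

lemma iter_deriv_lincomb:
  assumes "\<phi> \<in> \<S>" "\<psi> \<in> \<S>" "set vs \<subseteq> Basis"
  shows "iter_deriv vs (\<lambda>y. c * \<phi> y + \<psi> y) = (\<lambda>y. c * iter_deriv vs \<phi> y + iter_deriv vs \<psi> y)"
  using assms(3)
proof (induction vs)
  case (Cons a vs)
  have "dir_deriv a (\<lambda>y. c * iter_deriv vs \<phi> y + iter_deriv vs \<psi> y)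
    = (\<lambda>y. c * dir_deriv a (iter_deriv vs \<phi>) y + dir_deriv a (iter_deriv vs \<psi>) y)"
    by (rule dir_derivI)
      (use Cons.prems assms in \<open>auto intro!: derivative_eq_intros schwartz_has_derivative schwartz_iter_deriv\<close>)
  then show ?case using Cons by simp
qed auto

lemma schwartz_has_derivative_line:
  assumes "\<phi> \<in> \<S>"
  shows "((\<lambda>s. \<phi> (x + s *\<^sub>R b)) has_derivative (\<lambda>r. r *\<^sub>R dir_deriv b \<phi> (x + s *\<^sub>R b))) (at s within S)"
proof -
  have "((\<lambda>s. \<phi> (x + s *\<^sub>R b)) has_derivative
        (\<lambda>r. frechet_derivative \<phi> (at (x + s *\<^sub>R b)) (r *\<^sub>R b))) (at s within S)"
    by (rule has_derivative_compose[OF _ schwartz_has_derivative[OF assms]])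
      (auto intro!: derivative_eq_intros)
  moreover have "linear (frechet_derivative \<phi> (at (x + s *\<^sub>R b)))"
    using schwartz_has_derivative[OF assms] has_derivative_linear by blast
  ultimately show ?thesis by (simp add: linear_scale)
qed

lemma schwartz_continuous: "\<phi> \<in> \<S> \<Longrightarrow> continuous_on UNIV \<phi>"
  by (meson continuous_at_imp_continuous_on differentiable_imp_continuous_within schwartz_differentiable)

lemma schwartz_measurable [measurable_dest]: "\<phi> \<in> \<S> \<Longrightarrow> \<phi> \<in> borel_measurable borel"
  by (simp add: borel_measurable_continuous_onI schwartz_continuous)

lemma schwartz_power_bound:
  assumes "\<phi> \<in> \<S>"
  obtains C where "\<And>x. norm x ^ k * cmod (\<phi> x) \<le> C"
proof -
  have "bounded (range (\<lambda>x. norm x ^ k *\<^sub>R iter_deriv [] \<phi> x))"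
    using assms unfolding schwartz_space_def by (blast intro: lists.Nil)
  then show thesis
    using that by (auto simp: bounded_iff norm_mult norm_power)
qed

lemma one_plus_power_le:
  assumes "(t::real) \<ge> 0"
  shows "(1 + t) ^ k \<le> 2 ^ k * (1 + t ^ k)"
proof -
  have "(1 + t) ^ k \<le> (2 * max 1 t) ^ k"
    using assms by (intro power_mono) auto
  also have "\<dots> = 2 ^ k * (max 1 t) ^ k" by (simp add: power_mult_distrib)
  also have "\<dots> \<le> 2 ^ k * (1 + t ^ k)"
    using assms by (intro mult_left_mono) (auto simp: max_def)
  finally show ?thesis .
qed

lemma schwartz_decay:
  assumes "\<phi> \<in> \<S>"
  obtains C where "C > 0" "\<And>x. (1 + norm x) ^ k * cmod (\<phi> x) \<le> C"
proof -
  obtain C0 Ck where C: "\<And>x. norm x ^ 0 * cmod (\<phi> x) \<le> C0" "\<And>x. norm x ^ k * cmod (\<phi> x) \<le> Ck"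
    using schwartz_power_bound[OF assms] by metis
  have "(1 + norm x) ^ k * cmod (\<phi> x) \<le> 2 ^ k * (C0 + Ck) + 1" for x
  proof -
    have "(1 + norm x) ^ k * cmod (\<phi> x) \<le> 2 ^ k * (1 + norm x ^ k) * cmod (\<phi> x)"
      by (intro mult_right_mono one_plus_power_le) auto
    also have "\<dots> = 2 ^ k * (norm x ^ 0 * cmod (\<phi> x) + norm x ^ k * cmod (\<phi> x))"
      by (simp add: algebra_simps)
    also have "\<dots> \<le> 2 ^ k * (C0 + Ck)"
      by (intro mult_left_mono add_mono C) auto
    finally show ?thesis by simp
  qed
  moreover have "2 ^ k * (C0 + Ck) + 1 > 0"
    using C(1)[of 0] C(2)[of 0] by (smt (verit) mult_nonneg_nonneg norm_ge_zero zero_le_power)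
  ultimately show thesis using that by blast
qed

text \<open>The Schwartz space is itself an admissible family of generators, which yields its vector
  space structure.\<close>

lemma schwartz_fspan: "fspan \<S> \<subseteq> \<S>"
proof (rule schwartz_spanI)
  show "\<exists>C. \<forall>x. norm x ^ k * cmod (\<phi> x) \<le> C" if "\<phi> \<in> \<S>" for \<phi> :: "'a \<Rightarrow> complex" and k
    using schwartz_power_bound[OF that, of k] by metis
qed (auto intro: schwartz_differentiable fspan_base schwartz_dir_deriv)

lemma schwartz_lincomb:
  assumes "\<phi> \<in> \<S>" "\<psi> \<in> \<S>"
  shows "(\<lambda>x. c * \<phi> x + \<psi> x) \<in> \<S>"
  using schwartz_fspan fspan_lincomb[OF fspan_base[OF assms(1)] fspan_base[OF assms(2)]] by blast

lemma schwartz_zero: "(\<lambda>_. 0) \<in> \<S>"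
  using schwartz_fspan fspan_zero by blast

lemma schwartz_cmult: "\<phi> \<in> \<S> \<Longrightarrow> (\<lambda>x. c * \<phi> x) \<in> \<S>"
  using schwartz_lincomb[OF _ schwartz_zero] by simp

lemma schwartz_sum:
  assumes "finite I" "\<And>i. i \<in> I \<Longrightarrow> \<phi> i \<in> \<S>"
  shows "(\<lambda>x. \<Sum>i\<in>I. c i * \<phi> i x) \<in> \<S>"
  using schwartz_fspan fspan_sum[OF assms(1), of \<phi> \<S> c] assms(2) fspan_base by blast

lemma schwartz_mult:
  fixes \<phi> \<psi> :: "'a::euclidean_space \<Rightarrow> complex"
  assumes "\<phi> \<in> \<S>" "\<psi> \<in> \<S>"
  shows "(\<lambda>x. \<phi> x * \<psi> x) \<in> \<S>"
proof -
  \<comment> \<open>All products serve as generators, not just the given one, because the Leibniz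
    rule turns one product into two others.\<close>
  define G :: "('a \<Rightarrow> complex) set"
    where "G = {\<lambda>x. \<phi> x * \<psi> x | \<phi> \<psi>. \<phi> \<in> \<S> \<and> \<psi> \<in> \<S>}"
  have GI: "(\<lambda>x. \<phi> x * \<psi> x) \<in> G" if "\<phi> \<in> \<S>" "\<psi> \<in> \<S>" for \<phi> \<psi>
    unfolding G_def using that by blast
  have "fspan G \<subseteq> \<S>"
  proof (rule schwartz_spanI)
    fix \<rho> assume "\<rho> \<in> G"
    then obtain \<phi> \<psi> where \<rho>: "\<rho> = (\<lambda>x. \<phi> x * \<psi> x)" and S: "\<phi> \<in> \<S>" "\<psi> \<in> \<S>"
      unfolding G_def by auto
    show "\<rho> differentiable at x" for x
      unfolding \<rho> using S schwartz_differentiable by (intro derivative_intros) auto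
    show "dir_deriv b \<rho> \<in> fspan G" if "b \<in> Basis" for b
    proof -
      have "dir_deriv b \<rho> = (\<lambda>x. \<phi> x * dir_deriv b \<psi> x + dir_deriv b \<phi> x * \<psi> x)"
        unfolding \<rho> by (rule dir_derivI) (use S in \<open>auto intro!: has_derivative_mult schwartz_has_derivative\<close>)
      moreover have "\<dots> \<in> fspan G"
        using S that by (intro fspan_add fspan_base GI schwartz_dir_deriv)
      ultimately show ?thesis by simp
    qed
    show "\<exists>C. \<forall>x. norm x ^ k * cmod (\<rho> x) \<le> C" for k
    proof -
      obtain C1 C2 where C: "\<And>x. norm x ^ k * cmod (\<phi> x) \<le> C1" "\<And>x. norm x ^ 0 * cmod (\<psi> x) \<le> C2"
        using schwartz_power_bound S by metis
      have "norm x ^ k * cmod (\<rho> x) \<le> C1 * C2" for x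
      proof -
        have "norm x ^ k * cmod (\<rho> x) = (norm x ^ k * cmod (\<phi> x)) * cmod (\<psi> x)"
          by (simp add: \<rho> norm_mult)
        also have "\<dots> \<le> C1 * C2"
          using C(1)[of x] C(2)[of x]
          by (intro mult_mono) (auto intro: order_trans[OF _ C(1)])
        finally show ?thesis .
      qed
      then show ?thesis by blast
    qed
  qed
  then show ?thesis
    using fspan_base[OF GI[OF assms]] by blast
qed

lemma schwartz_cnj:
  fixes \<phi> :: "'a::euclidean_space \<Rightarrow> complex"
  assumes "\<phi> \<in> \<S>"
  shows "cnj \<circ> \<phi> \<in> \<S>"
proof -
  define G :: "('a \<Rightarrow> complex) set" where "G = (\<lambda>\<phi>. cnj \<circ> \<phi>) ` \<S>"
  have "fspan G \<subseteq> \<S>"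
  proof (rule schwartz_spanI)
    fix \<rho> assume "\<rho> \<in> G"
    then obtain \<phi> where \<rho>: "\<rho> = (\<lambda>x. cnj (\<phi> x))" and S: "\<phi> \<in> \<S>"
      unfolding G_def o_def by blast
    have D: "(\<rho> has_derivative (\<lambda>v. cnj (frechet_derivative \<phi> (at x) v))) (at x)" for x
      unfolding \<rho> by (rule has_derivative_cnj[OF schwartz_has_derivative[OF S]])
    then show "\<rho> differentiable at x" for x
      using differentiable_def by blast
    show "dir_deriv b \<rho> \<in> fspan G" if "b \<in> Basis" for b
      unfolding dir_derivI[OF D]
      using imageI[OF schwartz_dir_deriv[OF S that], of "(\<circ>) cnj"]
      by (intro fspan_base) (simp add: G_def o_def)
    show "\<exists>C. \<forall>x. norm x ^ k * cmod (\<rho> x) \<le> C" for k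
      proof -
      obtain C where "\<And>x. norm x ^ k * cmod (\<phi> x) \<le> C"
        using schwartz_power_bound[OF S] by metis
      then show ?thesis unfolding \<rho> complex_mod_cnj by blast
    qed
  qed
  then show ?thesis
    using subsetD[OF _ fspan_base[of _ G]] imageI[OF assms(1)] unfolding G_def by metis
qed

lemma schwartz_linear_compose:
  fixes \<phi> :: "'a::euclidean_space \<Rightarrow> complex" and L :: "'b::euclidean_space \<Rightarrow> 'a"
  assumes "\<phi> \<in> \<S>" "linear L" "inj L"
  shows "\<phi> \<circ> L \<in> \<S>"
proof -
  define G :: "('b \<Rightarrow> complex) set" where "G = (\<lambda>\<phi>. \<phi> \<circ> L) ` \<S>"
  \<comment> \<open>In finite dimension injectivity bounds \<open>norm (L x)\<close> below by a
    multiple of \<open>norm x\<close>, which carries decay in \<open>L x\<close> back to decay in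
    \<open>x\<close>.\<close>
  obtain B where B: "B > 0" "\<And>x. B * norm x \<le> norm (L x)"
    using linear_inj_bounded_below_pos[OF assms(2,3)] by metis
  have L: "(L has_derivative L) (at x)" for x
    using assms(2) by (simp add: linear_imp_has_derivative)
  have "fspan G \<subseteq> \<S>"
  proof (rule schwartz_spanI)
    fix \<rho> assume "\<rho> \<in> G"
    then obtain \<phi> where \<rho>: "\<rho> = (\<lambda>x. \<phi> (L x))" and S: "\<phi> \<in> \<S>"
      unfolding G_def o_def by blast
    have D: "(\<rho> has_derivative (\<lambda>v. frechet_derivative \<phi> (at (L x)) (L v))) (at x)" for x
      unfolding \<rho> by (rule has_derivative_compose[OF L schwartz_has_derivative[OF S]])
    then show "\<rho> differentiable at x" for x
      using differentiable_def by blast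
    show "dir_deriv b \<rho> \<in> fspan G" if "b \<in> Basis" for b
    proof -
      have "dir_deriv b \<rho> = (\<lambda>x. \<Sum>i\<in>Basis. complex_of_real (L b \<bullet> i) * (dir_deriv i \<phi> \<circ> L) x)"
      proof
        fix x
        have lin: "linear (frechet_derivative \<phi> (at (L x)))"
          using schwartz_has_derivative[OF S] has_derivative_linear by blast
        have "dir_deriv b \<rho> x = frechet_derivative \<phi> (at (L x)) (\<Sum>i\<in>Basis. (L b \<bullet> i) *\<^sub>R i)"
          using fun_cong[OF dir_derivI[OF D, of b], of x] by (simp add: euclidean_representation)
        also have "\<dots> = (\<Sum>i\<in>Basis. (L b \<bullet> i) *\<^sub>R frechet_derivative \<phi> (at (L x)) i)"
          using lin by (simp add: linear_sum linear_scale)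
        finally show "dir_deriv b \<rho> x = (\<Sum>i\<in>Basis. complex_of_real (L b \<bullet> i) * (dir_deriv i \<phi> \<circ> L) x)"
          by (simp add: scaleR_conv_of_real)
      qed
      moreover have "\<dots> \<in> fspan G"
        unfolding G_def by (intro fspan_sum fspan_base imageI schwartz_dir_deriv S finite_Basis)
      ultimately show ?thesis by simp
    qed
    show "\<exists>C. \<forall>x. norm x ^ k * cmod (\<rho> x) \<le> C" for k
    proof -
      obtain C where C: "\<And>x. norm x ^ k * cmod (\<phi> x) \<le> C"
        using schwartz_power_bound[OF S] by metis
      have "norm x ^ k * cmod (\<rho> x) \<le> C / B ^ k" for x
      proof -
        have "(B * norm x) ^ k * cmod (\<rho> x) \<le> norm (L x) ^ k * cmod (\<rho> x)"
          using B by (intro mult_right_mono power_mono) auto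
        also have "\<dots> \<le> C" using C by (simp add: \<rho>)
        finally show ?thesis using B(1) by (simp add: field_simps power_mult_distrib)
      qed
      then show ?thesis by blast
    qed
  qed
  then show ?thesis
    using subsetD[OF _ fspan_base[of _ G]] imageI[OF assms(1)] unfolding G_def by metis
qed

section \<open>Time-frequency shifts of Schwartz functions\<close>

definition tf_shift :: "'a \<times> 'a \<Rightarrow> ('a::euclidean_space \<Rightarrow> complex) \<Rightarrow> 'a \<Rightarrow> complex" where
  "tf_shift w \<phi> = (\<lambda>y. cis (2 * pi * (snd w \<bullet> y)) * \<phi> (y - fst w))"

lemma tf_shift_has_derivative:
  assumes "\<phi> \<in> \<S>"
  shows "(tf_shift w \<phi> has_derivative
      (\<lambda>v. complex_of_real (2 * pi * (snd w \<bullet> v)) * \<i> * tf_shift w \<phi> y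
         + cis (2 * pi * (snd w \<bullet> y)) * frechet_derivative \<phi> (at (y - fst w)) v)) (at y)"
proof -
  have 1: "((\<lambda>y. \<phi> (y - fst w)) has_derivative (\<lambda>v. frechet_derivative \<phi> (at (y - fst w)) v)) (at y)"
    by (rule has_derivative_compose[of "\<lambda>y. y - fst w" "\<lambda>v. v", OF _ schwartz_has_derivative[OF assms]])
      (auto intro!: derivative_eq_intros)
  have 2: "((\<lambda>y. cis (2 * pi * (snd w \<bullet> y))) has_derivative
      (\<lambda>v. complex_of_real (2 * pi * (snd w \<bullet> v)) * \<i> * cis (2 * pi * (snd w \<bullet> y)))) (at y)"
  proof -
    have "((\<lambda>y. \<i> * complex_of_real (2 * pi * (snd w \<bullet> y))) has_derivative
        (\<lambda>v. \<i> * complex_of_real (2 * pi * (snd w \<bullet> v)))) (at y)"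
      by (auto intro!: derivative_eq_intros)
    from has_derivative_compose[OF this DERIV_exp[unfolded has_field_derivative_def]]
    show ?thesis unfolding cis_conv_exp by (simp add: mult_ac)
  qed
  show ?thesis
    unfolding tf_shift_def
    by (rule has_derivative_eq_rhs[OF has_derivative_mult[OF 2 1]]) (auto simp: algebra_simps)
qed

lemma dir_deriv_tf_shift:
  assumes "\<phi> \<in> \<S>"
  shows "dir_deriv v (tf_shift w \<phi>) =
    (\<lambda>y. (complex_of_real (2 * pi * (snd w \<bullet> v)) * \<i>) * tf_shift w \<phi> y + tf_shift w (dir_deriv v \<phi>) y)"
  unfolding dir_derivI[OF tf_shift_has_derivative[OF assms]] by (simp add: tf_shift_def)

lemma norm_tf_shift [simp]: "cmod (tf_shift w \<phi> y) = cmod (\<phi> (y - fst w))"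
  by (simp add: tf_shift_def norm_mult)

text \<open>Submultiplicativity of the polynomial weight, a form of Peetre's inequality. It is the
  device for passing weights through translations.\<close>

lemma norm_le_weight:
  fixes x y :: "'a::real_normed_vector"
  shows "1 + norm y \<le> (1 + norm x) * (1 + norm (y - x))"
proof -
  have "norm y \<le> norm x + norm (y - x)"
    using norm_triangle_ineq[of x "y - x"] by simp
  then show ?thesis
    by (simp add: algebra_simps) (smt (verit) mult_nonneg_nonneg norm_ge_zero)
qed

text \<open>The constant grows only polynomially in the shift \<open>w\<close>. This is why
  coefficient functions with finite moments of all orders are good enough for
  superpositions.\<close>

lemma tf_shift_decay:
  assumes "\<phi> \<in> \<S>"
  obtains C where "C > 0" "\<And>w y. (1 + norm y) ^ k * cmod (tf_shift w \<phi> y) \<le> C * (1 + norm w) ^ k"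
proof -
  obtain C where C: "C > 0" "\<And>x. (1 + norm x) ^ k * cmod (\<phi> x) \<le> C"
    using schwartz_decay[OF assms] by metis
  have "(1 + norm y) ^ k * cmod (tf_shift w \<phi> y) \<le> C * (1 + norm w) ^ k" for w y
  proof -
    have "(1 + norm y) ^ k * cmod (tf_shift w \<phi> y)
        \<le> ((1 + norm w) * (1 + norm (y - fst w))) ^ k * cmod (tf_shift w \<phi> y)"
    proof (intro mult_right_mono power_mono)
      have "1 + norm y \<le> (1 + norm (fst w)) * (1 + norm (y - fst w))"
        by (rule norm_le_weight)
      also have "\<dots> \<le> (1 + norm w) * (1 + norm (y - fst w))"
        by (intro mult_right_mono) (auto intro: order_trans[OF norm_fst_le[of "fst w" "snd w"]])
      finally show "1 + norm y \<le> (1 + norm w) * (1 + norm (y - fst w))" .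
    qed auto
    also have "\<dots> = (1 + norm w) ^ k * ((1 + norm (y - fst w)) ^ k * cmod (\<phi> (y - fst w)))"
      by (simp add: power_mult_distrib)
    also have "\<dots> \<le> (1 + norm w) ^ k * C"
      by (intro mult_left_mono C(2)) auto
    finally show ?thesis by (simp add: mult.commute)
  qed
  then show thesis using that C(1) by blast
qed

lemma schwartz_tf_shift:
  fixes \<phi> :: "'a::euclidean_space \<Rightarrow> complex"
  assumes "\<phi> \<in> \<S>"
  shows "tf_shift w \<phi> \<in> \<S>"
proof -
  define G :: "('a \<Rightarrow> complex) set" where "G = tf_shift w ` \<S>"
  have "fspan G \<subseteq> \<S>"
  proof (rule schwartz_spanI)
    fix \<rho> assume "\<rho> \<in> G"
    then obtain \<phi> where \<rho>: "\<rho> = tf_shift w \<phi>" and S: "\<phi> \<in> \<S>"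
      unfolding G_def by auto
    show "\<rho> differentiable at x" for x
      unfolding \<rho> using tf_shift_has_derivative[OF S] differentiable_def by blast
    show "dir_deriv b \<rho> \<in> fspan G" if "b \<in> Basis" for b
      unfolding \<rho> dir_deriv_tf_shift[OF S]
      by (intro fspan_lincomb fspan_base) (use S schwartz_dir_deriv that in \<open>auto simp: G_def\<close>)
    show "\<exists>C. \<forall>x. norm x ^ k * cmod (\<rho> x) \<le> C" for k
    proof -
      obtain C where C: "\<And>w y. (1 + norm y) ^ k * cmod (tf_shift w \<phi> y) \<le> C * (1 + norm w) ^ k"
        using tf_shift_decay[OF S] by metis
      have "norm x ^ k * cmod (\<rho> x) \<le> C * (1 + norm w) ^ k" for x
        unfolding \<rho> by (rule order_trans[OF mult_right_mono C]) (auto intro: power_mono)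
      then show ?thesis by blast
    qed
  qed
  then show ?thesis
    using subsetD[OF _ fspan_base[of _ G]] imageI[OF assms(1)] unfolding G_def by metis
qed

text \<open>Iterated derivatives are peeled off from the innermost end, so that the induction hypothesis
  applies to both terms of the product rule.\<close>

lemma tf_shift_seminorm_bound:
  assumes "\<phi> \<in> \<S>" "set vs \<subseteq> Basis"
  shows "\<exists>C>0. \<forall>w y. norm y ^ k * cmod (iter_deriv vs (tf_shift w \<phi>) y) \<le> C * (1 + norm w) ^ (k + length vs)"
  using assms
proof (induction vs arbitrary: \<phi> rule: rev_induct)
  case Nil
  obtain C where C: "C > 0" "\<And>w y. (1 + norm y) ^ k * cmod (tf_shift w \<phi> y) \<le> C * (1 + norm w) ^ k"
    using tf_shift_decay[OF Nil(1)] by metis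
  have "norm y ^ k * cmod (tf_shift w \<phi> y) \<le> C * (1 + norm w) ^ k" for w y
    by (rule order_trans[OF mult_right_mono C(2)]) (auto intro: power_mono)
  then show ?case using C(1) by auto
next
  case (snoc b vs)
  have b: "b \<in> Basis" and vs: "set vs \<subseteq> Basis" using snoc by auto
  note S = snoc.prems(1) and S' = schwartz_dir_deriv[OF snoc.prems(1) b]
  obtain C1 where C1: "C1 > 0"
    "\<And>w y. norm y ^ k * cmod (iter_deriv vs (tf_shift w \<phi>) y) \<le> C1 * (1 + norm w) ^ (k + length vs)"
    using snoc.IH[OF S vs] by metis
  obtain C2 where C2: "C2 > 0"
    "\<And>w y. norm y ^ k * cmod (iter_deriv vs (tf_shift w (dir_deriv b \<phi>)) y) \<le> C2 * (1 + norm w) ^ (k + length vs)"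
    using snoc.IH[OF S' vs] by metis
  have "norm y ^ k * cmod (iter_deriv (vs @ [b]) (tf_shift w \<phi>) y)
      \<le> (2 * pi * C1 + C2) * (1 + norm w) ^ (k + length (vs @ [b]))" for w y
  proof -
    let ?W = "(1 + norm w) ^ (k + length vs)" and ?d = "iter_deriv vs (tf_shift w \<phi>) y"
      and ?d' = "iter_deriv vs (tf_shift w (dir_deriv b \<phi>)) y"
    define c where "c = complex_of_real (2 * pi * (snd w \<bullet> b)) * \<i>"
    have "\<bar>snd w \<bullet> b\<bar> \<le> norm w"
      using Basis_le_norm[OF b, of "snd w"] norm_snd_le[of "snd w" "fst w"] by simp
    then have c: "cmod c \<le> 2 * pi * (1 + norm w)"
      by (simp add: c_def norm_mult)
    have "iter_deriv (vs @ [b]) (tf_shift w \<phi>) y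
        = c * ?d + ?d'"
      using iter_deriv_lincomb[of "tf_shift w \<phi>" "tf_shift w (dir_deriv b \<phi>)" vs c] S S' vs
      by (simp add: iter_deriv_append dir_deriv_tf_shift[OF S] schwartz_tf_shift c_def)
    then have "norm y ^ k * cmod (iter_deriv (vs @ [b]) (tf_shift w \<phi>) y)
       \<le> norm y ^ k * (cmod c * cmod (?d) + cmod (?d'))"
      by (auto intro!: mult_left_mono simp flip: norm_mult simp: norm_triangle_ineq)
    also have "\<dots> = cmod c * (norm y ^ k * cmod (?d)) + norm y ^ k * cmod (?d')"
      by (simp add: algebra_simps)
    also have "\<dots> \<le> (2 * pi * (1 + norm w)) * (C1 * ?W) + C2 * ?W"
      using c by (intro add_mono mult_mono C1 C2) auto
    also have "\<dots> \<le> (2 * pi * (1 + norm w)) * (C1 * ?W) + C2 * ((1 + norm w) * ?W)"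
      using C2(1) mult_right_mono[of 1 "1 + norm w" "?W"]
      by (intro add_left_mono mult_left_mono) auto
    also have "\<dots> = (2 * pi * C1 + C2) * (1 + norm w) ^ (k + length (vs @ [b]))"
      by (simp add: algebra_simps)
    finally show ?thesis .
  qed
  moreover have "2 * pi * C1 + C2 > 0" using C1(1) C2(1) by (simp add: add_pos_pos)
  ultimately show ?case by blast
qed

section \<open>The Gaussian as a Schwartz function\<close>

definition gauss :: "'a::euclidean_space \<Rightarrow> complex" where
  "gauss x = complex_of_real (exp (- pi * (x \<bullet> x)))"

text \<open>Gaussian times a product of linear forms: a family containing \<open>gauss\<close> whose
  span is closed under differentiation. Adding one linear form at a time matches the product rule in
  the induction.\<close>

inductive_set gauss_poly :: "('a::euclidean_space \<Rightarrow> complex) set" where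
  gauss_poly_gauss: "gauss \<in> gauss_poly"
| gauss_poly_mult: "\<phi> \<in> gauss_poly \<Longrightarrow> (\<lambda>x. complex_of_real (v \<bullet> x) * \<phi> x) \<in> gauss_poly"

lemma fspan_gauss_poly_mult:
  "\<phi> \<in> fspan gauss_poly \<Longrightarrow> (\<lambda>x. complex_of_real (v \<bullet> x) * \<phi> x) \<in> fspan gauss_poly"
proof (induction \<phi> rule: fspan.induct)
  case fspan_zero
  then show ?case by (simp add: fspan.fspan_zero)
next
  case (fspan_step \<phi> \<psi> c)
  have "(\<lambda>x. c * (complex_of_real (v \<bullet> x) * \<phi> x) + complex_of_real (v \<bullet> x) * \<psi> x) \<in> fspan gauss_poly"
    using fspan_step by (intro fspan.fspan_step gauss_poly_mult) auto
  then show ?case by (simp add: algebra_simps)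
qed

text \<open>From \<open>t / k \<le> exp (t / k)\<close> one gets
  \<open>t ^ k \<le> k ^ k * exp t\<close>, and the exponent left over,
  \<open>t - pi * t ^ 2\<close>, never exceeds 1.\<close>

lemma power_gauss_bound: "(t::real) \<ge> 0 \<Longrightarrow> t ^ k * exp (- pi * t\<^sup>2) \<le> real k ^ k * exp 1"
proof -
  assume t: "t \<ge> 0"
  have "t ^ k \<le> real k ^ k * exp t"
  proof (cases "k = 0")
    case False
    have "(t / k) ^ k \<le> exp (t / k) ^ k"
      using t by (intro power_mono) (auto intro: order_trans[OF _ exp_ge_add_one_self])
    also have "\<dots> = exp t" using False by (simp flip: exp_of_nat_mult)
    finally show ?thesis using False by (simp add: power_divide field_simps)
  qed (use t in auto)
  moreover have "t - pi * t\<^sup>2 \<le> 1"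
  proof -
    have "t\<^sup>2 \<le> pi * t\<^sup>2"
      using pi_gt3 by (intro mult_le_cancel_right1[THEN iffD2]) auto
    moreover have "t - t\<^sup>2 \<le> 1"
      using zero_le_power2[of "t - 1"] t by (simp add: power2_eq_square algebra_simps)
    ultimately show ?thesis by linarith
  qed
  ultimately have "t ^ k * exp (- pi * t\<^sup>2) \<le> real k ^ k * exp t * exp (- pi * t\<^sup>2)"
    by (intro mult_right_mono) auto
  also have "\<dots> = real k ^ k * exp (t - pi * t\<^sup>2)" by (simp add: exp_diff exp_minus field_simps)
  also have "\<dots> \<le> real k ^ k * exp 1"
    using \<open>t - pi * t\<^sup>2 \<le> 1\<close> by (intro mult_left_mono) auto
  finally show ?thesis .
qed

lemma gauss_schwartz: "(gauss :: 'a::euclidean_space \<Rightarrow> complex) \<in> \<S>"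
proof -
  have *: "(\<forall>x. \<phi> differentiable (at x)) \<and> (\<forall>b. dir_deriv b \<phi> \<in> fspan gauss_poly) \<and>
     (\<forall>k. \<exists>C. \<forall>x. norm x ^ k * cmod (\<phi> x) \<le> C)" if "\<phi> \<in> gauss_poly" for \<phi> :: "'a \<Rightarrow> complex"
    using that
  proof (induction \<phi> rule: gauss_poly.induct)
    case gauss_poly_gauss
    have D: "(gauss has_derivative (\<lambda>v. (- 2 * pi) * (complex_of_real (v \<bullet> x) * gauss x))) (at x)" for x :: 'a
      unfolding gauss_def [abs_def]
      by (auto intro!: derivative_eq_intros simp: algebra_simps inner_commute)
    have "(\<lambda>x. (- 2 * pi) * (complex_of_real (b \<bullet> x) * gauss x)) \<in> fspan gauss_poly" for b :: 'a
      by (intro fspan_cmult fspan_base gauss_poly.intros)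
    moreover have "norm x ^ k * cmod (gauss x) \<le> real k ^ k * exp 1" for k and x :: 'a
      using power_gauss_bound[of "norm x" k]
      by (simp add: gauss_def power2_norm_eq_inner)
    ultimately show ?case
      unfolding dir_derivI[OF D] using D differentiable_def by (intro conjI allI) blast+
  next
    case (gauss_poly_mult \<phi> v)
    then have d: "(\<phi> has_derivative frechet_derivative \<phi> (at x)) (at x)" for x
      using frechet_derivative_works by blast
    have D: "((\<lambda>x. complex_of_real (v \<bullet> x) * \<phi> x) has_derivative
      (\<lambda>w. complex_of_real (v \<bullet> w) * \<phi> x + complex_of_real (v \<bullet> x) * frechet_derivative \<phi> (at x) w)) (at x)" for x
      by (auto intro!: derivative_eq_intros d simp: algebra_simps)
    have "(\<lambda>x. complex_of_real (v \<bullet> b) * \<phi> x + complex_of_real (v \<bullet> x) * dir_deriv b \<phi> x) \<in> fspan gauss_poly" for b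
      using gauss_poly_mult by (intro fspan_lincomb fspan_gauss_poly_mult) (auto intro: fspan_base)
    moreover have "\<exists>C. \<forall>x. norm x ^ k * cmod (complex_of_real (v \<bullet> x) * \<phi> x) \<le> C" for k
    proof -
      obtain C where C: "\<And>x. norm x ^ Suc k * cmod (\<phi> x) \<le> C"
        using gauss_poly_mult by metis
      have "norm x ^ k * cmod (complex_of_real (v \<bullet> x) * \<phi> x) \<le> norm v * C" for x
      proof -
        have "norm x ^ k * cmod (complex_of_real (v \<bullet> x) * \<phi> x) \<le> norm x ^ k * ((norm v * norm x) * cmod (\<phi> x))"
          by (auto simp: norm_mult intro!: mult_left_mono mult_right_mono Cauchy_Schwarz_ineq2)
        also have "\<dots> = norm v * (norm x ^ Suc k * cmod (\<phi> x))" by simp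
        also have "\<dots> \<le> norm v * C" by (intro mult_left_mono C) auto
        finally show ?thesis .
      qed
      then show ?thesis by blast
    qed
    ultimately show ?case
      unfolding dir_derivI[OF D] using D differentiable_def by blast
  qed
  have "fspan (gauss_poly :: ('a \<Rightarrow> complex) set) \<subseteq> \<S>"
    by (rule schwartz_spanI) (use * in blast)+
  then show ?thesis
    using fspan_base[OF gauss_poly_gauss] by blast
qed

section \<open>Superpositions of time-frequency shifts\<close>

lemma schwartz_lipschitz:
  fixes \<phi> :: "'a::euclidean_space \<Rightarrow> complex"
  assumes S: "\<phi> \<in> \<S>" and C: "\<And>b x. b \<in> Basis \<Longrightarrow> cmod (dir_deriv b \<phi> x) \<le> C"
  shows "cmod (\<phi> x - \<phi> y) \<le> (real DIM('a) * C) * norm (x - y)"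
proof (rule differentiable_bound[of UNIV])
  fix z :: 'a
  let ?D = "frechet_derivative \<phi> (at z)"
  show "(\<phi> has_derivative ?D) (at z within UNIV)"
    using schwartz_has_derivative[OF S] by simp
  then have lin: "linear ?D" using has_derivative_linear by auto
  show "onorm ?D \<le> real DIM('a) * C"
  proof (rule onorm_le)
    fix v :: 'a
    have "?D v = (\<Sum>b\<in>Basis. (v \<bullet> b) *\<^sub>R ?D b)"
      using lin by (subst euclidean_representation[of v, symmetric]) (simp add: linear_sum linear_scale)
    then have "cmod (?D v) = cmod (\<Sum>b\<in>Basis. (v \<bullet> b) *\<^sub>R ?D b)"
      by (rule arg_cong)
    also have "\<dots> \<le> (\<Sum>b\<in>Basis. cmod ((v \<bullet> b) *\<^sub>R ?D b))"
      by (rule norm_sum)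
    also have "\<dots> \<le> (\<Sum>b\<in>(Basis::'a set). norm v * C)"
      using C by (intro sum_mono) (auto intro!: mult_mono Basis_le_norm)
    finally show "cmod (?D v) \<le> real DIM('a) * C * norm v" by (simp add: mult_ac)
  qed
qed auto

text \<open>Bounded second derivatives make a difference quotient of fixed step \<open>d\<close>
  approximate the derivative within \<open>L * d\<close>, uniformly in \<open>n\<close>. For fixed
  \<open>d\<close> the quotient tends to 0, and \<open>d\<close> may be as small as desired.\<close>

lemma schwartz_dir_deriv_tendsto_0:
  fixes v :: "nat \<Rightarrow> 'a::euclidean_space \<Rightarrow> complex"
  assumes S: "\<And>n. v n \<in> \<S>" and b: "b \<in> Basis"
    and C: "\<And>n c x. c \<in> Basis \<Longrightarrow> cmod (dir_deriv c (dir_deriv b (v n)) x) \<le> C"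
    and lim: "\<And>x. (\<lambda>n. v n x) \<longlonglongrightarrow> 0"
  shows "(\<lambda>n. dir_deriv b (v n) x) \<longlonglongrightarrow> 0"
proof (rule tendstoI)
  fix e :: real assume e: "e > 0"
  define L where "L = real DIM('a) * C"
  obtain c :: 'a where "c \<in> Basis" using nonempty_Basis by blast
  then have "C \<ge> 0" using C[of c undefined x] norm_ge_zero order_trans by blast
  then have L: "L \<ge> 0" by (simp add: L_def)
  \<comment> \<open>Gives \<open>L * d < e / 2\<close>; the summand 1 keeps the denominator positive
    when \<open>L = 0\<close>.\<close>
  define d where "d = e / (2 * (L + 1))"
  have d: "d > 0" and Ld: "L * d < e / 2"
    using e L by (auto simp: d_def field_simps)
  have lip: "cmod (dir_deriv b (v n) y - dir_deriv b (v n) z) \<le> L * norm (y - z)" for n y z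
    unfolding L_def by (rule schwartz_lipschitz[OF schwartz_dir_deriv[OF S b] C])
  have main: "d * cmod (dir_deriv b (v n) x) \<le> cmod (v n (x + d *\<^sub>R b)) + cmod (v n x) + L * d * d" for n
  proof -
    define D where "D = dir_deriv b (v n) x"
    \<comment> \<open>After the linear part is subtracted, the derivative of \<open>g\<close> is
      only the variation of the directional derivative along the segment, at most
      \<open>L * d\<close>.\<close>
    define g where "g s = v n (x + s *\<^sub>R b) - s *\<^sub>R D" for s :: real
    have "cmod (g d - g 0) \<le> (L * d) * norm (d - 0)"
    proof (rule differentiable_bound[of "{0..d}"])
      fix s assume s: "s \<in> {0..d}"
      show "(g has_derivative (\<lambda>h. h *\<^sub>R (dir_deriv b (v n) (x + s *\<^sub>R b) - D))) (at s within {0..d})"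
        unfolding g_def
        by (auto intro!: derivative_eq_intros schwartz_has_derivative_line[OF S] simp: scaleR_diff_right)
      show "onorm (\<lambda>h. h *\<^sub>R (dir_deriv b (v n) (x + s *\<^sub>R b) - D)) \<le> L * d"
      proof (rule onorm_le)
        fix h :: real
        have "cmod (dir_deriv b (v n) (x + s *\<^sub>R b) - D) \<le> L * norm (x + s *\<^sub>R b - x)"
          unfolding D_def by (rule lip)
        also have "\<dots> \<le> L * d" using s b L by (intro mult_left_mono) auto
        finally show "cmod (h *\<^sub>R (dir_deriv b (v n) (x + s *\<^sub>R b) - D)) \<le> L * d * norm h"
          by (simp add: mult.commute mult_left_mono)
      qed
    qed (use d in auto)
    then have 1: "cmod (v n (x + d *\<^sub>R b) - d *\<^sub>R D - v n x) \<le> L * d * d"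
      using d by (simp add: g_def)
    have "d * cmod D = cmod (v n (x + d *\<^sub>R b) - v n x - (v n (x + d *\<^sub>R b) - d *\<^sub>R D - v n x))"
      using d by simp
    also have "\<dots> \<le> cmod (v n (x + d *\<^sub>R b)) + cmod (v n x) + cmod (v n (x + d *\<^sub>R b) - d *\<^sub>R D - v n x)"
      by (intro order_trans[OF norm_triangle_ineq4] add_right_mono) auto
    finally show ?thesis using 1 by (simp add: D_def)
  qed
  have "(\<lambda>n. cmod (v n (x + d *\<^sub>R b)) + cmod (v n x)) \<longlonglongrightarrow> 0"
    using tendsto_add[OF tendsto_norm[OF lim] tendsto_norm[OF lim]] by simp
  moreover have "d * (e / 2) > 0" using d e by simp
  ultimately have "eventually (\<lambda>n. cmod (v n (x + d *\<^sub>R b)) + cmod (v n x) < d * (e / 2)) sequentially"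
    using order_tendstoD(2) by blast
  then show "eventually (\<lambda>n. dist (dir_deriv b (v n) x) 0 < e) sequentially"
  proof eventually_elim
    case (elim n)
    have "d * cmod (dir_deriv b (v n) x) < d * (e / 2) + (L * d) * d"
      using main[of n] elim by linarith
    also have "\<dots> \<le> d * (e / 2) + (e / 2) * d"
      using Ld d by (intro add_left_mono mult_right_mono) auto
    also have "\<dots> = d * e" by (simp add: field_simps)
    finally show ?case using d by simp
  qed
qed

text \<open>Outside a large ball the one extra power of \<open>norm x\<close> makes the expression
  small for every \<open>n\<close>; inside, the common Lipschitz constant reduces the claim to
  finitely many points.\<close>

lemma schwartz_uniform_tendsto_0:
  fixes v :: "nat \<Rightarrow> 'a::euclidean_space \<Rightarrow> complex"
  assumes S: "\<And>n. v n \<in> \<S>"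
    and C1: "\<And>n c x. c \<in> Basis \<Longrightarrow> cmod (dir_deriv c (v n) x) \<le> C1"
    and C2: "\<And>n x. norm x ^ Suc k * cmod (v n x) \<le> C2"
    and lim: "\<And>x. (\<lambda>n. v n x) \<longlonglongrightarrow> 0" and e: "e > 0"
  shows "\<forall>\<^sub>F n in sequentially. \<forall>x. norm x ^ k * cmod (v n x) \<le> e"
proof -
  define L where "L = real DIM('a) * C1"
  obtain c :: 'a where "c \<in> Basis" using nonempty_Basis by blast
  then have "C1 \<ge> 0" using C1[of c undefined 0] norm_ge_zero order_trans by blast
  then have L: "L \<ge> 0" by (simp add: L_def)
  have "C2 \<ge> 0" using C2[of 0 undefined] by simp
  \<comment> \<open>Chosen so that \<open>C2 \<le> R * e\<close>, which settles the points outside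
    the ball, and so that \<open>R \<ge> 1\<close>.\<close>
  define R where "R = C2 / e + 1"
  have R: "R \<ge> 1" using e \<open>C2 \<ge> 0\<close> by (simp add: R_def)
  \<comment> \<open>Moving by \<open>d\<close> changes \<open>v n\<close> by at most
    \<open>L * d\<close>; even after multiplication by the largest weight \<open>R ^ k\<close> this
    stays below \<open>e / 2\<close>.\<close>
  define d where "d = e / (2 * R ^ k * (L + 1))"
  have d: "d > 0" using e L R by (auto simp: d_def intro!: divide_pos_pos mult_pos_pos)
  have Ld: "R ^ k * (L * d) \<le> e / 2"
  proof -
    have "r * (L * (e / (2 * r * q))) = (e / 2) * (L / q)" if "r \<noteq> 0" for r q :: real
      using that by simp
    from this[of "R ^ k" "L + 1"] have "R ^ k * (L * d) = (e / 2) * (L / (L + 1))"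
      using R by (simp add: d_def)
    also have "\<dots> \<le> e / 2 * 1" using L e by (intro mult_left_mono) (auto simp: field_simps)
    finally show ?thesis by simp
  qed
  have "\<exists>T. finite T \<and> cball (0::'a) R \<subseteq> (\<Union>t\<in>T. ball t d)"
    by (rule compact_eq_totally_bounded[THEN iffD1, THEN conjunct2, rule_format, OF compact_cball d])
  then obtain T where T: "finite T" "cball (0::'a) R \<subseteq> (\<Union>t\<in>T. ball t d)"
    by (elim exE conjE)
  have "\<forall>\<^sub>F n in sequentially. \<forall>t\<in>T. cmod (v n t) < e / (2 * R ^ k)"
  proof (rule eventually_ball_finite[OF T(1)], rule ballI)
    fix t
    have "e / (2 * R ^ k) > 0" using e R by (auto intro!: divide_pos_pos)
    then show "\<forall>\<^sub>F n in sequentially. cmod (v n t) < e / (2 * R ^ k)"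
      using order_tendstoD(2)[OF tendsto_norm[OF lim]] by simp
  qed
  then show ?thesis
  proof eventually_elim
    case (elim n)
    show ?case
    proof
      fix x :: 'a
      show "norm x ^ k * cmod (v n x) \<le> e"
      proof (cases "norm x \<le> R")
        case True
        then obtain t where t: "t \<in> T" "dist t x < d" using T(2) by (auto simp: subset_iff)
        have "cmod (v n x - v n t) \<le> L * norm (x - t)"
          unfolding L_def by (rule schwartz_lipschitz[OF S C1])
        also have "\<dots> \<le> L * d" using t L by (intro mult_left_mono) (auto simp: dist_norm norm_minus_commute)
        finally have "cmod (v n x) \<le> e / (2 * R ^ k) + L * d"
          using elim t(1) norm_triangle_sub[of "v n x" "v n t"] by fastforce
        then have "norm x ^ k * cmod (v n x) \<le> R ^ k * (e / (2 * R ^ k) + L * d)"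
          using True R by (intro mult_mono power_mono) auto
        also have "\<dots> \<le> e" using Ld R by (simp add: distrib_left)
        finally show ?thesis .
      next
        case False
        then have "R * (norm x ^ k * cmod (v n x)) \<le> norm x * (norm x ^ k * cmod (v n x))"
          by (intro mult_right_mono) auto
        also have "\<dots> \<le> C2" using C2[of x n] by (simp add: mult_ac)
        also have "\<dots> \<le> R * e" using e by (simp add: R_def field_simps)
        finally show ?thesis using R by simp
      qed
    qed
  qed
qed

text \<open>Montel property: on a bounded set of Schwartz functions, pointwise convergence is convergence
  in every seminorm, because each derivative is controlled by the next ones.\<close>

definition schwartz_bounded :: "('a::euclidean_space \<Rightarrow> complex) set \<Rightarrow> bool" where
  "schwartz_bounded F \<longleftrightarrow> F \<subseteq> \<S> \<and>
     (\<forall>vs k. set vs \<subseteq> Basis \<longrightarrow> (\<exists>C. \<forall>\<phi>\<in>F. \<forall>x. norm x ^ k * cmod (iter_deriv vs \<phi> x) \<le> C))"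

lemma tempered_tendsto_0:
  fixes u :: "nat \<Rightarrow> 'a::euclidean_space \<Rightarrow> complex"
  assumes f: "tempered_distribution f" and u: "schwartz_bounded (range u)"
    and lim: "\<And>x. (\<lambda>n. u n x) \<longlonglongrightarrow> 0"
  shows "(\<lambda>n. f (u n)) \<longlonglongrightarrow> 0"
proof -
  have S: "u n \<in> \<S>" for n using u unfolding schwartz_bounded_def by blast
  have B: "\<exists>C. \<forall>n x. norm x ^ k * cmod (iter_deriv vs (u n) x) \<le> C" if "set vs \<subseteq> Basis" for k vs
    using u that unfolding schwartz_bounded_def by (metis rangeI)
  have B1: "\<exists>C. \<forall>c n x. c \<in> Basis \<longrightarrow> cmod (dir_deriv c (iter_deriv vs (u n)) x) \<le> C" if vs: "set vs \<subseteq> Basis" for vs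
  proof -
    have "\<exists>C. \<forall>n x. cmod (iter_deriv (c # vs) (u n) x) \<le> C" if "c \<in> Basis" for c
      using B[of "c # vs" 0] vs that by simp
    then obtain C where C: "\<And>c n x. c \<in> Basis \<Longrightarrow> cmod (iter_deriv (c # vs) (u n) x) \<le> C c"
      by metis
    have "cmod (dir_deriv c (iter_deriv vs (u n)) x) \<le> Max (C ` Basis)" if "c \<in> Basis" for c n x
      using C[OF that, of n x] that by (auto intro: order_trans[OF _ Max_ge])
    then show ?thesis by blast
  qed
  have ptw: "(\<lambda>n. iter_deriv vs (u n) x) \<longlonglongrightarrow> 0" if "set vs \<subseteq> Basis" for vs x
    using that
  proof (induction vs arbitrary: x)
    case (Cons b vs)
    have b: "b \<in> Basis" and vs: "set vs \<subseteq> Basis" using Cons.prems by auto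
    obtain C where "\<And>c n x. c \<in> Basis \<Longrightarrow> cmod (dir_deriv c (iter_deriv (b # vs) (u n)) x) \<le> C"
      using B1[OF Cons.prems] by metis
    then show ?case
      using schwartz_dir_deriv_tendsto_0[of "\<lambda>n. iter_deriv vs (u n)" b C x]
        schwartz_iter_deriv[OF S vs] b Cons.IH[OF vs] by simp
  qed (simp add: lim)
  have semi: "(\<lambda>n. schwartz_seminorm k vs (u n)) \<longlonglongrightarrow> 0" if vs: "set vs \<subseteq> Basis" for k vs
  proof (rule tendstoI)
    fix e :: real assume "e > 0"
    obtain C where C': "\<And>c n x. c \<in> Basis \<Longrightarrow> cmod (dir_deriv c (iter_deriv vs (u n)) x) \<le> C"
      using B1[OF vs] by metis
    obtain C2 where C2: "\<And>n x. norm x ^ Suc k * cmod (iter_deriv vs (u n) x) \<le> C2"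
      using B[OF vs] by metis
    have "\<forall>\<^sub>F n in sequentially. \<forall>x. norm x ^ k * cmod (iter_deriv vs (u n) x) \<le> e / 2"
      by (rule schwartz_uniform_tendsto_0[OF schwartz_iter_deriv[OF S vs] C' C2 ptw[OF vs]])
        (use \<open>e > 0\<close> in auto)
    then show "\<forall>\<^sub>F n in sequentially. dist (schwartz_seminorm k vs (u n)) 0 < e"
    proof eventually_elim
      case (elim n)
      have "schwartz_seminorm k vs (u n) \<le> e / 2"
        unfolding schwartz_seminorm_def using elim by (intro cSUP_least) auto
      \<comment> \<open>A real supremum is informative only for a set that is bounded above, so even
        nonnegativity relies on the bound from \<open>elim\<close>.\<close>
      moreover have "0 \<le> schwartz_seminorm k vs (u n)"
        unfolding schwartz_seminorm_def
      proof (rule cSUP_upper2[of _ _ 0])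
        show "bdd_above (range (\<lambda>x. norm x ^ k * cmod (iter_deriv vs (u n) x)))"
          using elim by (intro bdd_aboveI2) blast
      qed auto
      ultimately show ?case using \<open>e > 0\<close> by (simp add: dist_real_def)
    qed
  qed
  obtain C N where CN: "\<forall>\<phi>\<in>\<S>.
      cmod (f \<phi>) \<le> C * (\<Sum>k\<le>N. \<Sum>vs | set vs \<subseteq> Basis \<and> length vs \<le> N. schwartz_seminorm k vs \<phi>)"
    using f unfolding tempered_distribution_def by (elim conjE exE)
  have "(\<lambda>n. C * (\<Sum>k\<le>N. \<Sum>vs | set vs \<subseteq> Basis \<and> length vs \<le> N. schwartz_seminorm k vs (u n))) \<longlonglongrightarrow> 0"
    by (intro tendsto_mult_right_zero tendsto_null_sum) (auto intro: semi)
  then show ?thesis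
    by (rule Lim_null_comparison[rotated]) (use CN S in auto)
qed

lemma tempered_add:
  "tempered_distribution f \<Longrightarrow> \<phi> \<in> \<S> \<Longrightarrow> \<psi> \<in> \<S> \<Longrightarrow>
    f (\<lambda>x. \<phi> x + \<psi> x) = f \<phi> + f \<psi>"
  unfolding tempered_distribution_def by blast

lemma tempered_cmult:
  "tempered_distribution f \<Longrightarrow> \<phi> \<in> \<S> \<Longrightarrow> f (\<lambda>x. c * \<phi> x) = c * f \<phi>"
  unfolding tempered_distribution_def by blast

lemma tempered_sum:
  assumes f: "tempered_distribution f" and "finite I" "\<And>i. i \<in> I \<Longrightarrow> \<phi> i \<in> \<S>"
  shows "f (\<lambda>x. \<Sum>i\<in>I. c i * \<phi> i x) = (\<Sum>i\<in>I. c i * f (\<phi> i))"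
  using assms(2,3)
proof (induction I rule: finite_induct)
  case empty
  then show ?case using tempered_cmult[OF f schwartz_zero, of 0] by simp
next
  case (insert i I)
  then show ?case
    by (simp add: tempered_add[OF f] schwartz_cmult schwartz_sum tempered_cmult[OF f])
qed

lemma tempered_tendsto:
  fixes u :: "nat \<Rightarrow> 'a::euclidean_space \<Rightarrow> complex"
  assumes f: "tempered_distribution f" and u: "schwartz_bounded (range u)" and v: "v \<in> \<S>"
    and lim: "\<And>x. (\<lambda>n. u n x) \<longlonglongrightarrow> v x"
  shows "(\<lambda>n. f (u n)) \<longlonglongrightarrow> f v"
proof -
  have S: "u n \<in> \<S>" for n using u unfolding schwartz_bounded_def by blast
  \<comment> \<open>The difference is spelled as \<open>- 1 * v x + u n x\<close> to fit
    \<open>iter_deriv_lincomb\<close> and \<open>schwartz_lincomb\<close>.\<close>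
  define w where "w n = (\<lambda>x. - 1 * v x + u n x)" for n
  have "schwartz_bounded (range w)"
    unfolding schwartz_bounded_def
  proof (intro conjI allI impI)
    show "range w \<subseteq> \<S>"
      unfolding w_def using schwartz_lincomb[OF v S] by blast
    fix vs :: "'a list" and k assume vs: "set vs \<subseteq> Basis"
    obtain C where C: "\<And>n x. norm x ^ k * cmod (iter_deriv vs (u n) x) \<le> C"
      using u vs unfolding schwartz_bounded_def by (metis rangeI)
    obtain C' where C': "\<And>x. norm x ^ k * cmod (iter_deriv vs v x) \<le> C'"
      using schwartz_power_bound[OF schwartz_iter_deriv[OF v vs]] by metis
    have "norm x ^ k * cmod (iter_deriv vs (w n) x) \<le> C + C'" for n x
    proof -
      have "norm x ^ k * cmod (iter_deriv vs (w n) x)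
          \<le> norm x ^ k * (cmod (iter_deriv vs (u n) x) + cmod (iter_deriv vs v x))"
        unfolding w_def iter_deriv_lincomb[OF v S vs]
        using norm_triangle_ineq4[of "iter_deriv vs (u n) x" "iter_deriv vs v x"]
        by (intro mult_left_mono) auto
      then show ?thesis using C[of x n] C'[of x] by (simp add: distrib_left)
    qed
    then show "\<exists>C. \<forall>\<phi>\<in>range w. \<forall>x. norm x ^ k * cmod (iter_deriv vs \<phi> x) \<le> C" by blast
  qed
  moreover have "(\<lambda>n. w n x) \<longlonglongrightarrow> 0" for x
    using tendsto_diff[OF lim[of x] tendsto_const[of "v x"]] by (simp add: w_def)
  ultimately have "(\<lambda>n. f (w n)) \<longlonglongrightarrow> 0" by (rule tempered_tendsto_0[OF f])
  moreover have "f (w n) = f (u n) - f v" for n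
    unfolding w_def
    using tempered_add[OF f schwartz_cmult[OF v, of "- 1"] S] tempered_cmult[OF f v, of "- 1"] by simp
  ultimately show ?thesis by (simp add: LIM_zero_iff)
qed

section \<open>Combinations of time-frequency shifts and their limits\<close>

lemma iter_deriv_sum:
  assumes "finite I" "\<And>i. i \<in> I \<Longrightarrow> \<phi> i \<in> \<S>" "set vs \<subseteq> Basis"
  shows "iter_deriv vs (\<lambda>x. \<Sum>i\<in>I. c i * \<phi> i x) = (\<lambda>x. \<Sum>i\<in>I. c i * iter_deriv vs (\<phi> i) x)"
  using assms(1,2)
proof (induction I rule: finite_induct)
  case empty
  have "iter_deriv vs (\<lambda>x. - 1 * (\<lambda>_. 0) x + (\<lambda>_. 0) x) = (\<lambda>x. - 1 * iter_deriv vs (\<lambda>_. 0) x + iter_deriv vs (\<lambda>_. 0) x)"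
    by (rule iter_deriv_lincomb[OF schwartz_zero schwartz_zero assms(3)])
  then show ?case by simp
next
  case (insert i I)
  then show ?case
    by (simp add: iter_deriv_lincomb[OF _ _ assms(3)] schwartz_sum)
qed

text \<open>A shift by \<open>w\<close> costs a factor \<open>(1 + norm w) ^ (k + length vs)\<close>
  in the corresponding seminorm, so uniform bounds on all moments of the coefficients bound all
  seminorms uniformly.\<close>

lemma schwartz_bounded_tf_combination:
  fixes G :: "'a::euclidean_space \<Rightarrow> complex" and V :: "nat \<Rightarrow> 'i set"
  assumes G: "G \<in> \<S>" and fin: "\<And>n. finite (V n)"
    and mom: "\<And>m. \<exists>D. \<forall>n. (\<Sum>i\<in>V n. cmod (c n i) * (1 + norm (W n i)) ^ m) \<le> D"
  shows "schwartz_bounded (range (\<lambda>n x. \<Sum>i\<in>V n. c n i * tf_shift (W n i) G x))"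
  unfolding schwartz_bounded_def
proof (intro conjI allI impI)
  show "range (\<lambda>n x. \<Sum>i\<in>V n. c n i * tf_shift (W n i) G x) \<subseteq> \<S>"
    using schwartz_sum[OF fin schwartz_tf_shift[OF G]] by blast
  fix vs :: "'a list" and k assume vs: "set vs \<subseteq> Basis"
  obtain C where C: "C > 0" "\<And>w y. norm y ^ k * cmod (iter_deriv vs (tf_shift w G) y) \<le> C * (1 + norm w) ^ (k + length vs)"
    using tf_shift_seminorm_bound[OF G vs] by metis
  obtain D where D: "\<And>n. (\<Sum>i\<in>V n. cmod (c n i) * (1 + norm (W n i)) ^ (k + length vs)) \<le> D"
    using mom by metis
  have "norm x ^ k * cmod (iter_deriv vs (\<lambda>x. \<Sum>i\<in>V n. c n i * tf_shift (W n i) G x) x) \<le> C * D" for n x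
  proof -
    have "cmod (iter_deriv vs (\<lambda>x. \<Sum>i\<in>V n. c n i * tf_shift (W n i) G x) x)
        \<le> (\<Sum>i\<in>V n. cmod (c n i) * cmod (iter_deriv vs (tf_shift (W n i) G) x))"
      unfolding iter_deriv_sum[OF fin schwartz_tf_shift[OF G] vs]
      by (rule order_trans[OF norm_sum]) (simp add: norm_mult)
    then have "norm x ^ k * cmod (iter_deriv vs (\<lambda>x. \<Sum>i\<in>V n. c n i * tf_shift (W n i) G x) x)
        \<le> norm x ^ k * (\<Sum>i\<in>V n. cmod (c n i) * cmod (iter_deriv vs (tf_shift (W n i) G) x))"
      by (rule mult_left_mono) auto
    also have "\<dots> = (\<Sum>i\<in>V n. cmod (c n i) * (norm x ^ k * cmod (iter_deriv vs (tf_shift (W n i) G) x)))"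
      by (simp add: sum_distrib_left mult_ac)
    also have "\<dots> \<le> (\<Sum>i\<in>V n. cmod (c n i) * (C * (1 + norm (W n i)) ^ (k + length vs)))"
      by (intro sum_mono mult_left_mono C(2)) auto
    also have "\<dots> = C * (\<Sum>i\<in>V n. cmod (c n i) * (1 + norm (W n i)) ^ (k + length vs))"
      by (simp add: sum_distrib_left mult_ac)
    also have "\<dots> \<le> C * D" using C(1) D by (intro mult_left_mono) auto
    finally show ?thesis .
  qed
  then show "\<exists>C. \<forall>\<phi>\<in>range (\<lambda>n x. \<Sum>i\<in>V n. c n i * tf_shift (W n i) G x).
        \<forall>x. norm x ^ k * cmod (iter_deriv vs \<phi> x) \<le> C" by blast
qed

lemma tf_shift_continuous:
  assumes "G \<in> \<S>"
  shows "continuous_on UNIV (\<lambda>w. tf_shift w G y)"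
proof -
  have "continuous_on UNIV (\<lambda>w. G (y - fst w))"
    by (rule continuous_on_compose2[OF schwartz_continuous[OF assms]]) (auto intro!: continuous_intros)
  then show ?thesis
    unfolding tf_shift_def cis_conv_exp by (auto intro!: continuous_intros)
qed

text \<open>Along a convergent sequence the shifts are bounded, so the shifted windows form a
  bounded set, on which pointwise convergence suffices. Continuity jointly in position and frequency
  later supplies the measurability that the mixed norms require.\<close>

lemma tempered_tf_shift_continuous:
  fixes G :: "'a::euclidean_space \<Rightarrow> complex"
  assumes f: "tempered_distribution f" and G: "G \<in> \<S>"
  shows "continuous_on UNIV (\<lambda>w. f (tf_shift w G))"
  unfolding continuous_on_sequentially
proof (clarsimp simp: o_def)
  fix u :: "nat \<Rightarrow> 'a \<times> 'a" and w
  assume u: "u \<longlonglongrightarrow> w"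
  obtain K where K: "\<And>n. norm (u n) \<le> K"
    using convergent_imp_Bseq[OF convergentI[OF u]] by (auto simp: Bseq_def)
  \<comment> \<open>A single shifted window is treated as a combination with one term, indexed by
    the unit type.\<close>
  have "\<exists>D. \<forall>n. (\<Sum>i\<in>{()}. cmod 1 * (1 + norm (u n)) ^ m) \<le> D" for m
    using K by (auto intro!: exI[of _ "(1 + K) ^ m"] power_mono)
  from schwartz_bounded_tf_combination[OF G _ this]
  have "schwartz_bounded (range (\<lambda>n. tf_shift (u n) G))" by simp
  then show "(\<lambda>n. f (tf_shift (u n) G)) \<longlonglongrightarrow> f (tf_shift w G)"
  proof (rule tempered_tendsto[OF f _ schwartz_tf_shift[OF G]])
    show "(\<lambda>n. tf_shift (u n) G x) \<longlonglongrightarrow> tf_shift w G x" for x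
      by (rule continuous_on_tendsto_compose[OF tf_shift_continuous[OF G] u]) auto
  qed
qed

text \<open>A shift translates first and modulates afterwards; moving the inner modulation past the
  outer translation leaves a unimodular factor. It disappears from every estimate, since only
  absolute values enter.\<close>

lemma tf_shift_tf_shift:
  "tf_shift z (tf_shift v G) y = cis (- (2 * pi * (snd v \<bullet> fst z))) * tf_shift (z + v) G y"
proof -
  have "cis (2 * pi * (snd z \<bullet> y)) * cis (2 * pi * (snd v \<bullet> (y - fst z)))
      = cis (- (2 * pi * (snd v \<bullet> fst z))) * cis (2 * pi * (snd (z + v) \<bullet> y))"
    unfolding cis_mult by (rule arg_cong[of _ _ cis]) (simp add: algebra_simps)
  then show ?thesis
    unfolding tf_shift_def by (simp only: mult.assoc[symmetric] diff_diff_eq fst_add)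
qed

lemma sum_indicator_singleton:
  fixes F :: "'a \<Rightarrow> 'b::real_algebra_1"
  assumes "finite V" "x \<in> V"
  shows "(\<Sum>v\<in>V. a * indicator {v} x * F v) = a * F x"
  using assms by (subst sum.remove[of _ x]) (auto intro!: sum.neutral simp: indicator_def of_bool_def split: if_splits)

lemma tf_shift_sum:
  "tf_shift z (\<lambda>y. \<Sum>v\<in>V. c v * tf_shift v G y)
    = (\<lambda>y. \<Sum>v\<in>V. (c v * cis (- (2 * pi * (snd v \<bullet> fst z)))) * tf_shift (z + v) G y)"
proof
  fix y
  have "tf_shift z (\<lambda>y. \<Sum>v\<in>V. c v * tf_shift v G y) y = (\<Sum>v\<in>V. c v * tf_shift z (tf_shift v G) y)"
    by (subst tf_shift_def) (simp add: sum_distrib_left tf_shift_def[of z] mult_ac)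
  then show "tf_shift z (\<lambda>y. \<Sum>v\<in>V. c v * tf_shift v G y) y
      = (\<Sum>v\<in>V. (c v * cis (- (2 * pi * (snd v \<bullet> fst z)))) * tf_shift (z + v) G y)"
    by (simp add: tf_shift_tf_shift mult_ac)
qed

text \<open>Replacing \<open>\<Theta>\<close> by simple functions makes \<open>H\<close> a limit of finite combinations of
  time-frequency shifts of \<open>G\<close>; by lemma \<open>tempered_tendsto\<close> the limit may be pulled out of \<open>f\<close>.\<close>

lemma superposition_approx:
  fixes G H :: "'a::euclidean_space \<Rightarrow> complex" and \<Theta> :: "'b \<Rightarrow> 'a \<times> 'a" and a :: "'b \<Rightarrow> complex"
  assumes G: "G \<in> \<S>" and H: "H \<in> \<S>"
    and a [measurable]: "a \<in> borel_measurable M" and \<Theta> [measurable]: "\<Theta> \<in> borel_measurable M"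
    and mom: "\<And>m. integrable M (\<lambda>w. cmod (a w) * (1 + norm (\<Theta> w)) ^ m)"
    and rep: "\<And>y. H y = (\<integral>w. a w * tf_shift (\<Theta> w) G y \<partial>M)"
  obtains V :: "nat \<Rightarrow> ('a \<times> 'a) set" and c :: "nat \<Rightarrow> 'a \<times> 'a \<Rightarrow> complex"
  where "\<And>n. finite (V n)" "\<And>n. (\<Sum>v\<in>V n. cmod (c n v)) \<le> (\<integral>w. cmod (a w) \<partial>M)"
    "\<And>f z. tempered_distribution f \<Longrightarrow>
       (\<lambda>n. f (tf_shift z (\<lambda>y. \<Sum>v\<in>V n. c n v * tf_shift v G y))) \<longlonglongrightarrow> f (tf_shift z H)"
proof -
  \<comment> \<open>The bound of \<open>s i w\<close> by twice \<open>norm (\<Theta> w)\<close> is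
    essential: it keeps all moments of the approximations under control uniformly in the
    index.\<close>
  obtain s where s: "\<And>i. simple_function M (s i)"
      "\<And>w. w \<in> space M \<Longrightarrow> (\<lambda>i. s i w) \<longlonglongrightarrow> \<Theta> w"
      "\<And>i w. w \<in> space M \<Longrightarrow> norm (s i w) \<le> 2 * norm (\<Theta> w)"
    using borel_measurable_implies_sequence_metric[OF \<Theta>, of 0]
    unfolding dist_norm diff_zero by metis
  have s_meas [measurable]: "s i \<in> borel_measurable M" for i
    using s(1) borel_measurable_simple_function by blast
  define V where "V n = s n ` space M" for n
  \<comment> \<open>Only the location \<open>\<Theta>\<close> is discretised, not the coefficient.
    Collecting the mass of \<open>a\<close> on each level set of \<open>s n\<close> makes the finite
    sum equal to the integral with \<open>s n\<close> in place of \<open>\<Theta>\<close>, and keeps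
    the total of the absolute values at most the integral of \<open>cmod (a w)\<close>.\<close>
  define c where "c n v = (\<integral>w. a w * indicator {v} (s n w) \<partial>M)" for n v
  have fin: "finite (V n)" for n
    unfolding V_def using s(1) simple_functionD(1) by blast
  have int_norm: "integrable M (\<lambda>w. cmod (a w))" using mom[of 0] by simp
  have int_ai: "integrable M (\<lambda>w. a w * indicator {v} (s n w))" for v n
    by (rule Bochner_Integration.integrable_bound[OF int_norm])
      (auto simp: norm_mult indicator_def intro!: AE_I2)
  have wbound: "(1 + norm (s n w)) ^ m \<le> 2 ^ m * (1 + norm (\<Theta> w)) ^ m" if "w \<in> space M" for n w m
    using s(3)[OF that, of n] by (auto simp: power_mult_distrib[symmetric] intro!: power_mono)
  have mom_bound: "(\<Sum>v\<in>V n. cmod (c n v) * (1 + norm v) ^ m)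
      \<le> (\<integral>w. cmod (a w) * (1 + norm (s n w)) ^ m \<partial>M)" for n m
  proof -
    have ni: "cmod (a w * indicator {v} (s n w)) = cmod (a w) * indicator {v} (s n w)" for w v
      by (simp add: norm_mult indicator_def)
    have i: "integrable M (\<lambda>w. cmod (a w) * indicator {v} (s n w) * (1 + norm v) ^ m)" for v
      using integrable_norm[OF int_ai[of v n]] unfolding ni by (rule integrable_mult_left)
    have "(\<Sum>v\<in>V n. cmod (c n v) * (1 + norm v) ^ m)
        \<le> (\<Sum>v\<in>V n. (\<integral>w. cmod (a w) * indicator {v} (s n w) \<partial>M) * (1 + norm v) ^ m)"
      using integral_norm_bound[of M "\<lambda>w. a w * indicator {v} (s n w)" for v]
      unfolding c_def ni by (intro sum_mono mult_right_mono) auto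
    also have "\<dots> = (\<integral>w. (\<Sum>v\<in>V n. cmod (a w) * indicator {v} (s n w) * (1 + norm v) ^ m) \<partial>M)"
      by (subst Bochner_Integration.integral_sum[OF i]) simp
    also have "\<dots> = (\<integral>w. cmod (a w) * (1 + norm (s n w)) ^ m \<partial>M)"
      by (intro Bochner_Integration.integral_cong refl)
        (rule sum_indicator_singleton[OF fin], simp add: V_def)
    finally show ?thesis .
  qed
  have mom_unif: "(\<integral>w. cmod (a w) * (1 + norm (s n w)) ^ m \<partial>M)
      \<le> (\<integral>w. 2 ^ m * (cmod (a w) * (1 + norm (\<Theta> w)) ^ m) \<partial>M)" for n m
  proof (rule integral_mono')
    show "integrable M (\<lambda>w. 2 ^ m * (cmod (a w) * (1 + norm (\<Theta> w)) ^ m))"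
      using mom by simp
    show "cmod (a w) * (1 + norm (s n w)) ^ m \<le> 2 ^ m * (cmod (a w) * (1 + norm (\<Theta> w)) ^ m)"
      if "w \<in> space M" for w
      using mult_left_mono[OF wbound[OF that, of n m], of "cmod (a w)"] by (simp add: mult_ac)
  qed auto
  show thesis
  proof (rule that[of V c])
    show "finite (V n)" for n by (rule fin)
    show "(\<Sum>v\<in>V n. cmod (c n v)) \<le> (\<integral>w. cmod (a w) \<partial>M)" for n
      using mom_bound[of n 0] by simp
    fix f :: "('a \<Rightarrow> complex) \<Rightarrow> complex" and z :: "'a \<times> 'a" assume f: "tempered_distribution f"
    show "(\<lambda>n. f (tf_shift z (\<lambda>y. \<Sum>v\<in>V n. c n v * tf_shift v G y))) \<longlonglongrightarrow> f (tf_shift z H)"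
    proof (rule tempered_tendsto[OF f _ schwartz_tf_shift[OF H]])
      show "schwartz_bounded (range (\<lambda>n. tf_shift z (\<lambda>y. \<Sum>v\<in>V n. c n v * tf_shift v G y)))"
        unfolding tf_shift_sum
      proof (rule schwartz_bounded_tf_combination[OF G fin])
        fix m
        \<comment> \<open>The outer shift moves a node \<open>v\<close> to \<open>z + v\<close>;
          submultiplicativity of the weight absorbs this into the factor
          \<open>(1 + norm z) ^ m\<close>.\<close>
        define D where "D = (1 + norm z) ^ m * (\<integral>w. 2 ^ m * (cmod (a w) * (1 + norm (\<Theta> w)) ^ m) \<partial>M)"
        have "(\<Sum>v\<in>V n. cmod (c n v * cis (- (2 * pi * (snd v \<bullet> fst z)))) * (1 + norm (z + v)) ^ m) \<le> D"
          (is "?s n \<le> D") for n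
        proof -
          have "(1 + norm (z + v)) ^ m \<le> (1 + norm z) ^ m * (1 + norm v) ^ m" for v
            using norm_le_weight[of "z + v" z] by (auto simp: power_mult_distrib[symmetric] intro!: power_mono)
          then have "?s n \<le> (\<Sum>v\<in>V n. cmod (c n v) * ((1 + norm z) ^ m * (1 + norm v) ^ m))"
            by (intro sum_mono mult_mono) (auto simp: norm_mult)
          also have "\<dots> = (1 + norm z) ^ m * (\<Sum>v\<in>V n. cmod (c n v) * (1 + norm v) ^ m)"
            by (simp add: sum_distrib_left mult_ac)
          also have "\<dots> \<le> D"
            unfolding D_def by (intro mult_left_mono order_trans[OF mom_bound mom_unif]) auto
          finally show ?thesis .
        qed
        then show "\<exists>D. \<forall>n. (\<Sum>v\<in>V n. cmod (c n v * cis (- (2 * pi * (snd v \<bullet> fst z)))) * (1 + norm (z + v)) ^ m) \<le> D" by blast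
      qed
      obtain B where B: "\<And>x. cmod (G x) \<le> B"
        using schwartz_power_bound[OF G, of 0] by auto
      have conv: "(\<lambda>n. \<Sum>v\<in>V n. c n v * tf_shift v G y) \<longlonglongrightarrow> H y" for y
      proof -
        have tfm [measurable]: "(\<lambda>w. tf_shift w G y) \<in> borel_measurable borel"
          by (rule borel_measurable_continuous_onI[OF tf_shift_continuous[OF G]])
        have "(\<Sum>v\<in>V n. c n v * tf_shift v G y) = (\<integral>w. a w * tf_shift (s n w) G y \<partial>M)" for n
        proof -
          have "(\<Sum>v\<in>V n. c n v * tf_shift v G y) = (\<integral>w. (\<Sum>v\<in>V n. a w * indicator {v} (s n w) * tf_shift v G y) \<partial>M)"
            unfolding c_def by (subst Bochner_Integration.integral_sum) (use int_ai in auto)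
          also have "\<dots> = (\<integral>w. a w * tf_shift (s n w) G y \<partial>M)"
            by (intro Bochner_Integration.integral_cong refl)
              (rule sum_indicator_singleton[OF fin], simp add: V_def)
          finally show ?thesis .
        qed
        moreover have "(\<lambda>n. \<integral>w. a w * tf_shift (s n w) G y \<partial>M) \<longlonglongrightarrow> (\<integral>w. a w * tf_shift (\<Theta> w) G y \<partial>M)"
        proof (rule integral_dominated_convergence[where w="\<lambda>w. cmod (a w) * B"])
          show "AE w in M. (\<lambda>n. a w * tf_shift (s n w) G y) \<longlonglongrightarrow> a w * tf_shift (\<Theta> w) G y"
          proof (rule AE_I2)
            fix w assume "w \<in> space M"
            then have "(\<lambda>n. tf_shift (s n w) G y) \<longlonglongrightarrow> tf_shift (\<Theta> w) G y"
              by (intro continuous_on_tendsto_compose[OF tf_shift_continuous[OF G] s(2)]) auto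
            then show "(\<lambda>n. a w * tf_shift (s n w) G y) \<longlonglongrightarrow> a w * tf_shift (\<Theta> w) G y"
              by (intro tendsto_intros)
          qed
        qed (use int_norm B in \<open>auto simp: norm_mult intro!: mult_left_mono\<close>)
        ultimately show ?thesis using rep by simp
      qed
      then show "(\<lambda>n. tf_shift z (\<lambda>y. \<Sum>v\<in>V n. c n v * tf_shift v G y) y) \<longlonglongrightarrow> tf_shift z H y" for y
        unfolding tf_shift_def[of z] by (intro tendsto_intros)
    qed
  qed
qed

section \<open>Mixed norms\<close>

lemma ennreal_powr_ennreal [simp]: "x \<ge> 0 \<Longrightarrow> ennreal_powr (ennreal x) a = ennreal (x powr a)"
  by (simp add: ennreal_powr_def)

lemma ennreal_powr_zero [simp]: "ennreal_powr 0 a = 0"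
  by (simp add: ennreal_powr_def)

lemma ennreal_powr_top [simp]: "ennreal_powr top a = top"
  by (simp add: ennreal_powr_def)

lemma ennreal_powr_mono: "a > 0 \<Longrightarrow> x \<le> y \<Longrightarrow> ennreal_powr x a \<le> ennreal_powr y a"
  by (cases x; cases y) (auto simp: top_unique powr_mono2)

lemma ennreal_powr_powr: "a > 0 \<Longrightarrow> b > 0 \<Longrightarrow> ennreal_powr (ennreal_powr x a) b = ennreal_powr x (a * b)"
  by (cases x) (auto simp: powr_powr)

lemma ennreal_powr_one [simp]: "ennreal_powr x 1 = x"
  by (cases x) auto

lemma ennreal_powr_mult: "a > 0 \<Longrightarrow> ennreal_powr (x * y) a = ennreal_powr x a * ennreal_powr y a"
proof (cases x; cases y)
  fix r s assume "a > 0" "x = ennreal r" "0 \<le> r" "y = ennreal s" "0 \<le> s"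
  then show ?thesis by (simp add: powr_mult flip: ennreal_mult)
qed (auto simp: ennreal_mult_top ennreal_top_mult)

lemma ennreal_powr_le_iff: "a > 0 \<Longrightarrow> ennreal_powr x a \<le> y \<longleftrightarrow> x \<le> ennreal_powr y (1 / a)"
  using ennreal_powr_mono[of a x "ennreal_powr y (1 / a)"] ennreal_powr_mono[of "1 / a" "ennreal_powr x a" y]
  by (auto simp: ennreal_powr_powr)

lemma ennreal_powr_less_iff: "a > 0 \<Longrightarrow> y < ennreal_powr x a \<longleftrightarrow> ennreal_powr y (1 / a) < x"
  using ennreal_powr_le_iff[of a x y] by (simp add: not_le[symmetric])

lemma ennreal_powr_measurable [measurable]:
  assumes [measurable]: "F \<in> borel_measurable M"
  shows "(\<lambda>x. ennreal_powr (F x) a) \<in> borel_measurable M"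
proof -
  have [measurable]: "(\<lambda>x. enn2real (F x) powr a) \<in> borel_measurable M"
    by (intro powr_real_measurable) auto
  show ?thesis unfolding ennreal_powr_def by measurable
qed

lemma enn2real_ge_1: "1 \<le> (p::ennreal) \<Longrightarrow> p \<noteq> \<infinity> \<Longrightarrow> enn2real p \<ge> 1"
  by (cases p) auto

lemma eLp_norm_le_iff:
  assumes "1 \<le> p" "p \<noteq> \<infinity>"
  shows "eLp_norm p M F \<le> c \<longleftrightarrow> (\<integral>\<^sup>+x. ennreal_powr (F x) (enn2real p) \<partial>M) \<le> ennreal_powr c (enn2real p)"
  using enn2real_ge_1[OF assms] assms(2)
  by (simp add: eLp_norm_def ennreal_powr_le_iff)

lemma eLp_norm_mono:
  assumes "1 \<le> p" and F: "F \<in> borel_measurable M" and le: "\<And>x. F x \<le> G x"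
  shows "eLp_norm p M F \<le> eLp_norm p M G"
proof (cases "p = \<infinity>")
  case True
  then show ?thesis using esssup_mono[OF F le] by (simp add: eLp_norm_def)
next
  case False
  have "(\<integral>\<^sup>+x. ennreal_powr (F x) (enn2real p) \<partial>M) \<le> (\<integral>\<^sup>+x. ennreal_powr (G x) (enn2real p) \<partial>M)"
    using enn2real_ge_1[OF assms(1) False] by (intro nn_integral_mono ennreal_powr_mono le) auto
  also have "\<dots> \<le> ennreal_powr (eLp_norm p M G) (enn2real p)"
    using eLp_norm_le_iff[OF assms(1) False] by blast
  finally show ?thesis using eLp_norm_le_iff[OF assms(1) False] by blast
qed

lemma eLp_norm_cmult_le:
  assumes "1 \<le> p" and F [measurable]: "F \<in> borel_measurable M"
  shows "eLp_norm p M (\<lambda>x. k * F x) \<le> k * eLp_norm p M F"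
proof (cases "p = \<infinity>")
  case True
  have "AE x in M. k * F x \<le> k * esssup M F"
    using esssup_AE[of F M] by eventually_elim (rule mult_left_mono, auto)
  then show ?thesis using True by (auto simp: eLp_norm_def intro!: esssup_I)
next
  case False
  note r = enn2real_ge_1[OF assms(1) False]
  have "(\<integral>\<^sup>+x. ennreal_powr (k * F x) (enn2real p) \<partial>M)
      = ennreal_powr k (enn2real p) * (\<integral>\<^sup>+x. ennreal_powr (F x) (enn2real p) \<partial>M)"
    using r by (simp add: ennreal_powr_mult nn_integral_cmult)
  also have "\<dots> \<le> ennreal_powr k (enn2real p) * ennreal_powr (eLp_norm p M F) (enn2real p)"
    using eLp_norm_le_iff[OF assms(1) False] by (intro mult_left_mono) auto
  also have "\<dots> = ennreal_powr (k * eLp_norm p M F) (enn2real p)"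
    using r by (simp add: ennreal_powr_mult)
  finally show ?thesis using eLp_norm_le_iff[OF assms(1) False] by blast
qed

text \<open>Convexity of the power function at the points \<open>u / a\<close> and
  \<open>v / b\<close> with weights \<open>a / (a + b)\<close> and \<open>b / (a + b)\<close>, whose
  mean is \<open>(u + v) / (a + b)\<close>. Zero arguments are treated separately through
  \<open>t powr r \<le> t\<close> for \<open>0 < t \<le> 1\<close>.\<close>

lemma powr_add_weighted:
  fixes r a b u v :: real
  assumes "r \<ge> 1" "a > 0" "b > 0" "u \<ge> 0" "v \<ge> 0"
  shows "(u + v) powr r \<le> (a + b) powr r * (a / (a + b) * (u / a) powr r + b / (a + b) * (v / b) powr r)"
proof -
  have *: "(t * s) powr r \<le> t * s powr r" if "0 < t" "t \<le> 1" "s \<ge> 0" for t s :: real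
  proof -
    have "t powr r \<le> t powr 1" using that assms(1) by (intro powr_mono') auto
    then show ?thesis using that by (auto simp: powr_mult intro!: mult_right_mono)
  qed
  have "(a / (a + b) * (u / a) + b / (a + b) * (v / b)) powr r
      \<le> a / (a + b) * (u / a) powr r + b / (a + b) * (v / b) powr r"
  proof (cases "u = 0 \<or> v = 0")
    case True
    then show ?thesis
    proof
      assume "u = 0"
      with *[of "b / (a + b)" "v / b"] assms show ?thesis by simp
    next
      assume "v = 0"
      with *[of "a / (a + b)" "u / a"] assms show ?thesis by simp
    qed
  next
    case False
    have "a / (a + b) = 1 - b / (a + b)" using assms by (simp add: field_simps)
    with convex_onD[OF powr_convex[OF assms(1)], of "b / (a + b)" "u / a" "v / b"] False assms
    show ?thesis by simp
  qed
  moreover have "a / (a + b) * (u / a) + b / (a + b) * (v / b) = (u + v) / (a + b)"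
    using assms by (simp add: add_divide_distrib)
  ultimately have "((u + v) / (a + b)) powr r \<le> a / (a + b) * (u / a) powr r + b / (a + b) * (v / b) powr r"
    by simp
  then have "(a + b) powr r * ((u + v) / (a + b)) powr r
      \<le> (a + b) powr r * (a / (a + b) * (u / a) powr r + b / (a + b) * (v / b) powr r)"
    by (rule mult_left_mono) simp
  moreover have "(a + b) powr r * ((u + v) / (a + b)) powr r = (u + v) powr r"
    using assms by (simp flip: powr_mult)
  ultimately show ?thesis by simp
qed

text \<open>For finite \<open>p\<close> the triangle inequality comes from integrating
  \<open>powr_add_weighted\<close> with \<open>a\<close> and \<open>b\<close> close to the two
  norms: the weights add up to 1, so no duality or Hoelder inequality is involved.\<close>

lemma eLp_norm_add_le:
  assumes "1 \<le> p" and F [measurable]: "F \<in> borel_measurable M" and G [measurable]: "G \<in> borel_measurable M"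
  shows "eLp_norm p M (\<lambda>x. F x + G x) \<le> eLp_norm p M F + eLp_norm p M G"
proof (cases "p = \<infinity>")
  case True
  have "AE x in M. F x + G x \<le> esssup M F + esssup M G"
    using esssup_AE[of F M] esssup_AE[of G M] by eventually_elim (rule add_mono)
  then show ?thesis using True by (auto simp: eLp_norm_def intro!: esssup_I)
next
  case False
  note r = enn2real_ge_1[OF assms(1) False]
  define r where "r = enn2real p"
  note r = r[folded r_def]
  show ?thesis
  proof (rule ennreal_le_epsilon)
    fix e :: real assume fin: "eLp_norm p M F + eLp_norm p M G < top" and e: "e > 0"
    obtain A B where AB: "eLp_norm p M F = ennreal A" "A \<ge> 0" "eLp_norm p M G = ennreal B" "B \<ge> 0"
      using fin by (cases "eLp_norm p M F"; cases "eLp_norm p M G") auto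
    \<comment> \<open>The norms are enlarged by \<open>e / 2\<close> each because the weights divide
      by \<open>a\<close> and \<open>b\<close>, and a norm may be 0.\<close>
    define a b where "a = A + e / 2" and "b = B + e / 2"
    have ab: "a > 0" "b > 0" using AB e by (auto simp: a_def b_def)
    have FG: "(\<integral>\<^sup>+x. ennreal_powr (F x) r \<partial>M) \<le> ennreal (a powr r)"
      "(\<integral>\<^sup>+x. ennreal_powr (G x) r \<partial>M) \<le> ennreal (b powr r)"
    proof -
      have "eLp_norm p M F \<le> ennreal a" "eLp_norm p M G \<le> ennreal b"
        unfolding AB a_def b_def using e by (auto intro!: ennreal_leI)
      then show "(\<integral>\<^sup>+x. ennreal_powr (F x) r \<partial>M) \<le> ennreal (a powr r)"
        "(\<integral>\<^sup>+x. ennreal_powr (G x) r \<partial>M) \<le> ennreal (b powr r)"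
        unfolding eLp_norm_le_iff[OF assms(1) False] r_def[symmetric] using ab by simp_all
    qed
    define K where "K = (a + b) powr r"
    \<comment> \<open>The divisions by \<open>a powr r\<close> and \<open>b powr r\<close> cancel
      the bounds in \<open>FG\<close>, so that after integration only the two convex weights
      remain.\<close>
    define \<alpha> \<beta> where "\<alpha> = a / (a + b) / a powr r" and "\<beta> = b / (a + b) / b powr r"
    have nn: "K \<ge> 0" "\<alpha> \<ge> 0" "\<beta> \<ge> 0" using ab by (auto simp: K_def \<alpha>_def \<beta>_def)
    have ptw: "ennreal_powr (x + y) r \<le> ennreal (K * \<alpha>) * ennreal_powr x r + ennreal (K * \<beta>) * ennreal_powr y r" for x y
    proof (cases "x = top \<or> y = top")
      case True
      have "K * \<alpha> > 0" "K * \<beta> > 0" using ab by (auto simp: K_def \<alpha>_def \<beta>_def)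
      then show ?thesis using True by (auto simp: ennreal_mult_top)
    next
      case False
      then obtain u v where uv: "x = ennreal u" "u \<ge> 0" "y = ennreal v" "v \<ge> 0"
        by (cases x; cases y) auto
      have "(u + v) powr r \<le> K * \<alpha> * u powr r + K * \<beta> * v powr r"
        using powr_add_weighted[OF r ab uv(2,4)] ab uv
        by (simp add: K_def \<alpha>_def \<beta>_def powr_divide algebra_simps)
      then show ?thesis using uv nn by (simp flip: ennreal_plus ennreal_mult)
    qed
    have "(\<integral>\<^sup>+x. ennreal_powr (F x + G x) r \<partial>M)
        \<le> (\<integral>\<^sup>+x. ennreal (K * \<alpha>) * ennreal_powr (F x) r + ennreal (K * \<beta>) * ennreal_powr (G x) r \<partial>M)"
      by (intro nn_integral_mono ptw)
    also have "\<dots> = ennreal (K * \<alpha>) * (\<integral>\<^sup>+x. ennreal_powr (F x) r \<partial>M) + ennreal (K * \<beta>) * (\<integral>\<^sup>+x. ennreal_powr (G x) r \<partial>M)"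
      by (simp add: nn_integral_add nn_integral_cmult)
    also have "\<dots> \<le> ennreal (K * \<alpha>) * ennreal (a powr r) + ennreal (K * \<beta>) * ennreal (b powr r)"
      by (intro add_mono mult_left_mono FG) auto
    also have "\<dots> = ennreal (K * (a / (a + b) + b / (a + b)))"
      using nn ab by (simp flip: ennreal_plus ennreal_mult add: \<alpha>_def \<beta>_def distrib_left)
    also have "\<dots> = ennreal K"
      using ab by (simp flip: add_divide_distrib)
    also have "\<dots> = ennreal_powr (ennreal (a + b)) r" using ab by (simp add: K_def del: ennreal_plus)
    finally have "eLp_norm p M (\<lambda>x. F x + G x) \<le> ennreal (a + b)"
      using eLp_norm_le_iff[OF assms(1) False, of M "\<lambda>x. F x + G x" "ennreal (a + b)"] by (simp add: r_def)
    also have "\<dots> = eLp_norm p M F + eLp_norm p M G + ennreal e"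
      using AB e by (simp add: a_def b_def flip: ennreal_plus)
    finally show "eLp_norm p M (\<lambda>x. F x + G x) \<le> eLp_norm p M F + eLp_norm p M G + ennreal e" .
  qed
qed

lemma eLp_norm_zero [simp]: "1 \<le> p \<Longrightarrow> eLp_norm p M (\<lambda>_. 0) = 0"
proof -
  assume p: "1 \<le> p"
  have "eLp_norm p M (\<lambda>x. 0 * (0::ennreal)) \<le> 0 * eLp_norm p M (\<lambda>_. 0)"
    by (rule eLp_norm_cmult_le[OF p]) simp
  then show ?thesis by simp
qed

lemma eLp_norm_sum_le:
  assumes "1 \<le> p" "finite I" and F: "\<And>i. i \<in> I \<Longrightarrow> F i \<in> borel_measurable M"
  shows "eLp_norm p M (\<lambda>x. \<Sum>i\<in>I. k i * F i x) \<le> (\<Sum>i\<in>I. k i * eLp_norm p M (F i))"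
  using assms(2) F
proof (induction I rule: finite_induct)
  case (insert i I)
  have [measurable]: "\<And>j. j \<in> insert i I \<Longrightarrow> F j \<in> borel_measurable M" using insert by auto
  have "eLp_norm p M (\<lambda>x. \<Sum>j\<in>insert i I. k j * F j x) = eLp_norm p M (\<lambda>x. k i * F i x + (\<Sum>j\<in>I. k j * F j x))"
    using insert by simp
  also have "\<dots> \<le> eLp_norm p M (\<lambda>x. k i * F i x) + eLp_norm p M (\<lambda>x. \<Sum>j\<in>I. k j * F j x)"
    by (rule eLp_norm_add_le[OF assms(1)]) measurable
  also have "\<dots> \<le> k i * eLp_norm p M (F i) + (\<Sum>j\<in>I. k j * eLp_norm p M (F j))"
    using insert by (intro add_mono eLp_norm_cmult_le[OF assms(1)]) auto
  finally show ?case using insert by simp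
qed (use assms(1) in simp)

text \<open>Fatou's lemma for all exponents. It carries the triangle inequality for finite sums over
  to their limits and so stands in for Minkowski's integral inequality.\<close>

lemma eLp_norm_liminf_le:
  assumes p: "1 \<le> p" and F [measurable]: "\<And>n. F n \<in> borel_measurable M"
  shows "eLp_norm p M (\<lambda>x. liminf (\<lambda>n. F n x)) \<le> liminf (\<lambda>n. eLp_norm p M (F n))"
proof (cases "p = \<infinity>")
  case True
  have "AE x in M. \<forall>n. F n x \<le> esssup M (F n)"
    unfolding AE_all_countable using esssup_AE by blast
  then have "AE x in M. liminf (\<lambda>n. F n x) \<le> liminf (\<lambda>n. esssup M (F n))"
    by eventually_elim (auto intro!: Liminf_mono)
  then show ?thesis using True by (auto simp: eLp_norm_def intro!: esssup_I)
next
  case False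
  define r where "r = enn2real p"
  have r: "r > 0" using enn2real_ge_1[OF p False] by (simp add: r_def)
  have sub: "ennreal_powr (liminf X) a \<le> liminf (\<lambda>n. ennreal_powr (X n) a)" if "a > 0" for X :: "nat \<Rightarrow> ennreal" and a
    unfolding le_Liminf_iff
  proof (intro allI impI)
    fix y assume "y < ennreal_powr (liminf X) a"
    then have "ennreal_powr y (1 / a) < liminf X" using ennreal_powr_less_iff[OF that] by blast
    then have "\<forall>\<^sub>F n in sequentially. ennreal_powr y (1 / a) < X n"
      using le_Liminf_iff[of "liminf X" sequentially X] by blast
    then show "\<forall>\<^sub>F n in sequentially. y < ennreal_powr (X n) a"
      by eventually_elim (use ennreal_powr_less_iff[OF that] in blast)
  qed
  \<comment> \<open>Obtained from \<open>sub\<close> by applying it with the inverse exponent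
    \<open>1 / a\<close> to the sequence of powers.\<close>
  have sup: "liminf (\<lambda>n. ennreal_powr (X n) a) \<le> ennreal_powr (liminf X) a" if "a > 0" for X :: "nat \<Rightarrow> ennreal" and a
  proof -
    have "ennreal_powr (liminf (\<lambda>n. ennreal_powr (X n) a)) (1 / a) \<le> liminf (\<lambda>n. ennreal_powr (ennreal_powr (X n) a) (1 / a))"
      by (rule sub) (use that in simp)
    also have "\<dots> = liminf X" using that by (simp add: ennreal_powr_powr)
    finally show ?thesis using that by (simp add: ennreal_powr_le_iff)
  qed
  have "(\<integral>\<^sup>+x. ennreal_powr (liminf (\<lambda>n. F n x)) r \<partial>M) \<le> (\<integral>\<^sup>+x. liminf (\<lambda>n. ennreal_powr (F n x) r) \<partial>M)"
    by (intro nn_integral_mono sub r)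
  also have "\<dots> \<le> liminf (\<lambda>n. \<integral>\<^sup>+x. ennreal_powr (F n x) r \<partial>M)"
    by (rule nn_integral_liminf) measurable
  also have "\<dots> \<le> liminf (\<lambda>n. ennreal_powr (eLp_norm p M (F n)) r)"
    using eLp_norm_le_iff[OF p False] by (intro Liminf_mono always_eventually allI) (auto simp: r_def)
  also have "\<dots> \<le> ennreal_powr (liminf (\<lambda>n. eLp_norm p M (F n))) r"
    by (rule sup[OF r])
  finally show ?thesis by (simp add: eLp_norm_le_iff[OF p False] r_def)
qed

text \<open>At \<open>p = \<infinity>\<close> the exponent \<open>enn2real (1 / p)\<close> is 0, so
  the factor becomes 1, as it must: for \<open>k > 0\<close> the pushforward has the same null sets
  as Lebesgue measure.\<close>

lemma eLp_norm_distr: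
  assumes p: "1 \<le> p" and F [measurable]: "F \<in> borel_measurable borel" and T [measurable]: "T \<in> borel_measurable borel"
    and k: "k > 0" and distr: "distr lborel borel T = density lborel (\<lambda>_. ennreal k)"
  shows "eLp_norm p lborel (\<lambda>x. F (T x)) = ennreal (k powr enn2real (1 / p)) * eLp_norm p lborel F"
proof (cases "p = \<infinity>")
  case True
  have "(AE x in lborel. F (T x) \<le> c) \<longleftrightarrow> (AE x in lborel. F x \<le> c)" for c
  proof -
    have "(AE x in lborel. F (T x) \<le> c) \<longleftrightarrow> (AE x in distr lborel borel T. F x \<le> c)"
      by (subst AE_distr_iff) auto
    also have "\<dots> \<longleftrightarrow> (AE x in lborel. F x \<le> c)"
      unfolding distr using k by (subst AE_density) auto
    finally show ?thesis .
  qed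
  then have "esssup lborel (\<lambda>x. F (T x)) = esssup lborel F"
    by (subst (1 2) esssup_eq_AE) auto
  then show ?thesis using True k by (simp add: eLp_norm_def)
next
  case False
  define r where "r = enn2real p"
  have r: "r > 0" using enn2real_ge_1[OF p False] by (simp add: r_def)
  have inv: "enn2real (1 / p) = 1 / r"
    using False r by (cases p) (auto simp: r_def divide_ennreal simp flip: ennreal_1)
  have "(\<integral>\<^sup>+x. ennreal_powr (F (T x)) r \<partial>lborel) = (\<integral>\<^sup>+x. ennreal_powr (F x) r \<partial>distr lborel borel T)"
    by (subst nn_integral_distr) auto
  also have "\<dots> = ennreal k * (\<integral>\<^sup>+x. ennreal_powr (F x) r \<partial>lborel)"
    unfolding distr by (subst nn_integral_density) (auto simp: nn_integral_cmult)
  finally show ?thesis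
    using False r k unfolding eLp_norm_def r_def[symmetric] inv by (simp add: ennreal_powr_mult)
qed

lemma eLp_norm_translate:
  fixes a :: "'a::euclidean_space"
  assumes p: "1 \<le> p" and F: "F \<in> borel_measurable borel"
  shows "eLp_norm p lborel (\<lambda>x. F (x + a)) = eLp_norm p lborel F"
  unfolding add.commute[of _ a]
  using eLp_norm_distr[OF p F, of "(+) a" 1] lborel_distr_plus[of a]
  by (simp add: density_1)

text \<open>The triangle inequality and Fatou's lemma for the outer norm presuppose that the inner
  norm is measurable. For finite \<open>p\<close> this is Tonelli; the essential supremum needs an
  argument of its own.\<close>

lemma eLp_norm_measurable:
  fixes F :: "'a::euclidean_space \<Rightarrow> 'b::euclidean_space \<Rightarrow> ennreal"
  assumes p: "1 \<le> p" and F [measurable]: "(\<lambda>w. F (fst w) (snd w)) \<in> borel_measurable (borel \<Otimes>\<^sub>M borel)"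
  shows "(\<lambda>\<xi>. eLp_norm p lborel (\<lambda>z. F z \<xi>)) \<in> borel_measurable borel"
proof -
  have swap: "(\<lambda>w. F (snd w) (fst w)) \<in> borel_measurable (borel \<Otimes>\<^sub>M lborel)"
    by (rule measurable_compose[OF _ F, of "\<lambda>w. (snd w, fst w)", simplified]) measurable
  have sec: "(\<lambda>z. F z \<xi>) \<in> borel_measurable lborel" for \<xi>
    using measurable_compose[OF measurable_Pair2' F, of \<xi>] by simp
  show ?thesis
  proof (cases "p = \<infinity>")
    case True
    have "(\<lambda>\<xi>. esssup lborel (\<lambda>z. F z \<xi>)) \<in> borel_measurable borel"
    proof (rule borel_measurableI_greater)
      fix y
      \<comment> \<open>\<open>y\<close> lies below the essential supremum exactly if the superlevel
        section has positive measure, and that measure depends measurably on \<open>\<xi>\<close> by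
        Tonelli.\<close>
      have iff: "y < esssup lborel (\<lambda>z. F z \<xi>) \<longleftrightarrow> 0 < (\<integral>\<^sup>+z. indicator {z. y < F z \<xi>} z \<partial>lborel)" for \<xi>
      proof -
        have m: "{z. y < F z \<xi>} \<in> sets lborel"
          using sec[of \<xi>] by measurable
        have "\<not> y < esssup lborel (\<lambda>z. F z \<xi>)" if "\<not> 0 < emeasure lborel {z. y < F z \<xi>}"
        proof -
          have "AE z in lborel. \<not> y < F z \<xi>"
            using that m by (subst AE_iff_measurable[of "{z. y < F z \<xi>}"]) auto
          then have "AE z in lborel. F z \<xi> \<le> y" by (simp add: not_less)
          then show ?thesis using sec[of \<xi>] by (auto simp: not_less intro!: esssup_I)
        qed
        moreover have "y < esssup lborel (\<lambda>z. F z \<xi>)" if "0 < emeasure lborel {z. y < F z \<xi>}"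
        proof (rule ccontr)
          assume "\<not> y < esssup lborel (\<lambda>z. F z \<xi>)"
          then have "AE z in lborel. \<not> y < F z \<xi>"
            using esssup_AE[of "\<lambda>z. F z \<xi>" lborel] by (auto elim!: eventually_mono simp: not_less)
          then have "emeasure lborel {z. y < F z \<xi>} = 0"
            using m by (subst (asm) AE_iff_measurable[of "{z. y < F z \<xi>}"]) auto
          with that show False by simp
        qed
        ultimately show ?thesis using m by (auto simp: zero_less_iff_neq_zero)
      qed
      have [measurable]: "(\<lambda>\<xi>. \<integral>\<^sup>+z. indicator {z. y < F z \<xi>} z \<partial>lborel) \<in> borel_measurable borel"
      proof (rule sigma_finite_measure.borel_measurable_nn_integral[OF sigma_finite_lborel])
        have "(\<lambda>w. indicator {y<..} (F (snd w) (fst w)) :: ennreal) \<in> borel_measurable (borel \<Otimes>\<^sub>M lborel)"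
          using swap by measurable
        then show "(\<lambda>(\<xi>, z). indicator {z. y < F z \<xi>} z :: ennreal) \<in> borel_measurable (borel \<Otimes>\<^sub>M lborel)"
          by (simp add: case_prod_beta indicator_def)
      qed
      show "{\<xi> \<in> space borel. y < esssup lborel (\<lambda>z. F z \<xi>)} \<in> sets borel"
        unfolding iff by measurable
    qed
    then show ?thesis using True by (simp add: eLp_norm_def)
  next
    case False
    have "(\<lambda>\<xi>. \<integral>\<^sup>+z. ennreal_powr (F z \<xi>) (enn2real p) \<partial>lborel) \<in> borel_measurable borel"
    proof (rule sigma_finite_measure.borel_measurable_nn_integral[OF sigma_finite_lborel])
      show "(\<lambda>(\<xi>, z). ennreal_powr (F z \<xi>) (enn2real p)) \<in> borel_measurable (borel \<Otimes>\<^sub>M lborel)"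
        using swap by (simp add: case_prod_beta)
    qed
    then show ?thesis using False by (simp add: eLp_norm_def)
  qed
qed

section \<open>Mixed norms of superpositions\<close>

definition mixed_norm :: "ennreal \<Rightarrow> ennreal \<Rightarrow> ('a::euclidean_space \<Rightarrow> 'b::euclidean_space \<Rightarrow> ennreal) \<Rightarrow> ennreal" where
  "mixed_norm p q F = eLp_norm q lborel (\<lambda>\<xi>. eLp_norm p lborel (\<lambda>z. F z \<xi>))"

text \<open>All translates of \<open>F0\<close> have the same mixed norm. Fatou's lemma, the
  triangle inequality and translation invariance are applied once in position and once in frequency,
  and the coefficients contribute only their sum.\<close>

lemma mixed_norm_superposition:
  fixes F F0 :: "'a::euclidean_space \<Rightarrow> 'b::euclidean_space \<Rightarrow> ennreal"
  assumes p: "1 \<le> p" and q: "1 \<le> q"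
    and F: "(\<lambda>w. F (fst w) (snd w)) \<in> borel_measurable (borel \<Otimes>\<^sub>M borel)"
    and F0: "(\<lambda>w. F0 (fst w) (snd w)) \<in> borel_measurable (borel \<Otimes>\<^sub>M borel)"
    and fin: "\<And>n::nat. finite (V n)" and c: "\<And>n. (\<Sum>v\<in>V n. c n v) \<le> K"
    and le: "\<And>z \<xi>. F z \<xi> \<le> liminf (\<lambda>n. \<Sum>v\<in>V n. c n v * F0 (z + fst v) (\<xi> + snd v))"
  shows "mixed_norm p q F \<le> K * mixed_norm p q F0"
proof -
  define N where "N \<xi> = eLp_norm p lborel (\<lambda>z. F0 z \<xi>)" for \<xi>
  have N [measurable]: "N \<in> borel_measurable borel"
    unfolding N_def by (rule eLp_norm_measurable[OF p F0])
  have sec [measurable]: "(\<lambda>z. F0 (z + a) \<xi>) \<in> borel_measurable borel" for \<xi> a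
  proof -
    have "(\<lambda>z. F0 z \<xi>) \<in> borel_measurable borel"
      using measurable_compose[OF measurable_Pair2' F0, of \<xi>] by simp
    from measurable_compose[OF _ this, of "\<lambda>z. z + a"] show ?thesis by simp
  qed
  have secF: "(\<lambda>z. F z \<xi>) \<in> borel_measurable lborel" for \<xi>
    using measurable_compose[OF measurable_Pair2' F, of \<xi>] by simp
  have sum_meas [measurable]: "(\<lambda>\<xi>. \<Sum>v\<in>V n. c n v * N (\<xi> + snd v)) \<in> borel_measurable borel" for n
    by measurable
  have inner: "eLp_norm p lborel (\<lambda>z. F z \<xi>) \<le> liminf (\<lambda>n. \<Sum>v\<in>V n. c n v * N (\<xi> + snd v))" for \<xi>
  proof -
    have "eLp_norm p lborel (\<lambda>z. F z \<xi>)
        \<le> eLp_norm p lborel (\<lambda>z. liminf (\<lambda>n. \<Sum>v\<in>V n. c n v * F0 (z + fst v) (\<xi> + snd v)))"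
      by (rule eLp_norm_mono[OF p secF le])
    also have "\<dots> \<le> liminf (\<lambda>n. eLp_norm p lborel (\<lambda>z. \<Sum>v\<in>V n. c n v * F0 (z + fst v) (\<xi> + snd v)))"
      by (rule eLp_norm_liminf_le[OF p]) measurable
    also have "\<dots> \<le> liminf (\<lambda>n. \<Sum>v\<in>V n. c n v * eLp_norm p lborel (\<lambda>z. F0 (z + fst v) (\<xi> + snd v)))"
      by (intro Liminf_mono always_eventually allI eLp_norm_sum_le[OF p fin]) measurable
    also have "\<dots> = liminf (\<lambda>n. \<Sum>v\<in>V n. c n v * N (\<xi> + snd v))"
      using eLp_norm_translate[OF p sec[of 0]] by (simp add: N_def)
    finally show ?thesis .
  qed
  have "mixed_norm p q F \<le> eLp_norm q lborel (\<lambda>\<xi>. liminf (\<lambda>n. \<Sum>v\<in>V n. c n v * N (\<xi> + snd v)))"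
    unfolding mixed_norm_def using eLp_norm_measurable[OF p F]
    by (intro eLp_norm_mono[OF q] inner) simp
  also have "\<dots> \<le> liminf (\<lambda>n. eLp_norm q lborel (\<lambda>\<xi>. \<Sum>v\<in>V n. c n v * N (\<xi> + snd v)))"
    by (rule eLp_norm_liminf_le[OF q]) measurable
  also have "\<dots> \<le> liminf (\<lambda>n. \<Sum>v\<in>V n. c n v * eLp_norm q lborel (\<lambda>\<xi>. N (\<xi> + snd v)))"
    by (intro Liminf_mono always_eventually allI eLp_norm_sum_le[OF q fin]) measurable
  also have "\<dots> = liminf (\<lambda>n. (\<Sum>v\<in>V n. c n v) * mixed_norm p q F0)"
    unfolding mixed_norm_def N_def[symmetric] eLp_norm_translate[OF q N] sum_distrib_right ..
  also have "\<dots> \<le> liminf (\<lambda>n::nat. K * mixed_norm p q F0)"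
    by (intro Liminf_mono always_eventually allI mult_right_mono c) auto
  also have "\<dots> = K * mixed_norm p q F0" by (simp add: Liminf_const)
  finally show ?thesis .
qed

text \<open>The modulation norm with the complex conjugation absorbed into the window, so that the
  test functions depend linearly on the window; \<open>modulation_norm_eq_window_norm\<close> makes
  the translation.\<close>

definition window_norm :: "ennreal \<Rightarrow> ennreal \<Rightarrow> ('a::euclidean_space \<Rightarrow> complex) \<Rightarrow> (('a \<Rightarrow> complex) \<Rightarrow> complex) \<Rightarrow> ennreal" where
  "window_norm p q G f = mixed_norm p q (\<lambda>z \<xi>. ennreal (cmod (f (tf_shift (z, - \<xi>) G))))"

lemma tf_shift_measurable:
  fixes G :: "'a::euclidean_space \<Rightarrow> complex"
  assumes "tempered_distribution f" "G \<in> \<S>"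
  shows "(\<lambda>w. ennreal (cmod (f (tf_shift (fst w, - snd w) G)))) \<in> borel_measurable (borel \<Otimes>\<^sub>M borel)"
proof -
  have "continuous_on UNIV (\<lambda>w::'a \<times> 'a. f (tf_shift (fst w, - snd w) G))"
    by (rule continuous_on_compose2[OF tempered_tf_shift_continuous[OF assms]]) (auto intro!: continuous_intros)
  then have [measurable]: "(\<lambda>w::'a \<times> 'a. f (tf_shift (fst w, - snd w) G)) \<in> borel_measurable (borel \<Otimes>\<^sub>M borel)"
    unfolding borel_prod by (rule borel_measurable_continuous_onI)
  show ?thesis by measurable
qed

text \<open>The approximating combinations give a pointwise bound by a limit inferior, to which
  \<open>mixed_norm_superposition\<close> applies. The measure space is left general because
  integrals over frequencies, over positions and over the whole phase space all occur.\<close>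

lemma window_norm_superposition:
  fixes G H :: "'a::euclidean_space \<Rightarrow> complex" and \<Theta> :: "'b \<Rightarrow> 'a \<times> 'a" and a :: "'b \<Rightarrow> complex"
  assumes p: "1 \<le> p" and q: "1 \<le> q" and f: "tempered_distribution f"
    and G: "G \<in> \<S>" and H: "H \<in> \<S>"
    and a: "a \<in> borel_measurable M" and \<Theta>: "\<Theta> \<in> borel_measurable M"
    and mom: "\<And>m. integrable M (\<lambda>w. cmod (a w) * (1 + norm (\<Theta> w)) ^ m)"
    and rep: "\<And>y. H y = (\<integral>w. a w * tf_shift (\<Theta> w) G y \<partial>M)"
  shows "window_norm p q H f \<le> ennreal (\<integral>w. cmod (a w) \<partial>M) * window_norm p q G f"
proof -
  obtain V c where fin: "\<And>n. finite (V n)" and c: "\<And>n. (\<Sum>v\<in>V n. cmod (c n v)) \<le> (\<integral>w. cmod (a w) \<partial>M)"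
    and lim: "\<And>f z. tempered_distribution f \<Longrightarrow>
       (\<lambda>n. f (tf_shift z (\<lambda>y. \<Sum>v\<in>V n. c n v * tf_shift v G y))) \<longlonglongrightarrow> f (tf_shift z H)"
    using superposition_approx[OF G H a \<Theta> mom rep] by blast
  \<comment> \<open>Frequencies enter \<open>window_norm\<close> with a minus sign, so adding
    \<open>v\<close> to \<open>(z, - \<xi>)\<close> shifts \<open>\<xi>\<close> by
    \<open>- snd v\<close>.\<close>
  define V' where "V' n = (\<lambda>v. (fst v, - snd v)) ` V n" for n
  define c' where "c' n v = ennreal (cmod (c n (fst v, - snd v)))" for n v
  have inj: "inj_on (\<lambda>v. (fst v, - snd v)) S" for S :: "('a \<times> 'a) set"
    by (auto simp: inj_on_def prod_eq_iff)
  show ?thesis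
    unfolding window_norm_def
  proof (rule mixed_norm_superposition[OF p q, of _ _ V' c'])
    show "finite (V' n)" for n using fin by (simp add: V'_def)
    show "(\<Sum>v\<in>V' n. c' n v) \<le> ennreal (\<integral>w. cmod (a w) \<partial>M)" for n
      unfolding V'_def c'_def by (subst sum.reindex[OF inj]) (auto intro!: ennreal_leI c)
    fix z \<xi> :: 'a
    have le: "ennreal (cmod (f (tf_shift (z, - \<xi>) (\<lambda>y. \<Sum>v\<in>V n. c n v * tf_shift v G y))))
       \<le> (\<Sum>v\<in>V' n. c' n v * ennreal (cmod (f (tf_shift (z + fst v, - (\<xi> + snd v)) G))))" for n
    proof -
      let ?e = "\<lambda>v::'a\<times>'a. cis (- (2 * pi * (snd v \<bullet> z)))"
      have "f (tf_shift (z, - \<xi>) (\<lambda>y. \<Sum>v\<in>V n. c n v * tf_shift v G y))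
          = (\<Sum>v\<in>V n. (c n v * ?e v) * f (tf_shift ((z, - \<xi>) + v) G))"
        by (simp only: tf_shift_sum tempered_sum[OF f fin schwartz_tf_shift[OF G]] fst_conv)
      also have "cmod \<dots> \<le> (\<Sum>v\<in>V n. cmod (c n v) * cmod (f (tf_shift ((z, - \<xi>) + v) G)))"
        by (rule order_trans[OF norm_sum]) (simp add: norm_mult)
      finally have "ennreal (cmod (f (tf_shift (z, - \<xi>) (\<lambda>y. \<Sum>v\<in>V n. c n v * tf_shift v G y))))
          \<le> (\<Sum>v\<in>V n. ennreal (cmod (c n v)) * ennreal (cmod (f (tf_shift ((z, - \<xi>) + v) G))))"
        by (simp flip: ennreal_mult' add: ennreal_leI)
      also have "\<dots> = (\<Sum>v\<in>V' n. c' n v * ennreal (cmod (f (tf_shift (z + fst v, - (\<xi> + snd v)) G))))"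
        unfolding V'_def c'_def
        by (subst sum.reindex[OF inj]) (auto intro!: sum.cong simp: case_prod_beta plus_prod_def)
      finally show ?thesis .
    qed
    have "(\<lambda>n. ennreal (cmod (f (tf_shift (z, - \<xi>) (\<lambda>y. \<Sum>v\<in>V n. c n v * tf_shift v G y)))))
        \<longlonglongrightarrow> ennreal (cmod (f (tf_shift (z, - \<xi>) H)))"
      by (intro tendsto_ennrealI tendsto_norm lim f)
    then have "ennreal (cmod (f (tf_shift (z, - \<xi>) H)))
        = liminf (\<lambda>n. ennreal (cmod (f (tf_shift (z, - \<xi>) (\<lambda>y. \<Sum>v\<in>V n. c n v * tf_shift v G y)))))"
      by (rule lim_imp_Liminf[OF trivial_limit_sequentially, symmetric])
    also have "\<dots> \<le> liminf (\<lambda>n. \<Sum>v\<in>V' n. c' n v * ennreal (cmod (f (tf_shift (z + fst v, - (\<xi> + snd v)) G))))"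
      by (intro Liminf_mono always_eventually allI le)
    finally show "ennreal (cmod (f (tf_shift (z, - \<xi>) H)))
        \<le> liminf (\<lambda>n. \<Sum>v\<in>V' n. c' n v * ennreal (cmod (f (tf_shift (z + fst v, - (\<xi> + snd v)) G))))" .
  qed (use tf_shift_measurable[OF f] G H in auto)
qed

section \<open>Fourier inversion and the short-time Fourier transform\<close>

lemma cis_measurable [measurable]:
  "f \<in> borel_measurable M \<Longrightarrow> (\<lambda>x. cis (f x)) \<in> borel_measurable M"
  unfolding cis_conv_exp by measurable

text \<open>Fubini for tensor products in the standard coordinates. It reduces both the
  integrability of the weight and the Fourier transform of the Gaussian to one dimension.\<close>

lemma lborel_prod_Basis:
  fixes F :: "'a::euclidean_space \<Rightarrow> real \<Rightarrow> 'c::{real_normed_field,banach,second_countable_topology}"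
  assumes F: "\<And>b. b \<in> Basis \<Longrightarrow> integrable lborel (F b)"
  shows "integrable lborel (\<lambda>x. \<Prod>b\<in>Basis. F b (x \<bullet> b))"
    and "(\<integral>x. (\<Prod>b\<in>Basis. F b (x \<bullet> b)) \<partial>lborel) = (\<Prod>b\<in>Basis. \<integral>t. F b t \<partial>lborel)"
proof -
  interpret product_sigma_finite "\<lambda>_::'a. lborel :: real measure" ..
  have [measurable]: "F b \<in> borel_measurable borel" if "b \<in> Basis" for b
    using F[OF that] by auto
  have comp: "(\<Prod>b\<in>Basis. F b ((\<Sum>c\<in>Basis. f c *\<^sub>R c) \<bullet> b)) = (\<Prod>b\<in>Basis. F b (f b))" for f
    by (intro prod.cong refl) (simp add: inner_sum_left inner_Basis if_distrib cong: if_cong)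
  have meas: "(\<lambda>x. \<Prod>b\<in>Basis. F b (x \<bullet> b)) \<in> borel_measurable borel"
    by measurable
  have T: "(\<lambda>f. \<Sum>b\<in>Basis. f b *\<^sub>R b) \<in> measurable (Pi\<^sub>M Basis (\<lambda>_. lborel)) (borel :: 'a measure)"
    by measurable
  show "integrable lborel (\<lambda>x. \<Prod>b\<in>Basis. F b (x \<bullet> b))"
    by (subst lborel_eq, subst integrable_distr_eq[OF T meas])
      (use product_integrable_prod[of Basis F] F in \<open>simp add: comp\<close>)
  show "(\<integral>x. (\<Prod>b\<in>Basis. F b (x \<bullet> b)) \<partial>lborel) = (\<Prod>b\<in>Basis. \<integral>t. F b t \<partial>lborel)"
    by (subst lborel_eq, subst integral_distr[OF T meas])
      (use product_integral_prod[of Basis F] F in \<open>simp add: comp\<close>)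
qed

text \<open>The exponent provides two powers of \<open>1 + norm x\<close> per coordinate, and each
  pair dominates one factor \<open>1 + (x \<bullet> b) ^ 2\<close>, whose reciprocal is integrable
  on the line.\<close>

lemma integrable_weight:
  "integrable lborel (\<lambda>x::'a::euclidean_space. 1 / (1 + norm x) ^ (2 * DIM('a)))"
proof (rule Bochner_Integration.integrable_bound)
  have "integrable lborel (\<lambda>t::real. inverse (1 + t\<^sup>2))"
    using integrable_inverse_1_plus_square by (simp add: set_integrable_def)
  then show "integrable lborel (\<lambda>x::'a. \<Prod>b\<in>Basis. inverse (1 + (x \<bullet> b)\<^sup>2))"
    by (rule lborel_prod_Basis(1))
  show "AE x::'a in lborel. norm (1 / (1 + norm x) ^ (2 * DIM('a))) \<le> norm (\<Prod>b\<in>Basis. inverse (1 + (x \<bullet> b)\<^sup>2))"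
  proof (rule AE_I2)
    fix x :: 'a
    have "(\<Prod>b\<in>Basis. 1 + (x \<bullet> b)\<^sup>2) \<le> (\<Prod>b\<in>(Basis::'a set). (1 + norm x)\<^sup>2)"
    proof (rule prod_mono, intro conjI)
      fix b :: 'a assume b: "b \<in> Basis"
      have "(x \<bullet> b)\<^sup>2 \<le> (norm x)\<^sup>2"
        using Basis_le_norm[OF b, of x] by (rule abs_le_square_iff[THEN iffD1, OF order_trans]) simp
      then show "1 + (x \<bullet> b)\<^sup>2 \<le> (1 + norm x)\<^sup>2" by (simp add: power2_sum add_increasing2)
    qed (auto intro: add_nonneg_nonneg)
    also have "\<dots> = (1 + norm x) ^ (2 * DIM('a))" by (simp add: power_mult)
    finally have "inverse ((1 + norm x) ^ (2 * DIM('a))) \<le> inverse (\<Prod>b\<in>Basis. 1 + (x \<bullet> b)\<^sup>2)"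
      by (intro le_imp_inverse_le prod_pos) (auto intro: add_pos_nonneg)
    then show "norm (1 / (1 + norm x) ^ (2 * DIM('a))) \<le> norm (\<Prod>b\<in>Basis. inverse (1 + (x \<bullet> b)\<^sup>2))"
      by (simp add: prod_inversef[symmetric] divide_inverse abs_prod flip: power_inverse)
  qed
qed measurable

lemma integrable_of_decay:
  fixes F :: "'a::euclidean_space \<Rightarrow> 'b::{banach,second_countable_topology}"
  assumes [measurable]: "F \<in> borel_measurable borel" and C: "\<And>x. (1 + norm x) ^ (2 * DIM('a)) * norm (F x) \<le> C"
  shows "integrable lborel F"
proof (rule Bochner_Integration.integrable_bound)
  show "integrable lborel (\<lambda>x::'a. C * (1 / (1 + norm x) ^ (2 * DIM('a))))"
    by (rule integrable_mult_right[OF integrable_weight])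
  show "AE x in lborel. norm (F x) \<le> norm (C * (1 / (1 + norm x) ^ (2 * DIM('a))))"
  proof (rule AE_I2)
    fix x
    have "norm (F x) \<le> C / (1 + norm x) ^ (2 * DIM('a))"
      using C[of x] by (subst pos_le_divide_eq) (auto simp: mult.commute intro!: zero_less_power add_pos_nonneg)
    also have "\<dots> \<le> \<bar>C\<bar> / (1 + norm x) ^ (2 * DIM('a))" by (intro divide_right_mono) auto
    finally show "norm (F x) \<le> norm (C * (1 / (1 + norm x) ^ (2 * DIM('a))))" by simp
  qed
qed measurable

lemma schwartz_integrable:
  assumes "\<phi> \<in> \<S>"
  shows "integrable lborel \<phi>"
proof -
  obtain C where "\<And>x. (1 + norm x) ^ (2 * DIM('a)) * cmod (\<phi> x) \<le> C"
    using schwartz_decay[OF assms] by metis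
  then show ?thesis using assms by (intro integrable_of_decay) auto
qed

lemma integral_affine:
  fixes F :: "'a::euclidean_space \<Rightarrow> 'b::{banach,second_countable_topology}"
  assumes "c \<noteq> 0" and [measurable]: "F \<in> borel_measurable borel"
  shows "(\<integral>x. F x \<partial>lborel) = \<bar>c\<bar> ^ DIM('a) *\<^sub>R (\<integral>x. F (t + c *\<^sub>R x) \<partial>lborel)"
  by (subst lborel_affine[OF assms(1), of t])
    (simp add: integral_density integral_distr ennreal_power)

lemma integral_translate:
  fixes F :: "'a::euclidean_space \<Rightarrow> 'b::{banach,second_countable_topology}"
  assumes "F \<in> borel_measurable borel"
  shows "(\<integral>x. F (x + t) \<partial>lborel) = (\<integral>x. F x \<partial>lborel)"
  using integral_affine[OF _ assms, of 1 t] by (simp add: add.commute)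

text \<open>By translation invariance every difference quotient integrates to 0, and dominated
  convergence passes to the derivative. This is the source of integration by parts below.\<close>

lemma schwartz_integral_dir_deriv:
  fixes F :: "'a::euclidean_space \<Rightarrow> complex"
  assumes F: "F \<in> \<S>" and b: "b \<in> Basis"
  shows "(\<integral>x. dir_deriv b F x \<partial>lborel) = 0"
proof -
  let ?N = "2 * DIM('a)"
  have [measurable]: "F \<in> borel_measurable borel" "dir_deriv b F \<in> borel_measurable borel"
    using F schwartz_dir_deriv[OF F b] by auto
  obtain C where C: "C > 0" "\<And>x. (1 + norm x) ^ ?N * cmod (dir_deriv b F x) \<le> C"
    using schwartz_decay[OF schwartz_dir_deriv[OF F b]] by metis
  let ?K = "\<lambda>x. 2 ^ ?N * C * (1 / (1 + norm (x::'a)) ^ ?N)"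
  \<comment> \<open>Steps of length at most 1 change the weight \<open>1 + norm x\<close> by at most
    a factor 2, so the integrable majorant does not depend on \<open>n\<close>.\<close>
  define h where "h n = 1 / real (Suc n)" for n
  have h: "0 < h n" "h n \<le> 1" for n by (auto simp: h_def)
  define D where "D n x = (F (x + h n *\<^sub>R b) - F x) /\<^sub>R h n" for n x
  note path = schwartz_has_derivative_line[OF F]
  have bound: "cmod (D n x) \<le> ?K x" for n x
  proof -
    have d: "cmod (dir_deriv b F (x + s *\<^sub>R b)) \<le> ?K x" if s: "s \<in> {0..h n}" for s
    proof -
      have "1 + norm x \<le> (1 + norm (s *\<^sub>R b)) * (1 + norm (x + s *\<^sub>R b))"
        using norm_le_weight[of x "- s *\<^sub>R b"] by simp
      also have "\<dots> \<le> 2 * (1 + norm (x + s *\<^sub>R b))"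
        using s h[of n] b by (intro mult_right_mono) auto
      finally have "(1 + norm x) ^ ?N \<le> (2 * (1 + norm (x + s *\<^sub>R b))) ^ ?N"
        by (intro power_mono) auto
      then have "(1 + norm x) ^ ?N * cmod (dir_deriv b F (x + s *\<^sub>R b))
          \<le> (2 * (1 + norm (x + s *\<^sub>R b))) ^ ?N * cmod (dir_deriv b F (x + s *\<^sub>R b))"
        by (intro mult_right_mono) auto
      also have "\<dots> = 2 ^ ?N * ((1 + norm (x + s *\<^sub>R b)) ^ ?N * cmod (dir_deriv b F (x + s *\<^sub>R b)))"
        by (simp only: power_mult_distrib mult.assoc)
      also have "\<dots> \<le> 2 ^ ?N * C" by (intro mult_left_mono C(2)) auto
      finally have "cmod (dir_deriv b F (x + s *\<^sub>R b)) \<le> 2 ^ ?N * C / (1 + norm x) ^ ?N"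
        by (subst pos_le_divide_eq) (auto simp: mult.commute intro!: zero_less_power add_pos_nonneg)
      then show ?thesis by simp
    qed
    have "cmod (F (x + h n *\<^sub>R b) - F (x + 0 *\<^sub>R b)) \<le> ?K x * norm (h n - 0)"
    proof (rule differentiable_bound[of "{0..h n}", OF _ path])
      show "onorm (\<lambda>r. r *\<^sub>R dir_deriv b F (x + s *\<^sub>R b)) \<le> ?K x"
        if "s \<in> {0..h n}" for s
      proof (rule onorm_le)
        fix r :: real
        have "\<bar>r\<bar> * cmod (dir_deriv b F (x + s *\<^sub>R b)) \<le> \<bar>r\<bar> * ?K x"
          by (rule mult_left_mono[OF d[OF that]]) simp
        then show "cmod (r *\<^sub>R dir_deriv b F (x + s *\<^sub>R b)) \<le> ?K x * norm r"
          by (simp only: norm_scaleR real_norm_def mult.commute[of _ "\<bar>r\<bar>"])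
      qed
    qed (use h[of n] in auto)
    moreover have "cmod (D n x) = cmod (F (x + h n *\<^sub>R b) - F x) / h n"
      unfolding D_def norm_scaleR using h[of n] by (simp add: divide_inverse)
    ultimately show ?thesis
      using h[of n] by (simp add: pos_divide_le_eq)
  qed
  have "(\<lambda>n. \<integral>x. D n x \<partial>lborel) \<longlonglongrightarrow> (\<integral>x. dir_deriv b F x \<partial>lborel)"
  proof (rule integral_dominated_convergence)
    show "integrable lborel ?K"
      by (rule integrable_mult_right[OF integrable_weight])
    show "AE x in lborel. (\<lambda>n. D n x) \<longlonglongrightarrow> dir_deriv b F x"
    proof (rule AE_I2)
      fix x
      have "((\<lambda>s. F (x + s *\<^sub>R b)) has_vector_derivative dir_deriv b F x) (at 0)"
        using path[where x=x and s=0 and S=UNIV] by (simp add: has_vector_derivative_def)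
      then have "((\<lambda>s. (F (x + s *\<^sub>R b) - F x) /\<^sub>R s) \<longlongrightarrow> dir_deriv b F x) (at 0)"
      proof -
        have "((\<lambda>s. norm (F (x + s *\<^sub>R b) - F x - s *\<^sub>R dir_deriv b F x) / norm s) \<longlongrightarrow> 0) (at 0)"
          using path[where x=x and s=0 and S=UNIV] by (simp add: has_derivative_iff_norm)
        moreover have "\<forall>\<^sub>F s in at 0. norm (F (x + s *\<^sub>R b) - F x - s *\<^sub>R dir_deriv b F x) / norm s
            = norm ((F (x + s *\<^sub>R b) - F x) /\<^sub>R s - dir_deriv b F x)"
        proof (rule eventually_at_topological[THEN iffD2], intro exI[of _ UNIV], safe)
          fix s :: real assume "s \<noteq> 0"
          then have "(F (x + s *\<^sub>R b) - F x) /\<^sub>R s - dir_deriv b F x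
              = (F (x + s *\<^sub>R b) - F x - s *\<^sub>R dir_deriv b F x) /\<^sub>R s"
            by (simp add: scaleR_diff_right)
          then show "norm (F (x + s *\<^sub>R b) - F x - s *\<^sub>R dir_deriv b F x) / norm s
              = norm ((F (x + s *\<^sub>R b) - F x) /\<^sub>R s - dir_deriv b F x)"
            by (simp only: norm_scaleR) (simp add: divide_inverse mult.commute)
        qed auto
        ultimately have "((\<lambda>s. norm ((F (x + s *\<^sub>R b) - F x) /\<^sub>R s - dir_deriv b F x)) \<longlongrightarrow> 0) (at 0)"
          by (rule Lim_transform_eventually)
        then show ?thesis by (rule LIM_zero_cancel[OF tendsto_norm_zero_cancel])
      qed
      moreover have "filterlim h (at 0) sequentially"
        unfolding h_def filterlim_at
        using LIMSEQ_inverse_real_of_nat by (simp add: divide_inverse)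
      ultimately show "(\<lambda>n. D n x) \<longlonglongrightarrow> dir_deriv b F x"
        unfolding D_def by (rule filterlim_compose)
    qed
  qed (use bound in \<open>auto simp: D_def\<close>)
  moreover have "(\<integral>x. D n x \<partial>lborel) = 0" for n
  proof -
    have "integrable lborel (\<lambda>x. F (x + h n *\<^sub>R b))"
      using schwartz_integrable[OF schwartz_tf_shift[OF F, of "(- h n *\<^sub>R b, 0)"]] by (simp add: tf_shift_def)
    then have "(\<integral>x. D n x \<partial>lborel) = ((\<integral>x. F (x + h n *\<^sub>R b) \<partial>lborel) - (\<integral>x. F x \<partial>lborel)) /\<^sub>R h n"
      unfolding D_def using schwartz_integrable[OF F] by simp
    then show ?thesis by (simp add: integral_translate)
  qed
  ultimately show ?thesis by (simp add: LIMSEQ_const_iff)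
qed

section \<open>Fourier transform of the Gaussian and Fourier inversion\<close>

lemma gauss_fourier_real:
  shows "integrable lborel (\<lambda>x::real. complex_of_real (exp (- pi * (x * x))) * cis (2 * pi * (t * x)))"
    and "(\<integral>x. complex_of_real (exp (- pi * (x * x))) * cis (2 * pi * (t * x)) \<partial>lborel)
       = complex_of_real (exp (- pi * (t * t)))"
proof -
  let ?f = "\<lambda>x::real. complex_of_real (exp (- pi * (x * x))) * cis (2 * pi * (t * x))"
  have "integrable lborel (gauss :: real \<Rightarrow> complex)"
    by (rule schwartz_integrable[OF gauss_schwartz])
  then show "integrable lborel ?f"
    by (rule Bochner_Integration.integrable_bound) (auto simp: gauss_def norm_mult)
  \<comment> \<open>Rescaling by \<open>sqrt (2 * pi)\<close> turns the standard normal density into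
    \<open>exp (- pi * (x * x))\<close> divided by \<open>s\<close>, so its known characteristic
    function yields the transform in the present normalisation.\<close>
  define s where "s = sqrt (2 * pi)"
  have s: "s > 0" "s * s = 2 * pi" by (auto simp: s_def)
  have "complex_of_real (exp (- (s * t)\<^sup>2 / 2)) = char std_normal_distribution (s * t)"
    by (simp add: char_std_normal_distribution)
  also have "\<dots> = (\<integral>x. std_normal_density x *\<^sub>R iexp (s * t * x) \<partial>lborel)"
    unfolding char_def by (subst integral_density) auto
  also have "\<dots> = s *\<^sub>R (\<integral>x. std_normal_density (s * x) *\<^sub>R iexp (s * t * (s * x)) \<partial>lborel)"
    using lborel_integral_real_affine[of s "\<lambda>x. std_normal_density x *\<^sub>R iexp (s * t * x)" 0] s by simp
  also have "(\<lambda>x. std_normal_density (s * x) *\<^sub>R iexp (s * t * (s * x))) = (\<lambda>x. (1 / s) *\<^sub>R ?f x)"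
  proof
    fix x
    have "(s * x)\<^sup>2 / 2 = pi * (x * x)" using s(2) by (simp add: power2_eq_square)
    moreover have "s * t * (s * x) = 2 * pi * (t * x)"
      using s(2) by (metis mult.assoc mult.commute)
    then have "iexp (s * t * (s * x)) = cis (2 * pi * (t * x))"
      by (simp only: cis_conv_exp)
    ultimately show "std_normal_density (s * x) *\<^sub>R iexp (s * t * (s * x)) = (1 / s) *\<^sub>R ?f x"
      by (simp only: std_normal_density_def) (simp add: s_def[symmetric] scaleR_conv_of_real)
  qed
  also have "s *\<^sub>R (\<integral>x. (1 / s) *\<^sub>R ?f x \<partial>lborel) = (\<integral>x. ?f x \<partial>lborel)"
    using s by simp
  finally have "(\<integral>x. ?f x \<partial>lborel) = complex_of_real (exp (- (s * t)\<^sup>2 / 2))" by simp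
  moreover have "(s * t)\<^sup>2 = (s * s) * (t * t)" by (simp add: power2_eq_square)
  ultimately show "(\<integral>x. ?f x \<partial>lborel) = complex_of_real (exp (- pi * (t * t)))"
    by (simp add: s(2))
qed

lemma gauss_prod: "gauss x = (\<Prod>b\<in>Basis. complex_of_real (exp (- pi * ((x \<bullet> b) * (x \<bullet> b)))))"
  unfolding gauss_def
  by (subst euclidean_inner) (simp add: exp_sum sum_distrib_left sum_negf[symmetric])

lemma gauss_fourier:
  fixes y :: "'a::euclidean_space"
  shows "(\<integral>w. gauss w * cis (2 * pi * (w \<bullet> y)) \<partial>lborel) = gauss y"
proof -
  have "gauss w * cis (2 * pi * (w \<bullet> y))
      = (\<Prod>b\<in>Basis. complex_of_real (exp (- pi * ((w \<bullet> b) * (w \<bullet> b)))) * cis (2 * pi * ((y \<bullet> b) * (w \<bullet> b))))" for w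
  proof -
    have "cis (2 * pi * (w \<bullet> y)) = (\<Prod>b\<in>Basis. cis (2 * pi * ((y \<bullet> b) * (w \<bullet> b))))"
      by (subst euclidean_inner) (simp add: cis_conv_exp exp_sum sum_distrib_left mult_ac)
    then show ?thesis by (simp add: gauss_prod prod.distrib)
  qed
  then show ?thesis
    using lborel_prod_Basis(2)[OF gauss_fourier_real(1), of "\<lambda>b. y \<bullet> b"]
    by (simp only: gauss_fourier_real(2) gauss_prod)
qed

lemma gauss_integral: "(\<integral>x. gauss (x::'a::euclidean_space) \<partial>lborel) = 1"
  using gauss_fourier[of "0::'a"] by (simp add: gauss_def)

lemma gauss_fourier_scaled:
  fixes u :: "'a::euclidean_space"
  assumes "e > 0"
  shows "(\<integral>w. gauss (e *\<^sub>R w) * cis (2 * pi * (w \<bullet> u)) \<partial>lborel) = gauss (u /\<^sub>R e) /\<^sub>R e ^ DIM('a)"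
proof -
  have [measurable]: "(gauss :: 'a \<Rightarrow> complex) \<in> borel_measurable borel"
    by (rule schwartz_measurable[OF gauss_schwartz])
  have "gauss (u /\<^sub>R e) = (\<integral>w. gauss w * cis (2 * pi * (w \<bullet> (u /\<^sub>R e))) \<partial>lborel)"
    by (simp only: gauss_fourier)
  also have "\<dots> = \<bar>e\<bar> ^ DIM('a) *\<^sub>R (\<integral>w. gauss (0 + e *\<^sub>R w) * cis (2 * pi * ((0 + e *\<^sub>R w) \<bullet> (u /\<^sub>R e))) \<partial>lborel)"
    by (rule integral_affine) (use assms in \<open>simp_all add: cis_conv_exp\<close>)
  also have "\<dots> = e ^ DIM('a) *\<^sub>R (\<integral>w. gauss (e *\<^sub>R w) * cis (2 * pi * (w \<bullet> u)) \<partial>lborel)"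
  proof -
    have "(0 + e *\<^sub>R w) \<bullet> (u /\<^sub>R e) = w \<bullet> u" for w using assms by simp
    then show ?thesis using assms by (simp only: add_0 abs_of_pos)
  qed
  finally show ?thesis using assms by simp
qed

lemma integrable_pair_dominated:
  fixes F :: "'a::euclidean_space \<Rightarrow> 'b::euclidean_space \<Rightarrow> 'c::{banach,second_countable_topology}"
  assumes [measurable]: "(\<lambda>(x, y). F x y) \<in> borel_measurable (lborel \<Otimes>\<^sub>M lborel)"
    and u: "integrable lborel u" and v: "integrable lborel v"
    and le: "\<And>x y. norm (F x y) = u x * v y"
  shows "integrable (lborel \<Otimes>\<^sub>M lborel) (\<lambda>(x, y). F x y)"
proof (rule lborel_pair.Fubini_integrable)
  show "integrable lborel (\<lambda>x. \<integral>y. norm (case (x, y) of (x, y) \<Rightarrow> F x y) \<partial>lborel)"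
    using u by (simp add: le)
  have "(\<lambda>y. F x y) \<in> borel_measurable lborel" for x by measurable
  then show "AE x in lborel. integrable lborel (\<lambda>y. case (x, y) of (x, y) \<Rightarrow> F x y)"
    using v by (intro AE_I2) (simp add: le flip: integrable_norm_iff)
qed fact

definition fourier :: "('a::euclidean_space \<Rightarrow> complex) \<Rightarrow> 'a \<Rightarrow> complex" where
  "fourier m \<omega> = (\<integral>t. m t * cis (- (2 * pi * (\<omega> \<bullet> t))) \<partial>lborel)"

lemma fourier_measurable [measurable]:
  assumes "m \<in> \<S>"
  shows "fourier m \<in> borel_measurable borel"
proof -
  have [measurable]: "m \<in> borel_measurable borel" using assms by auto
  have "(\<lambda>\<omega>. \<integral>t. m t * cis (- (2 * pi * (\<omega> \<bullet> t))) \<partial>lborel) \<in> borel_measurable borel"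
    by (rule lborel.borel_measurable_lebesgue_integral) measurable
  then show ?thesis unfolding fourier_def [abs_def] .
qed

text \<open>A Gaussian factor \<open>gauss (\<epsilon> \<omega>)\<close> makes Fubini applicable and turns the inversion integral into
  an average of \<open>m\<close> around \<open>y\<close>; then let \<open>\<epsilon> \<rightarrow> 0\<close> on both sides.\<close>

lemma fourier_inversion:
  fixes m :: "'a::euclidean_space \<Rightarrow> complex"
  assumes m: "m \<in> \<S>" and int: "integrable lborel (fourier m)"
  shows "m y = (\<integral>\<omega>. fourier m \<omega> * cis (2 * pi * (\<omega> \<bullet> y)) \<partial>lborel)"
proof -
  have [measurable]: "m \<in> borel_measurable borel" "fourier m \<in> borel_measurable borel"
    using m fourier_measurable[OF m] by auto
  have gm [measurable]: "(gauss :: 'a \<Rightarrow> complex) \<in> borel_measurable borel"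
    by (rule schwartz_measurable[OF gauss_schwartz])
  have gi: "integrable lborel (gauss :: 'a \<Rightarrow> complex)"
    by (rule schwartz_integrable[OF gauss_schwartz])
  have g1: "cmod (gauss x) \<le> 1" for x :: 'a by (simp add: gauss_def)
  have gc: "continuous_on UNIV (gauss :: 'a \<Rightarrow> complex)"
    by (rule schwartz_continuous[OF gauss_schwartz])
  have mi: "integrable lborel m" by (rule schwartz_integrable[OF m])
  define h where "h n = 1 / real (Suc n)" for n
  have h: "h n > 0" for n by (simp add: h_def)
  have hlim: "h \<longlonglongrightarrow> 0" unfolding h_def using LIMSEQ_inverse_real_of_nat by (simp add: divide_inverse)
  define I where "I n = (\<integral>\<omega>. fourier m \<omega> * cis (2 * pi * (\<omega> \<bullet> y)) * gauss (h n *\<^sub>R \<omega>) \<partial>lborel)" for n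
  have limI: "I \<longlonglongrightarrow> (\<integral>\<omega>. fourier m \<omega> * cis (2 * pi * (\<omega> \<bullet> y)) * 1 \<partial>lborel)"
    unfolding I_def
  proof (rule integral_dominated_convergence)
    show "integrable lborel (\<lambda>\<omega>. cmod (fourier m \<omega>))" using int by simp
    show "AE \<omega> in lborel. (\<lambda>n. fourier m \<omega> * cis (2 * pi * (\<omega> \<bullet> y)) * gauss (h n *\<^sub>R \<omega>))
        \<longlonglongrightarrow> fourier m \<omega> * cis (2 * pi * (\<omega> \<bullet> y)) * 1"
    proof (rule AE_I2)
      fix \<omega> :: 'a
      have "(\<lambda>n. gauss (h n *\<^sub>R \<omega>)) \<longlonglongrightarrow> gauss (0 *\<^sub>R \<omega>)"
        by (rule continuous_on_tendsto_compose[OF gc tendsto_scaleR[OF hlim tendsto_const]]) auto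
      then have "(\<lambda>n. gauss (h n *\<^sub>R \<omega>)) \<longlonglongrightarrow> 1" by (simp add: gauss_def)
      then show "(\<lambda>n. fourier m \<omega> * cis (2 * pi * (\<omega> \<bullet> y)) * gauss (h n *\<^sub>R \<omega>))
        \<longlonglongrightarrow> fourier m \<omega> * cis (2 * pi * (\<omega> \<bullet> y)) * 1" by (intro tendsto_intros)
    qed
  qed (use g1 in \<open>auto simp: norm_mult mult_left_le\<close>)
  have I_eq: "I n = (\<integral>s. m (y + h n *\<^sub>R s) * gauss s \<partial>lborel)" for n
  proof -
    define F where "F \<omega> t = m t * gauss (h n *\<^sub>R \<omega>) * cis (2 * pi * (\<omega> \<bullet> (y - t)))" for \<omega> t
    have gin: "integrable lborel (\<lambda>\<omega>::'a. cmod (gauss (h n *\<^sub>R \<omega>)))"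
    proof (rule integrable_norm)
      show "integrable lborel (\<lambda>\<omega>::'a. gauss (h n *\<^sub>R \<omega>))"
        using schwartz_integrable[OF schwartz_linear_compose[OF gauss_schwartz, of "\<lambda>\<omega>::'a. h n *\<^sub>R \<omega>"]] h[of n]
        by (simp add: o_def inj_on_def linear_scale_self)
    qed
    have "integrable (lborel \<Otimes>\<^sub>M lborel) (\<lambda>(\<omega>, t). F \<omega> t)"
    proof (rule integrable_pair_dominated[OF _ gin integrable_norm[OF mi]])
      show "(\<lambda>(\<omega>, t). F \<omega> t) \<in> borel_measurable (lborel \<Otimes>\<^sub>M lborel)"
        unfolding F_def by measurable
    qed (simp add: F_def norm_mult)
    then have "(\<integral>\<omega>. (\<integral>t. F \<omega> t \<partial>lborel) \<partial>lborel) = (\<integral>t. (\<integral>\<omega>. F \<omega> t \<partial>lborel) \<partial>lborel)"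
      using lborel_pair.Fubini_integral[of F] by simp
    moreover have "(\<integral>t. F \<omega> t \<partial>lborel) = fourier m \<omega> * cis (2 * pi * (\<omega> \<bullet> y)) * gauss (h n *\<^sub>R \<omega>)" for \<omega>
    proof -
      have "F \<omega> t = (m t * cis (- (2 * pi * (\<omega> \<bullet> t)))) * (cis (2 * pi * (\<omega> \<bullet> y)) * gauss (h n *\<^sub>R \<omega>))" for t
      proof -
        have "cis (2 * pi * (\<omega> \<bullet> (y - t))) = cis (- (2 * pi * (\<omega> \<bullet> t))) * cis (2 * pi * (\<omega> \<bullet> y))"
          by (simp add: cis_mult inner_diff_right algebra_simps)
        then show ?thesis by (simp add: F_def mult_ac)
      qed
      then have "(\<integral>t. F \<omega> t \<partial>lborel) = fourier m \<omega> * (cis (2 * pi * (\<omega> \<bullet> y)) * gauss (h n *\<^sub>R \<omega>))"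
        unfolding fourier_def by (simp only: integral_mult_left_zero)
      then show ?thesis by (simp only: mult.assoc)
    qed
    moreover have "(\<integral>\<omega>. F \<omega> t \<partial>lborel) = m t * (gauss ((y - t) /\<^sub>R h n) /\<^sub>R h n ^ DIM('a))" for t
      unfolding F_def mult.assoc[of "m t"] by (simp only: integral_mult_right_zero gauss_fourier_scaled[OF h])
    ultimately have "I n = (\<integral>t. m t * (gauss ((y - t) /\<^sub>R h n) /\<^sub>R h n ^ DIM('a)) \<partial>lborel)"
      by (simp add: I_def)
    also have "\<dots> = \<bar>h n\<bar> ^ DIM('a) *\<^sub>R (\<integral>s. m (y + h n *\<^sub>R s) * (gauss ((y - (y + h n *\<^sub>R s)) /\<^sub>R h n) /\<^sub>R h n ^ DIM('a)) \<partial>lborel)"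
      by (rule integral_affine) (use h[of n] in auto)
    also have "\<dots> = (\<integral>s. m (y + h n *\<^sub>R s) * gauss s \<partial>lborel)"
      using h[of n] by (simp add: gauss_def)
    finally show ?thesis .
  qed
  have "(\<lambda>n. \<integral>s. m (y + h n *\<^sub>R s) * gauss s \<partial>lborel) \<longlonglongrightarrow> (\<integral>s. m y * gauss (s::'a) \<partial>lborel)"
  proof -
    obtain B where B: "\<And>x. cmod (m x) \<le> B" using schwartz_power_bound[OF m, of 0] by auto
    show ?thesis
    proof (rule integral_dominated_convergence)
      show "integrable lborel (\<lambda>s::'a. B * cmod (gauss s))" using gi by simp
      show "AE s in lborel. (\<lambda>n. m (y + h n *\<^sub>R s) * gauss s) \<longlonglongrightarrow> m y * gauss s"
      proof (rule AE_I2)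
        fix s :: 'a
        have "(\<lambda>n. m (y + h n *\<^sub>R s)) \<longlonglongrightarrow> m (y + 0 *\<^sub>R s)"
          by (rule continuous_on_tendsto_compose[OF schwartz_continuous[OF m]
                tendsto_add[OF tendsto_const tendsto_scaleR[OF hlim tendsto_const]]]) auto
        then show "(\<lambda>n. m (y + h n *\<^sub>R s) * gauss s) \<longlonglongrightarrow> m y * gauss s"
          by (auto intro!: tendsto_intros)
      qed
    qed (use B in \<open>auto simp: norm_mult intro!: mult_right_mono\<close>)
  qed
  from LIMSEQ_unique[OF limI this[folded I_eq]] show ?thesis by (simp add: gauss_integral)
qed

section \<open>Decay and inversion of the short-time Fourier transform\<close>

definition cross_stft :: "('a::euclidean_space \<Rightarrow> complex) \<Rightarrow> ('a \<Rightarrow> complex) \<Rightarrow> 'a \<times> 'a \<Rightarrow> complex" where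
  "cross_stft E H w = (\<integral>t. H t * tf_shift (fst w, - snd w) E t \<partial>lborel)"

text \<open>The position lies at distance \<open>norm (t - fst w)\<close> from \<open>t\<close>, so
  its weight splits into one absorbed by \<open>H\<close> at \<open>t\<close> and one absorbed by
  \<open>E\<close> at \<open>t - fst w\<close>. The further \<open>2 * DIM('a)\<close> powers of
  decay of \<open>H\<close> leave an integrable function of \<open>t\<close>.\<close>

lemma cross_stft_decay_fst:
  fixes E H :: "'a::euclidean_space \<Rightarrow> complex"
  assumes E: "E \<in> \<S>" and H: "H \<in> \<S>"
  shows "\<exists>C. \<forall>w. (1 + norm (fst w)) ^ k * cmod (cross_stft E H w) \<le> C"
proof -
  let ?N = "2 * DIM('a)"
  obtain CE where CE: "CE > 0" "\<And>x. (1 + norm x) ^ k * cmod (E x) \<le> CE" using schwartz_decay[OF E] by metis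
  obtain CH where CH: "CH > 0" "\<And>x. (1 + norm x) ^ (?N + k) * cmod (H x) \<le> CH" using schwartz_decay[OF H] by metis
  have "(1 + norm (fst w)) ^ k * cmod (cross_stft E H w) \<le> (\<integral>t. CE * CH * (1 / (1 + norm (t::'a)) ^ ?N) \<partial>lborel)" for w
  proof -
    have "(1 + norm (fst w)) ^ k * cmod (cross_stft E H w) = cmod (\<integral>t. (1 + norm (fst w)) ^ k *\<^sub>R (H t * tf_shift (fst w, - snd w) E t) \<partial>lborel)"
      by (simp add: cross_stft_def)
    also have "\<dots> \<le> (\<integral>t. cmod ((1 + norm (fst w)) ^ k *\<^sub>R (H t * tf_shift (fst w, - snd w) E t)) \<partial>lborel)"
      by (rule integral_norm_bound)
    also have "\<dots> \<le> (\<integral>t. CE * CH * (1 / (1 + norm (t::'a)) ^ ?N) \<partial>lborel)"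
    proof (rule integral_mono')
      show "integrable lborel (\<lambda>t::'a. CE * CH * (1 / (1 + norm t) ^ ?N))"
        by (rule integrable_mult_right[OF integrable_weight])
      fix t :: 'a
      have "1 + norm (fst w) \<le> (1 + norm t) * (1 + norm (t - fst w))"
        using norm_le_weight[of "fst w" t] by (simp add: norm_minus_commute)
      then have "(1 + norm (fst w)) ^ k * (cmod (H t) * cmod (E (t - fst w)))
          \<le> ((1 + norm t) * (1 + norm (t - fst w))) ^ k * (cmod (H t) * cmod (E (t - fst w)))"
        by (intro mult_right_mono power_mono) auto
      also have "\<dots> = ((1 + norm t) ^ k * cmod (H t)) * ((1 + norm (t - fst w)) ^ k * cmod (E (t - fst w)))"
        by (simp add: power_mult_distrib mult_ac)
      also have "\<dots> \<le> (CH / (1 + norm t) ^ ?N) * CE"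
      proof (intro mult_mono CE)
        have "(1 + norm t) ^ ?N * ((1 + norm t) ^ k * cmod (H t)) \<le> CH"
          using CH(2)[of t] by (simp add: power_add mult_ac)
        then show "(1 + norm t) ^ k * cmod (H t) \<le> CH / (1 + norm t) ^ ?N"
          by (subst pos_le_divide_eq) (auto simp: mult_ac intro!: zero_less_power add_pos_nonneg)
      qed (use CH in auto)
      finally show "cmod ((1 + norm (fst w)) ^ k *\<^sub>R (H t * tf_shift (fst w, - snd w) E t)) \<le> CE * CH * (1 / (1 + norm t) ^ ?N)"
        by (simp add: norm_mult mult_ac)
    qed (use CE CH in auto)
    finally show ?thesis .
  qed
  then show ?thesis by blast
qed

text \<open>The integral of the derivative of the whole integrand vanishes. Differentiating the
  modulation produces the frequency factor, which is thus traded for a derivative on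
  \<open>H\<close> or on \<open>E\<close>.\<close>

lemma cross_stft_by_parts:
  assumes E: "E \<in> \<S>" and H: "H \<in> \<S>" and b: "b \<in> Basis"
  shows "complex_of_real (2 * pi * (snd w \<bullet> b)) * \<i> * cross_stft E H w
    = cross_stft E (dir_deriv b H) w + cross_stft (dir_deriv b E) H w"
proof -
  let ?w = "(fst w, - snd w)"
  define F where "F = (\<lambda>t. H t * tf_shift ?w E t)"
  note S = H E schwartz_dir_deriv[OF H b] schwartz_dir_deriv[OF E b]
  have F: "F \<in> \<S>" unfolding F_def by (intro schwartz_mult schwartz_tf_shift H E)
  have "dir_deriv b F = (\<lambda>t. H t * dir_deriv b (tf_shift ?w E) t + dir_deriv b H t * tf_shift ?w E t)"
    unfolding F_def
    by (rule dir_derivI) (use S in \<open>auto intro!: has_derivative_mult schwartz_has_derivative schwartz_tf_shift\<close>)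
  also have "\<dots> = (\<lambda>t. (dir_deriv b H t * tf_shift ?w E t + H t * tf_shift ?w (dir_deriv b E) t)
      - (complex_of_real (2 * pi * (snd w \<bullet> b)) * \<i>) * F t)"
    unfolding fun_cong[OF dir_deriv_tf_shift[OF E, of ?w b]] F_def by (simp add: algebra_simps)
  finally have D: "dir_deriv b F = \<dots>" .
  have I: "integrable lborel (\<lambda>t. dir_deriv b H t * tf_shift ?w E t)"
    "integrable lborel (\<lambda>t. H t * tf_shift ?w (dir_deriv b E) t)" "integrable lborel F"
    using S F by (auto intro!: schwartz_integrable schwartz_mult schwartz_tf_shift)
  have "0 = (\<integral>t. dir_deriv b F t \<partial>lborel)"
    using schwartz_integral_dir_deriv[OF F b] by simp
  also have "\<dots> = cross_stft E (dir_deriv b H) w + cross_stft (dir_deriv b E) H w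
      - (complex_of_real (2 * pi * (snd w \<bullet> b)) * \<i>) * cross_stft E H w"
    unfolding D cross_stft_def using I by (simp add: F_def)
  finally show ?thesis by simp
qed

text \<open>Each power of a frequency coordinate costs one derivative of one of the two functions,
  hence the induction over all pairs \<open>E\<close>, \<open>H\<close>.\<close>

lemma cross_stft_decay_snd:
  assumes "E \<in> \<S>" "H \<in> \<S>" and b: "b \<in> Basis"
  shows "\<exists>C. \<forall>w. (1 + norm (fst w)) ^ k * (\<bar>snd w \<bullet> b\<bar> ^ l * cmod (cross_stft E H w)) \<le> C"
  using assms(1,2)
proof (induction l arbitrary: E H)
  case 0
  then show ?case using cross_stft_decay_fst by simp
next
  case (Suc l)
  obtain C1 where C1: "\<And>w. (1 + norm (fst w)) ^ k * (\<bar>snd w \<bullet> b\<bar> ^ l * cmod (cross_stft E (dir_deriv b H) w)) \<le> C1"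
    using Suc.IH[OF Suc.prems(1) schwartz_dir_deriv[OF Suc.prems(2) b]] by metis
  obtain C2 where C2: "\<And>w. (1 + norm (fst w)) ^ k * (\<bar>snd w \<bullet> b\<bar> ^ l * cmod (cross_stft (dir_deriv b E) H w)) \<le> C2"
    using Suc.IH[OF schwartz_dir_deriv[OF Suc.prems(1) b] Suc.prems(2)] by metis
  have "(1 + norm (fst w)) ^ k * (\<bar>snd w \<bullet> b\<bar> ^ Suc l * cmod (cross_stft E H w)) \<le> C1 + C2" for w
  proof -
    \<comment> \<open>The factor \<open>2 * pi\<close> from integration by parts exceeds 1 and may
      be inserted for free.\<close>
    have "\<bar>snd w \<bullet> b\<bar> * cmod (cross_stft E H w) \<le> 2 * pi * (\<bar>snd w \<bullet> b\<bar> * cmod (cross_stft E H w))"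
      using mult_right_mono[of 1 "2 * pi" "\<bar>snd w \<bullet> b\<bar> * cmod (cross_stft E H w)"] pi_gt3 by simp
    also have "\<dots> = cmod (complex_of_real (2 * pi * (snd w \<bullet> b)) * \<i> * cross_stft E H w)"
      by (simp add: norm_mult abs_mult)
    also have "\<dots> \<le> cmod (cross_stft E (dir_deriv b H) w) + cmod (cross_stft (dir_deriv b E) H w)"
      unfolding cross_stft_by_parts[OF Suc.prems b] by (rule norm_triangle_ineq)
    finally have "(1 + norm (fst w)) ^ k * \<bar>snd w \<bullet> b\<bar> ^ l * (\<bar>snd w \<bullet> b\<bar> * cmod (cross_stft E H w))
        \<le> (1 + norm (fst w)) ^ k * \<bar>snd w \<bullet> b\<bar> ^ l * (cmod (cross_stft E (dir_deriv b H) w) + cmod (cross_stft (dir_deriv b E) H w))"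
      by (intro mult_left_mono) auto
    then show ?thesis using C1[of w] C2[of w] by (simp add: algebra_simps)
  qed
  then show ?case by blast
qed

lemma cross_stft_decay:
  fixes E H :: "'a::euclidean_space \<Rightarrow> complex"
  assumes E: "E \<in> \<S>" and H: "H \<in> \<S>"
  shows "\<exists>C. \<forall>w. (1 + norm w) ^ k * cmod (cross_stft E H w) \<le> C"
proof -
  let ?D = "real DIM('a)"
  obtain C0 where C0: "\<And>w. (1 + norm (fst w)) ^ k * cmod (cross_stft E H w) \<le> C0"
    using cross_stft_decay_fst[OF E H] by metis
  have "\<forall>b\<in>Basis. \<exists>C. \<forall>w. (1 + norm (fst w)) ^ k * (\<bar>snd w \<bullet> b\<bar> ^ k * cmod (cross_stft E H w)) \<le> C"
    using cross_stft_decay_snd[OF E H] by blast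
  then obtain C where C: "\<forall>b\<in>Basis. \<forall>w. (1 + norm (fst w)) ^ k * (\<bar>snd w \<bullet> b\<bar> ^ k * cmod (cross_stft E H w)) \<le> C b"
    by (rule bchoice[THEN exE])
  have "(1 + norm w) ^ k * cmod (cross_stft E H w) \<le> 2 ^ k * (C0 + ?D ^ k * (\<Sum>b\<in>Basis. C b))" for w :: "'a \<times> 'a"
  proof -
    have "norm w \<le> norm (fst w) + norm (snd w)"
      using norm_Pair_le[of "fst w" "snd w"] by simp
    then have "1 + norm w \<le> (1 + norm (fst w)) * (1 + norm (snd w))"
    proof -
      have "(1 + norm (fst w)) * (1 + norm (snd w)) = 1 + norm (fst w) + norm (snd w) + norm (fst w) * norm (snd w)"
        by (simp add: algebra_simps)
      moreover have "norm (fst w) * norm (snd w) \<ge> 0" by simp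
      ultimately show ?thesis using \<open>norm w \<le> norm (fst w) + norm (snd w)\<close> by linarith
    qed
    then have 1: "(1 + norm w) ^ k \<le> (1 + norm (fst w)) ^ k * (1 + norm (snd w)) ^ k"
      by (simp add: power_mono flip: power_mult_distrib)
    have 2: "norm (snd w) ^ k \<le> ?D ^ k * (\<Sum>b\<in>Basis. \<bar>snd w \<bullet> b\<bar> ^ k)"
    proof -
      \<comment> \<open>Comparing with the largest coordinate avoids expanding the
        \<open>k\<close>-th power of a sum of coordinates.\<close>
      let ?M = "Max ((\<lambda>b. \<bar>snd w \<bullet> b\<bar>) ` Basis)"
      have "?M \<in> (\<lambda>b. \<bar>snd w \<bullet> b\<bar>) ` Basis" by (rule Max_in) auto
      then obtain c where c: "?M = \<bar>snd w \<bullet> c\<bar>" "c \<in> Basis" by (rule imageE)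
      have "norm (snd w) \<le> (\<Sum>b\<in>Basis. \<bar>snd w \<bullet> b\<bar>)" by (rule norm_le_l1)
      also have "\<dots> \<le> (\<Sum>b\<in>(Basis::'a set). ?M)" by (intro sum_mono Max_ge) auto
      also have "\<dots> = ?D * \<bar>snd w \<bullet> c\<bar>" using c by simp
      finally have "norm (snd w) ^ k \<le> (?D * \<bar>snd w \<bullet> c\<bar>) ^ k" by (rule power_mono) simp
      also have "\<dots> = ?D ^ k * \<bar>snd w \<bullet> c\<bar> ^ k" by (rule power_mult_distrib)
      also have "\<dots> \<le> ?D ^ k * (\<Sum>b\<in>Basis. \<bar>snd w \<bullet> b\<bar> ^ k)"
        using member_le_sum[of c Basis "\<lambda>b. \<bar>snd w \<bullet> b\<bar> ^ k"] c by (intro mult_left_mono) auto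
      finally show ?thesis .
    qed
    let ?f = "(1 + norm (fst w)) ^ k" and ?V = "cmod (cross_stft E H w)"
    have "(1 + norm (snd w)) ^ k \<le> 2 ^ k * (1 + ?D ^ k * (\<Sum>b\<in>Basis. \<bar>snd w \<bullet> b\<bar> ^ k))"
      by (rule order_trans[OF one_plus_power_le]) (use 2 in auto)
    then have "(1 + norm w) ^ k * ?V \<le> (?f * (2 ^ k * (1 + ?D ^ k * (\<Sum>b\<in>Basis. \<bar>snd w \<bullet> b\<bar> ^ k)))) * ?V"
      by (intro mult_right_mono order_trans[OF 1] mult_left_mono) auto
    also have "\<dots> = 2 ^ k * (?f * ?V + ?D ^ k * (\<Sum>b\<in>Basis. ?f * (\<bar>snd w \<bullet> b\<bar> ^ k * ?V)))"
      by (simp add: algebra_simps sum_distrib_left sum_distrib_right)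
    also have "\<dots> \<le> 2 ^ k * (C0 + ?D ^ k * (\<Sum>b\<in>Basis. C b))"
      by (intro mult_left_mono add_mono sum_mono C0 C[rule_format]) auto
    finally show ?thesis .
  qed
  then show ?thesis by blast
qed

lemma cross_stft_measurable:
  assumes "E \<in> \<S>" "H \<in> \<S>"
  shows "cross_stft E H \<in> borel_measurable borel"
proof -
  have [measurable]: "E \<in> borel_measurable borel" "H \<in> borel_measurable borel"
    using assms by auto
  have "(\<lambda>w. \<integral>t. H t * tf_shift (fst w, - snd w) E t \<partial>lborel) \<in> borel_measurable (borel \<Otimes>\<^sub>M borel)"
    unfolding tf_shift_def by (rule lborel.borel_measurable_lebesgue_integral) (simp, measurable)
  then show ?thesis unfolding borel_prod cross_stft_def [abs_def] .
qed

text \<open>The reconstruction formula with \<open>a = V / c\<close>, where \<open>V\<close> is the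
  short-time Fourier transform of \<open>H\<close> with window \<open>G\<close> and \<open>c\<close>
  the squared L^2 norm of \<open>G\<close>. Inverting the Fourier transform in the frequency
  variable gives \<open>H y\<close> times the squared modulus of \<open>G (y - x)\<close>, and
  integrating over \<open>x\<close> leaves \<open>c * H y\<close>.\<close>

lemma schwartz_superposition:
  fixes G H :: "'a::euclidean_space \<Rightarrow> complex"
  assumes G: "G \<in> \<S>" and H: "H \<in> \<S>" and nz: "G \<noteq> (\<lambda>_. 0)"
  obtains a :: "'a \<times> 'a \<Rightarrow> complex"
  where "a \<in> borel_measurable lborel" "\<And>m. integrable lborel (\<lambda>w. cmod (a w) * (1 + norm w) ^ m)"
    "\<And>y. H y = (\<integral>w. a w * tf_shift w G y \<partial>lborel)"
proof -
  define E where "E = cnj \<circ> G"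
  have E: "E \<in> \<S>" unfolding E_def by (rule schwartz_cnj[OF G])
  have [measurable]: "G \<in> borel_measurable borel" "E \<in> borel_measurable borel" "H \<in> borel_measurable borel"
    using G E H by auto
  define V where "V = cross_stft E H"
  have V [measurable]: "V \<in> borel_measurable borel"
    unfolding V_def by (rule cross_stft_measurable[OF E H])
  have decay: "\<exists>C. \<forall>w. (1 + norm w) ^ k * cmod (V w) \<le> C" for k
    unfolding V_def by (rule cross_stft_decay[OF E H])
  define c where "c = (\<integral>t. (cmod (G t))\<^sup>2 \<partial>lborel)"
  have GE: "G t * E t = complex_of_real ((cmod (G t))\<^sup>2)" for t
    by (simp add: E_def complex_norm_square del: of_real_power)
  have iG: "integrable lborel (\<lambda>t. G t * E t)"
    by (intro schwartz_integrable schwartz_mult G E)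
  then have iG2: "integrable lborel (\<lambda>t. (cmod (G t))\<^sup>2)"
    unfolding GE by (simp only: complex_of_real_integrable_eq)
  \<comment> \<open>A continuous function that vanishes almost everywhere vanishes identically,
    because a nonempty open set is not negligible.\<close>
  have c: "c \<noteq> 0"
  proof
    assume "c = 0"
    then have "AE t in lborel. (cmod (G t))\<^sup>2 = 0"
      unfolding c_def using integral_nonneg_eq_0_iff_AE[OF iG2] by auto
    then have "AE t in lborel. G t = 0" by simp
    moreover have "open {t. G t \<noteq> 0}"
      using schwartz_continuous[OF G] by (intro open_Collect_neq continuous_on_const)
    ultimately have "{t. G t \<noteq> 0} \<in> null_sets lborel"
      by (subst AE_iff_null_sets) auto
    then have "negligible {t. G t \<noteq> 0}"
      unfolding negligible_iff_null_sets by (rule null_sets_completionI)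
    with \<open>open {t. G t \<noteq> 0}\<close> have "{t. G t \<noteq> 0} = {}"
      using open_not_negligible by blast
    then show False using nz by auto
  qed
  show thesis
  proof (rule that[of "\<lambda>w. V w / c"])
    fix k
    show "integrable lborel (\<lambda>w. cmod (V w / c) * (1 + norm w) ^ k)"
    proof -
      obtain C where C: "\<And>w. (1 + norm w) ^ (2 * DIM('a \<times> 'a) + k) * cmod (V w) \<le> C"
        using decay by metis
      have "integrable lborel (\<lambda>w. cmod (V w) * (1 + norm w) ^ k)"
        by (rule integrable_of_decay[of _ C]) (use C in \<open>auto simp: power_add mult_ac\<close>)
      from integrable_divide[OF this, of "cmod c"] show ?thesis by (simp add: norm_divide)
    qed
  next
    fix y
    obtain B where B: "\<And>x. cmod (G x) \<le> B" using schwartz_power_bound[OF G, of 0] by auto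
    have Vi: "integrable lborel V"
    proof -
      obtain C where C: "\<And>w. (1 + norm w) ^ (2 * DIM('a \<times> 'a)) * cmod (V w) \<le> C"
        using decay by metis
      show ?thesis by (rule integrable_of_decay[OF V C])
    qed
    have tfm [measurable]: "(\<lambda>w. tf_shift w G y) \<in> borel_measurable borel"
      by (rule borel_measurable_continuous_onI[OF tf_shift_continuous[OF G]])
    have "integrable lborel (\<lambda>w. V w * tf_shift w G y)"
    proof (rule Bochner_Integration.integrable_bound)
      show "integrable lborel (\<lambda>w. V w * of_real B)" using Vi by simp
      show "AE w in lborel. norm (V w * tf_shift w G y) \<le> norm (V w * complex_of_real B)"
        using B by (intro AE_I2) (auto simp: norm_mult intro!: mult_left_mono order_trans[OF B abs_ge_self])
    qed measurable
    then have pint: "integrable (lborel \<Otimes>\<^sub>M lborel) (\<lambda>w. V w * tf_shift w G y)"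
      by (simp add: lborel_prod)
    have inner: "(\<integral>\<omega>. V (x, \<omega>) * tf_shift (x, \<omega>) G y \<partial>lborel) = H y * (G (y - x) * E (y - x))" for x
    proof -
      define m where "m = (\<lambda>t. H t * tf_shift (x, 0) E t)"
      have m: "m \<in> \<S>" unfolding m_def by (intro schwartz_mult schwartz_tf_shift E H)
      have Vm: "V (x, \<omega>) = fourier m \<omega>" for \<omega>
        unfolding V_def cross_stft_def fourier_def m_def
        by (intro Bochner_Integration.integral_cong refl) (simp add: tf_shift_def)
      \<comment> \<open>Since \<open>norm \<omega> \<le> norm (x, \<omega>)\<close>, the joint decay
        of \<open>V\<close> makes every frequency section integrable, so inversion is available for
        each \<open>x\<close> and not only for almost every one.\<close>
      obtain C where C: "\<And>w. (1 + norm w) ^ (2 * DIM('a)) * cmod (V w) \<le> C"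
        using decay by metis
      have "integrable lborel (fourier m)"
      proof (rule integrable_of_decay[OF fourier_measurable[OF m]])
        fix \<omega> :: 'a
        have "(1 + norm \<omega>) ^ (2 * DIM('a)) * cmod (fourier m \<omega>) \<le> (1 + norm (x, \<omega>)) ^ (2 * DIM('a)) * cmod (V (x, \<omega>))"
          unfolding Vm by (intro mult_right_mono power_mono) (auto intro: norm_snd_le)
        then show "(1 + norm \<omega>) ^ (2 * DIM('a)) * norm (fourier m \<omega>) \<le> C"
          using C[of "(x, \<omega>)"] by simp
      qed
      from fourier_inversion[OF m this, of y]
      have inv: "m y * G (y - x) = (\<integral>\<omega>. fourier m \<omega> * cis (2 * pi * (\<omega> \<bullet> y)) * G (y - x) \<partial>lborel)"
        by simp
      have VG: "V (x, \<omega>) * tf_shift (x, \<omega>) G y = fourier m \<omega> * cis (2 * pi * (\<omega> \<bullet> y)) * G (y - x)" for \<omega>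
        by (simp add: Vm tf_shift_def)
      have mG: "m y * G (y - x) = H y * (G (y - x) * E (y - x))"
        by (simp add: tf_shift_def m_def)
      show ?thesis by (simp only: VG inv[symmetric] mG)
    qed
    have "(\<integral>w. V w * tf_shift w G y \<partial>lborel) = (\<integral>x. (\<integral>\<omega>. V (x, \<omega>) * tf_shift (x, \<omega>) G y \<partial>lborel) \<partial>lborel)"
      using lborel_pair.integral_fst'[OF pint] by (simp add: lborel_prod)
    also have "\<dots> = (\<integral>x. H y * (G (y - x) * E (y - x)) \<partial>lborel)"
      by (simp only: inner)
    also have "\<dots> = H y * (\<integral>x. G (y - x) * E (y - x) \<partial>lborel)"
      by (rule integral_mult_right_zero)
    also have "(\<integral>x. G (y - x) * E (y - x) \<partial>lborel) = (\<integral>t. G t * E t \<partial>lborel)"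
      using integral_affine[of "- 1" "\<lambda>t. G t * E t" y] by simp
    also have "\<dots> = complex_of_real c"
      unfolding GE c_def by (rule integral_complex_of_real)
    finally show "H y = (\<integral>w. V w / c * tf_shift w G y \<partial>lborel)"
      using c by (simp add: field_simps)
  qed measurable
qed

section \<open>Linear change of variables\<close>

text \<open>Singles out the coordinate along \<open>b\<close> as the innermost integral, the only
  coordinate that the shear below moves.\<close>

lemma nn_integral_lborel_split:
  fixes F :: "'a::euclidean_space \<Rightarrow> ennreal"
  assumes b: "b \<in> Basis" and [measurable]: "F \<in> borel_measurable borel"
  shows "(\<integral>\<^sup>+x. F x \<partial>lborel) =
    (\<integral>\<^sup>+x. (\<integral>\<^sup>+t. F (t *\<^sub>R b + (\<Sum>c\<in>Basis - {b}. x c *\<^sub>R c)) \<partial>lborel) \<partial>(\<Pi>\<^sub>M c\<in>Basis - {b}. lborel))"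
proof -
  interpret product_sigma_finite "\<lambda>_::'a. lborel :: real measure" ..
  have ins: "insert b (Basis - {b}) = (Basis :: 'a set)" using b by auto
  have T: "(\<lambda>f. \<Sum>c\<in>Basis. f c *\<^sub>R c) \<in> measurable (\<Pi>\<^sub>M c\<in>Basis. lborel) (borel :: 'a measure)"
    by measurable
  have m: "(\<lambda>f. F (\<Sum>c\<in>Basis. f c *\<^sub>R c)) \<in> borel_measurable (\<Pi>\<^sub>M c\<in>insert b (Basis - {b}). lborel)"
    unfolding ins by measurable
  have upd: "(\<Sum>c\<in>Basis. (x(b := t)) c *\<^sub>R c) = t *\<^sub>R b + (\<Sum>c\<in>Basis - {b}. x c *\<^sub>R c)"
    for x :: "'a \<Rightarrow> real" and t
    by (subst sum.remove[OF finite_Basis b]) (auto intro!: sum.cong)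
  have "(\<integral>\<^sup>+x. F x \<partial>lborel) = (\<integral>\<^sup>+f. F (\<Sum>c\<in>Basis. f c *\<^sub>R c) \<partial>(\<Pi>\<^sub>M c\<in>Basis. lborel))"
    by (subst lborel_eq, subst nn_integral_distr[OF T]) auto
  also have "\<dots> = (\<integral>\<^sup>+f. F (\<Sum>c\<in>Basis. f c *\<^sub>R c) \<partial>(\<Pi>\<^sub>M c\<in>insert b (Basis - {b}). lborel))"
    by (simp only: ins)
  also have "\<dots> = (\<integral>\<^sup>+x. (\<integral>\<^sup>+t. F (\<Sum>c\<in>Basis. (x(b := t)) c *\<^sub>R c) \<partial>lborel) \<partial>(\<Pi>\<^sub>M c\<in>Basis - {b}. lborel))"
    by (rule product_nn_integral_insert[OF _ _ m]) auto
  finally show ?thesis by (simp only: upd)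
qed

text \<open>With the other coordinates fixed, the shear is a translation along \<open>b\<close>: the
  amount \<open>x \<bullet> v\<close> does not involve the coordinate along \<open>b\<close>, since
  \<open>v\<close> is orthogonal to it.\<close>

lemma lborel_distr_shear:
  fixes b v :: "'a::euclidean_space"
  assumes b: "b \<in> Basis" and v: "v \<bullet> b = 0"
  shows "distr lborel borel (\<lambda>x. x + (x \<bullet> v) *\<^sub>R b) = lborel"
proof (rule measure_eqI)
  fix A assume "A \<in> sets (distr lborel borel (\<lambda>x. x + (x \<bullet> v) *\<^sub>R b))"
  then have A [measurable]: "A \<in> sets borel" by simp
  define S where "S x = (\<Sum>c\<in>Basis - {b}. x c *\<^sub>R c)" for x :: "'a \<Rightarrow> real"
  have tr: "(\<integral>\<^sup>+t. indicator A ((t + s) *\<^sub>R b + z) \<partial>lborel) = (\<integral>\<^sup>+t. indicator A (t *\<^sub>R b + z) \<partial>(lborel :: real measure))" for s z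
    by (subst lborel_distr_plus[of s, symmetric], subst nn_integral_distr) (auto simp: add.commute)
  have "emeasure (distr lborel borel (\<lambda>x. x + (x \<bullet> v) *\<^sub>R b)) A = (\<integral>\<^sup>+x. indicator A (x + (x \<bullet> v) *\<^sub>R b) \<partial>lborel)"
    by (subst nn_integral_indicator[symmetric], simp, subst nn_integral_distr) auto
  also have "\<dots> = (\<integral>\<^sup>+x. (\<integral>\<^sup>+t. indicator A ((t *\<^sub>R b + S x) + ((t *\<^sub>R b + S x) \<bullet> v) *\<^sub>R b) \<partial>lborel) \<partial>(\<Pi>\<^sub>M c\<in>Basis - {b}. lborel))"
    unfolding S_def by (subst nn_integral_lborel_split[OF b]) auto
  also have "\<dots> = (\<integral>\<^sup>+x. (\<integral>\<^sup>+t. indicator A ((t + S x \<bullet> v) *\<^sub>R b + S x) \<partial>lborel) \<partial>(\<Pi>\<^sub>M c\<in>Basis - {b}. lborel))"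
    using v by (intro nn_integral_cong) (simp add: inner_add_left inner_commute[of b] algebra_simps)
  also have "\<dots> = (\<integral>\<^sup>+x. (\<integral>\<^sup>+t. indicator A (t *\<^sub>R b + S x) \<partial>lborel) \<partial>(\<Pi>\<^sub>M c\<in>Basis - {b}. lborel))"
    by (simp only: tr)
  also have "\<dots> = emeasure lborel A"
    unfolding S_def by (subst nn_integral_lborel_split[OF b, symmetric]) auto
  finally show "emeasure (distr lborel borel (\<lambda>x. x + (x \<bullet> v) *\<^sub>R b)) A = emeasure lborel A" .
qed simp

lemma prod_Basis_cart: "(\<Prod>b\<in>Basis. F (x \<bullet> b)) = (\<Prod>i\<in>UNIV. F ((x :: real^'n) $ i))"
proof -
  have B: "(Basis :: (real^'n) set) = (\<lambda>i. axis i 1) ` UNIV"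
    by (auto simp: Basis_vec_def)
  have inj: "inj (\<lambda>i::'n. axis i (1::real))"
    by (auto simp: inj_on_def axis_eq_axis)
  show ?thesis unfolding B prod.reindex[OF inj] by (simp add: inner_axis)
qed

lemma distr_density_const:
  assumes [measurable]: "T \<in> measurable M N"
  shows "distr (density M (\<lambda>_. c)) N T = density (distr M N T) (\<lambda>_. c)"
  by (rule measure_eqI) (simp_all add: emeasure_distr emeasure_density_const)

lemma density_density_const: "density (density M (\<lambda>_. a)) (\<lambda>_. b) = density M (\<lambda>_. a * b)"
  by (rule measure_eqI) (simp_all add: emeasure_density_const mult_ac)

text \<open>Both sides are multiplicative under composition, so elementary linear maps suffice. A
  statement about the pushforward measure serves integrals, L^p norms and essential suprema
  alike.\<close>

lemma lborel_distr_linear: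
  fixes f :: "real^'n \<Rightarrow> real^'n"
  assumes "linear f" "det (matrix f) \<noteq> 0"
  shows "distr lborel borel f = density lborel (\<lambda>_. ennreal (inverse \<bar>det (matrix f)\<bar>))"
proof -
  have meas: "f \<in> borel_measurable borel" if "linear f" for f :: "real^'n \<Rightarrow> real^'n"
    using that by (intro borel_measurable_continuous_onI linear_continuous_on) (simp add: linear_conv_bounded_linear)
  \<comment> \<open>The determinant condition is part of the induction predicate because the
    decomposition into elementary maps also admits singular ones.\<close>
  let ?P = "\<lambda>f. det (matrix f) \<noteq> 0 \<longrightarrow> distr lborel borel f = density lborel (\<lambda>_. ennreal (inverse \<bar>det (matrix f)\<bar>))"
  have "?P f"
  proof (rule induct_linear_elementary[OF assms(1)])
    fix f g :: "real^'n \<Rightarrow> real^'n"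
    assume lin: "linear f" "linear g"
      and f: "?P f"
      and g: "?P g"
    note [measurable] = meas[OF lin(1)] meas[OF lin(2)]
    have m: "det (matrix (f \<circ> g)) = det (matrix f) * det (matrix g)"
      by (simp add: matrix_compose[OF lin(2,1)] det_mul)
    show "?P (f \<circ> g)"
    proof
      assume "det (matrix (f \<circ> g)) \<noteq> 0"
      then have nz: "det (matrix f) \<noteq> 0" "det (matrix g) \<noteq> 0" by (auto simp: m)
      have "distr lborel borel (f \<circ> g) = distr (distr lborel borel g) borel f"
        by (subst distr_distr) auto
      also have "\<dots> = density (distr lborel borel f) (\<lambda>_. ennreal (inverse \<bar>det (matrix g)\<bar>))"
        using g nz by (simp add: distr_density_const)
      also have "\<dots> = density lborel (\<lambda>_. ennreal (inverse \<bar>det (matrix (f \<circ> g))\<bar>))"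
        using f nz by (simp add: density_density_const m abs_mult flip: ennreal_mult)
      finally show "distr lborel borel (f \<circ> g) = density lborel (\<lambda>_. ennreal (inverse \<bar>det (matrix (f \<circ> g))\<bar>))" .
    qed
  next
    fix f :: "real^'n \<Rightarrow> real^'n" and i
    assume "linear f" and 0: "\<And>x. f x $ i = 0"
    \<comment> \<open>This case is vacuous: a vanishing coordinate excludes surjectivity, hence
      injectivity, hence a nonzero determinant.\<close>
    have "\<not> surj f" using 0 by (metis one_neq_zero surjE vec_component)
    then have "\<not> inj f" using linear_injective_imp_surjective[OF \<open>linear f\<close>] by blast
    then show "?P f"
      using det_nz_iff_inj[OF \<open>linear f\<close>] by blast
  next
    fix c :: "'n \<Rightarrow> real"
    let ?f = "\<lambda>x::real^'n. \<chi> i. c i * x $ i"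
    have det: "det (matrix ?f) = (\<Prod>i\<in>UNIV. c i)"
      by (subst det_diagonal) (auto simp: matrix_def axis_def)
    show "?P ?f"
    proof
      assume "det (matrix ?f) \<noteq> 0"
      then have c: "c i \<noteq> 0" for i by (auto simp: det)
      \<comment> \<open>\<open>lborel_affine_euclidean\<close> takes scaling factors indexed by
        basis vectors; the linear extension \<open>d\<close> takes the value \<open>c i\<close> at
        \<open>axis i 1\<close>.\<close>
      define d where "d b = (\<Sum>i\<in>UNIV. c i * (b $ i))" for b :: "real^'n"
      have d: "d (axis i 1) = c i" for i
        by (simp add: d_def axis_def if_distrib cong: if_cong)
      have B: "(Basis :: (real^'n) set) = (\<lambda>i. axis i 1) ` UNIV" by (auto simp: Basis_vec_def)
      have inj: "inj (\<lambda>i::'n. axis i (1::real))" by (auto simp: inj_on_def axis_eq_axis)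
      have eq: "?f = (\<lambda>x. 0 + (\<Sum>j\<in>Basis. (d j * (x \<bullet> j)) *\<^sub>R j))"
      proof
        fix x :: "real^'n"
        have "(\<Sum>j\<in>Basis. (d j * (x \<bullet> j)) *\<^sub>R j) = (\<Sum>k\<in>UNIV. (c k * x $ k) *\<^sub>R axis k 1)"
          unfolding B sum.reindex[OF inj] by (simp add: d inner_axis)
        then show "?f x = 0 + (\<Sum>j\<in>Basis. (d j * (x \<bullet> j)) *\<^sub>R j)"
          by (simp add: vec_eq_iff axis_def if_distrib cong: if_cong)
      qed
      have "lborel = density (distr lborel borel ?f) (\<lambda>_. ennreal (\<Prod>j\<in>Basis. \<bar>d j\<bar>))"
        unfolding eq by (rule lborel_affine_euclidean) (auto simp: B d c)
      then have *: "lborel = density (distr lborel borel ?f) (\<lambda>_. ennreal \<bar>det (matrix ?f)\<bar>)"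
        by (simp add: B prod.reindex[OF inj] d det abs_prod)
      have "density lborel (\<lambda>_. ennreal (inverse \<bar>det (matrix ?f)\<bar>))
          = density (density (distr lborel borel ?f) (\<lambda>_. ennreal \<bar>det (matrix ?f)\<bar>)) (\<lambda>_. ennreal (inverse \<bar>det (matrix ?f)\<bar>))"
        by (subst *) (rule refl)
      also have "\<dots> = distr lborel borel ?f"
        using \<open>det (matrix ?f) \<noteq> 0\<close> by (simp add: density_density_const density_1 flip: ennreal_mult)
      finally show "distr lborel borel ?f = density lborel (\<lambda>_. ennreal (inverse \<bar>det (matrix ?f)\<bar>))" ..
    qed
  next
    fix m n :: 'n assume "m \<noteq> n"
    let ?t = "Transposition.transpose m n"
    let ?f = "\<lambda>x::real^'n. \<chi> i. x $ ?t i"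
    have lin: "linear ?f" by (rule linearI) (auto simp: vec_eq_iff)
    have "matrix ?f = (\<chi> i. mat 1 $ ?t i)"
      by (auto simp: matrix_def mat_def axis_def vec_eq_iff)
    then have det: "\<bar>det (matrix ?f)\<bar> = 1"
      by (simp add: det_permute_rows permutes_swap_id abs_mult sign_swap_id \<open>m \<noteq> n\<close>)
    \<comment> \<open>Exchanging two coordinates maps boxes to boxes of equal volume, and boxes
      determine Lebesgue measure.\<close>
    have "lborel = distr lborel borel ?f"
    proof (rule lborel_eqI)
      fix l u :: "real^'n" assume le: "\<And>b. b \<in> Basis \<Longrightarrow> l \<bullet> b \<le> u \<bullet> b"
      have vim: "?f -` box l u = box (?f l) (?f u)"
      proof (intro set_eqI)
        fix x
        have "(\<forall>i. l $ i < x $ ?t i \<and> x $ ?t i < u $ i) \<longleftrightarrow> (\<forall>i. l $ ?t i < x $ i \<and> x $ i < u $ ?t i)"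
          by (metis transpose_involutory)
        then show "x \<in> ?f -` box l u \<longleftrightarrow> x \<in> box (?f l) (?f u)"
          by (simp add: mem_box_cart)
      qed
      have le': "l $ i \<le> u $ i" for i
        using le[of "axis i 1"] by (simp add: inner_axis)
      have "emeasure (distr lborel borel ?f) (box l u) = emeasure lborel (box (?f l) (?f u))"
        using meas[OF lin] by (subst emeasure_distr) (auto simp: vim)
      also have "\<dots> = (\<Prod>b\<in>Basis. (?f u - ?f l) \<bullet> b)"
      proof (rule emeasure_lborel_box)
        fix b :: "real^'n" assume "b \<in> Basis"
        then show "?f l \<bullet> b \<le> ?f u \<bullet> b" by (auto simp: Basis_vec_def inner_axis le')
      qed
      also have "(\<Prod>b\<in>Basis. (?f u - ?f l) \<bullet> b) = (\<Prod>i\<in>UNIV. (u - l) $ ?t i)"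
        using prod_Basis_cart[of "\<lambda>x. x" "?f u - ?f l"] by simp
      also have "\<dots> = (\<Prod>i\<in>UNIV. (u - l) $ i)"
        using prod.permute[OF permutes_swap_id, of m UNIV n "\<lambda>i. (u - l) $ i"] by (simp add: o_def)
      also have "\<dots> = (\<Prod>b\<in>Basis. (u - l) \<bullet> b)"
        using prod_Basis_cart[of "\<lambda>x. x" "u - l"] by simp
      finally show "emeasure (distr lborel borel ?f) (box l u) = (\<Prod>b\<in>Basis. (u - l) \<bullet> b)" .
    qed simp
    then show "?P ?f"
      using det by (simp add: density_1)
  next
    fix m n :: 'n assume mn: "m \<noteq> n"
    let ?f = "\<lambda>x::real^'n. \<chi> i. if i = m then x $ m + x $ n else x $ i"
    have "matrix ?f = (\<chi> k. if k = m then row m (mat 1) + 1 *s row n (mat 1) else row k (mat 1))"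
      by (auto simp: matrix_def mat_def axis_def row_def vec_eq_iff)
    then have det: "det (matrix ?f) = 1"
      using det_row_operation[OF mn, of "mat 1 :: real^'n^'n" 1] by simp
    \<comment> \<open>Adding coordinate \<open>n\<close> to coordinate \<open>m\<close> is a shear
      along \<open>axis m 1\<close>, with direction vectors orthogonal because \<open>m\<close> and
      \<open>n\<close> differ.\<close>
    have "?f = (\<lambda>x. x + (x \<bullet> axis n 1) *\<^sub>R axis m 1)"
    proof
      fix x :: "real^'n"
      have "x \<bullet> axis n 1 = x $ n" by (simp add: inner_axis)
      then show "?f x = x + (x \<bullet> axis n 1) *\<^sub>R axis m 1"
        by (simp only:) (auto simp: vec_eq_iff axis_def)
    qed
    moreover have "distr lborel borel (\<lambda>x::real^'n. x + (x \<bullet> axis n 1) *\<^sub>R axis m 1) = lborel"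
      using mn by (intro lborel_distr_shear) (auto simp: axis_in_Basis_iff inner_axis_axis)
    ultimately show "?P ?f"
      using det by (simp add: density_1)
  qed
  then show ?thesis using assms(2) by blast
qed

lemma lborel_distr_matrix:
  fixes A :: "real^'n^'n"
  assumes "det A \<noteq> 0"
  shows "distr lborel borel ((*v) A) = density lborel (\<lambda>_. ennreal (inverse \<bar>det A\<bar>))"
  using lborel_distr_linear[of "(*v) A"] assms by (simp add: matrix_vector_mul_linear)

lemma matrix_vector_measurable [measurable]:
  fixes A :: "real^'n^'m"
  assumes "f \<in> borel_measurable M"
  shows "(\<lambda>x. A *v f x) \<in> borel_measurable M"
  using measurable_compose[OF assms borel_measurable_continuous_onI[OF linear_continuous_on[OF matrix_vector_mul_bounded_linear]]] .

lemma nn_integral_matrix: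
  fixes A :: "real^'n^'n"
  assumes "det A \<noteq> 0" and [measurable]: "F \<in> borel_measurable borel"
  shows "(\<integral>\<^sup>+x. F (A *v x) \<partial>lborel) = ennreal (inverse \<bar>det A\<bar>) * (\<integral>\<^sup>+x. F x \<partial>lborel)"
proof -
  have "(\<integral>\<^sup>+x. F (A *v x) \<partial>lborel) = (\<integral>\<^sup>+x. F x \<partial>distr lborel borel ((*v) A))"
    by (subst nn_integral_distr) auto
  also have "\<dots> = ennreal (inverse \<bar>det A\<bar>) * (\<integral>\<^sup>+x. F x \<partial>lborel)"
    unfolding lborel_distr_matrix[OF assms(1)] by (subst nn_integral_density) (auto simp: nn_integral_cmult)
  finally show ?thesis .
qed

lemma integral_matrix:
  fixes A :: "real^'n^'n" and F :: "real^'n \<Rightarrow> 'b::{banach,second_countable_topology}"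
  assumes "det A \<noteq> 0" and [measurable]: "F \<in> borel_measurable borel"
  shows "(\<integral>x. F (A *v x) \<partial>lborel) = (\<integral>x. F x \<partial>lborel) /\<^sub>R \<bar>det A\<bar>"
proof -
  have "(\<integral>x. F (A *v x) \<partial>lborel) = (\<integral>x. F x \<partial>distr lborel borel ((*v) A))"
    by (subst integral_distr) auto
  also have "\<dots> = (\<integral>x. F x \<partial>lborel) /\<^sub>R \<bar>det A\<bar>"
    unfolding lborel_distr_matrix[OF assms(1)] by (subst integral_density) auto
  finally show ?thesis .
qed

text \<open>On the segment from the identity to this matrix the quadratic form
  \<open>x \<bullet> x + t * ((A *v x) \<bullet> (A *v x))\<close> stays definite, so the
  determinant never vanishes and keeps the sign it has at the identity.\<close>

lemma det_mat_1_plus_pos: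
  fixes A :: "real^'n^'n"
  shows "det (mat 1 + transpose A ** A) > 0"
proof -
  define M where "M t = mat 1 + t *\<^sub>R (transpose A ** A)" for t :: real
  have nz: "det (M t) \<noteq> 0" if "t \<ge> 0" for t
  proof -
    have "x = 0" if "M t *v x = 0" for x
    proof -
      have "0 = x \<bullet> (M t *v x)" using that by simp
      also have "\<dots> = x \<bullet> x + t * ((A *v x) \<bullet> (A *v x))"
        by (simp add: M_def matrix_vector_mult_add_rdistrib scaleR_matrix_vector_assoc[symmetric]
            inner_add_right matrix_vector_mul_assoc[symmetric] dot_lmul_matrix[symmetric] flip: transpose_matrix_vector)
      finally have "x \<bullet> x + t * ((A *v x) \<bullet> (A *v x)) = 0" ..
      then show "x = 0"
        using \<open>t \<ge> 0\<close> by (metis add_nonneg_eq_0_iff inner_eq_zero_iff inner_ge_zero mult_nonneg_nonneg)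
    qed
    then have "\<exists>B. B ** M t = mat 1" using matrix_left_invertible_ker by blast
    then show ?thesis using invertible_left_inverse invertible_det_nz by blast
  qed
  have cont: "continuous_on {0..1} (\<lambda>t. det (M t))"
    unfolding det_def M_def by (auto intro!: continuous_intros)
  show ?thesis
  proof (rule ccontr)
    assume "\<not> ?thesis"
    then have "det (M 1) \<le> 0" by (simp add: M_def)
    moreover have "0 \<le> det (M 0)" by (simp add: M_def)
    ultimately obtain t where "0 \<le> t" "det (M t) = 0"
      using IVT2'[of "\<lambda>t. det (M t)" 1 0 0] cont by auto
    then show False using nz by blast
  qed
qed

section \<open>Gaussian windows\<close>

lemma inner_matrix_transpose:
  fixes A :: "real^'n^'m"
  shows "x \<bullet> (A *v y) = (transpose A *v x) \<bullet> y"
  by (simp add: transpose_matrix_vector dot_lmul_matrix)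

declare transpose_matrix_vector [simp del]

lemma matrix_mul_add_rdistrib:
  fixes A B :: "real^'n^'m" and C :: "real^'k^'n"
  shows "(A + B) ** C = A ** C + B ** C"
  by (simp add: matrix_matrix_mult_def vec_eq_iff distrib_right sum.distrib)

lemma matrix_inv_mult:
  fixes A :: "real^'n^'n"
  assumes "invertible A"
  shows "A ** matrix_inv A = mat 1" "matrix_inv A ** A = mat 1"
  using someI_ex[OF assms[unfolded invertible_def]] unfolding matrix_inv_def by auto

lemma inj_of_matrix_inverse:
  fixes A :: "real^'n^'m"
  assumes "A ** B = mat 1"
  shows "inj ((*v) B)"
  by (rule inj_on_inverseI[of _ "(*v) A"]) (simp add: matrix_vector_mul_assoc assms)

lemma schwartz_matrix:
  fixes B :: "real^'n^'n"
  assumes "\<phi> \<in> \<S>" "inj ((*v) B)"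
  shows "(\<lambda>y. \<phi> (B *v y)) \<in> \<S>"
  using schwartz_linear_compose[OF assms(1) _ assms(2)] by (simp add: o_def matrix_vector_mul_linear)

section \<open>Masses and moments of Gaussians\<close>

lemma gauss_measurable [measurable]:
  assumes "f \<in> borel_measurable M"
  shows "(\<lambda>x. gauss (f x)) \<in> borel_measurable M"
  using measurable_compose[OF assms schwartz_measurable[OF gauss_schwartz]] .

lemma gauss_eq: "gauss = (\<lambda>x. complex_of_real (exp (- pi * (x \<bullet> x))))"
  by (simp add: fun_eq_iff gauss_def)

lemma norm_gauss: "cmod (gauss x) = exp (- pi * (x \<bullet> x))"
  by (simp add: gauss_def)

text \<open>No diagonalisation is needed to see that \<open>gauss_mass C = det (I + C C\<^sup>* )\<^sup>-\<^sup>1\<^sup>/\<^sup>2\<close>: by the Fourier transform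
  \<open>C\<close> and \<open>C\<^sup>*\<close> have the same mass, and \<open>|x + C\<^sup>* y|\<^sup>2 + |y - C x|\<^sup>2 = |x|\<^sup>2 + |C x|\<^sup>2 + |y|\<^sup>2 + |C\<^sup>* y|\<^sup>2\<close>
  evaluates the product of the two.\<close>

definition gauss_mass :: "real^'n^'n \<Rightarrow> real" where
  "gauss_mass C = (\<integral>x. exp (- pi * (x \<bullet> x)) * exp (- pi * ((C *v x) \<bullet> (C *v x))) \<partial>lborel)"

lemma gauss_mass_integrable:
  fixes C :: "real^'n^'n"
  shows "integrable lborel (\<lambda>x. exp (- pi * (x \<bullet> x)) * exp (- pi * ((C *v x) \<bullet> (C *v x))))"
proof (rule Bochner_Integration.integrable_bound)
  show "integrable lborel (gauss :: real^'n \<Rightarrow> complex)"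
    by (rule schwartz_integrable[OF gauss_schwartz])
qed (auto simp: norm_gauss)

lemma gauss_mass_complex:
  fixes C :: "real^'n^'n"
  shows "(\<integral>x. gauss x * gauss (C *v x) \<partial>lborel) = complex_of_real (gauss_mass C)"
  unfolding gauss_mass_def gauss_def of_real_mult[symmetric] by (rule integral_complex_of_real)

lemma gauss_mass_transpose:
  fixes C :: "real^'n^'n"
  shows "gauss_mass (transpose C) = gauss_mass C"
proof -
  \<comment> \<open>The Gaussian is its own Fourier transform, so integrating \<open>F\<close> over
    \<open>u\<close> produces \<open>gauss (C *v x)\<close>, while integrating over \<open>x\<close>
    produces the same expression with the transposed matrix in \<open>u\<close>.\<close>
  define F where "F x u = gauss x * (gauss u * cis (2 * pi * (u \<bullet> (C *v x))))" for x u :: "real^'n"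
  have gi: "integrable lborel (gauss :: real^'n \<Rightarrow> complex)"
    by (rule schwartz_integrable[OF gauss_schwartz])
  have int: "integrable (lborel \<Otimes>\<^sub>M lborel) (\<lambda>(x, u). F x u)"
  proof (rule integrable_pair_dominated[OF _ integrable_norm[OF gi] integrable_norm[OF gi]])
    show "(\<lambda>(x, u). F x u) \<in> borel_measurable (lborel \<Otimes>\<^sub>M lborel)"
      unfolding F_def by measurable
  qed (simp add: F_def norm_mult)
  have 1: "(\<integral>u. F x u \<partial>lborel) = gauss x * gauss (C *v x)" for x
    unfolding F_def by (simp only: integral_mult_right_zero gauss_fourier)
  have 2: "(\<integral>x. F x u \<partial>lborel) = gauss u * gauss (transpose C *v u)" for u
  proof -
    have "F x u = gauss u * (gauss x * cis (2 * pi * (x \<bullet> (transpose C *v u))))" for x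
    proof -
      have "u \<bullet> (C *v x) = x \<bullet> (transpose C *v u)"
        by (subst inner_matrix_transpose) (rule inner_commute)
      then show ?thesis by (simp only: F_def mult_ac)
    qed
    then show ?thesis by (simp only: integral_mult_right_zero gauss_fourier)
  qed
  have "complex_of_real (gauss_mass (transpose C)) = complex_of_real (gauss_mass C)"
    using lborel_pair.Fubini_integral[OF int] by (simp only: 1 2 gauss_mass_complex)
  then show ?thesis by simp
qed

lemma gauss_nn_integral: "(\<integral>\<^sup>+x. ennreal (exp (- pi * (x \<bullet> x))) \<partial>(lborel :: 'a::euclidean_space measure)) = 1"
proof -
  have "integrable lborel (\<lambda>x::'a. cmod (gauss x))"
    by (rule integrable_norm[OF schwartz_integrable[OF gauss_schwartz]])
  then have i: "integrable lborel (\<lambda>x::'a. exp (- pi * (x \<bullet> x)))" by (simp add: norm_gauss)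
  have "complex_of_real (\<integral>x. exp (- pi * (x \<bullet> (x::'a))) \<partial>lborel) = 1"
    using gauss_integral[where 'a='a] unfolding gauss_eq integral_complex_of_real .
  then show ?thesis by (subst nn_integral_eq_integral[OF i]) auto
qed

lemma gauss_mass_sq:
  fixes C :: "real^'n^'n"
  shows "(gauss_mass C)\<^sup>2 = inverse (det (mat 1 + C ** transpose C))"
proof -
  define D where "D = mat 1 + C ** transpose C"
  have D: "det D > 0" unfolding D_def using det_mat_1_plus_pos[of "transpose C"] by simp
  \<comment> \<open>Taking values in \<open>ennreal\<close> lets the order of integration be
    exchanged without integrability conditions.\<close>
  define e where "e x = ennreal (exp (- pi * (x \<bullet> x)))" for x :: "real^'n"
  have [measurable]: "e \<in> borel_measurable borel" unfolding e_def by measurable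
  have mass: "(\<integral>\<^sup>+x. e x * e (B *v x) \<partial>lborel) = ennreal (gauss_mass B)" for B
    unfolding e_def gauss_mass_def
    by (subst nn_integral_eq_integral[OF gauss_mass_integrable, symmetric]) (auto simp: ennreal_mult)
  have nonneg: "gauss_mass B \<ge> 0" for B :: "real^'n^'n"
    unfolding gauss_mass_def by (rule integral_nonneg_AE) auto
  have sq: "e x * e (C *v x) * (e y * e (transpose C *v y)) = e (x + transpose C *v y) * e (y - C *v x)" for x y
  proof -
    have "(x + transpose C *v y) \<bullet> (x + transpose C *v y) + (y - C *v x) \<bullet> (y - C *v x)
        = x \<bullet> x + (C *v x) \<bullet> (C *v x) + (y \<bullet> y + (transpose C *v y) \<bullet> (transpose C *v y))"
      using inner_matrix_transpose[of y C x]
      by (simp add: inner_add_left inner_add_right inner_diff_left inner_diff_right inner_commute)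
    then have "- pi * ((x + transpose C *v y) \<bullet> (x + transpose C *v y)) + - pi * ((y - C *v x) \<bullet> (y - C *v x))
        = - pi * (x \<bullet> x) + - pi * ((C *v x) \<bullet> (C *v x)) + (- pi * (y \<bullet> y) + - pi * ((transpose C *v y) \<bullet> (transpose C *v y)))"
      by (simp only: distrib_left[symmetric])
    then show ?thesis
      unfolding e_def by (simp only: exp_add[symmetric] ennreal_mult[symmetric] exp_ge_zero mult_nonneg_nonneg)
  qed
  have "ennreal ((gauss_mass C)\<^sup>2) = (\<integral>\<^sup>+x. e x * e (C *v x) \<partial>lborel) * (\<integral>\<^sup>+y. e y * e (transpose C *v y) \<partial>lborel)"
    unfolding mass gauss_mass_transpose using nonneg[of C] by (simp add: power2_eq_square ennreal_mult)
  also have "\<dots> = (\<integral>\<^sup>+y. (\<integral>\<^sup>+x. e x * e (C *v x) * (e y * e (transpose C *v y)) \<partial>lborel) \<partial>lborel)"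
    by (simp add: nn_integral_cmult nn_integral_multc)
  also have "\<dots> = (\<integral>\<^sup>+y. (\<integral>\<^sup>+x. e (x + transpose C *v y) * e (y - C *v x) \<partial>lborel) \<partial>lborel)"
    by (simp only: sq)
  \<comment> \<open>Translating \<open>x\<close> by \<open>transpose C *v y\<close> frees the first
    factor of \<open>y\<close> and collects the whole dependence on \<open>y\<close> in
    \<open>D *v y\<close>. The integral over \<open>y\<close> is then a linear substitution, which
    gives the determinant.\<close>
  also have "\<dots> = (\<integral>\<^sup>+y. (\<integral>\<^sup>+x. e x * e (D *v y - C *v x) \<partial>lborel) \<partial>lborel)"
  proof (rule nn_integral_cong)
    fix y
    have "D *v y - C *v x = y - C *v (x - transpose C *v y)" for x
      by (simp add: D_def matrix_vector_mult_add_rdistrib matrix_vector_mult_diff_distrib matrix_vector_mul_assoc)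
    then show "(\<integral>\<^sup>+x. e (x + transpose C *v y) * e (y - C *v x) \<partial>lborel) = (\<integral>\<^sup>+x. e x * e (D *v y - C *v x) \<partial>lborel)"
      by (subst (2) lborel_distr_plus[of "transpose C *v y", symmetric], subst nn_integral_distr)
        (auto simp: add.commute)
  qed
  also have "\<dots> = (\<integral>\<^sup>+x. (\<integral>\<^sup>+y. e x * e (D *v y - C *v x) \<partial>lborel) \<partial>lborel)"
    by (rule lborel_pair.Fubini') measurable
  also have "\<dots> = (\<integral>\<^sup>+x. e x * (ennreal (inverse \<bar>det D\<bar>) * 1) \<partial>lborel)"
  proof (rule nn_integral_cong)
    fix x
    have "(\<integral>\<^sup>+y. e (D *v y - C *v x) \<partial>lborel) = ennreal (inverse \<bar>det D\<bar>) * (\<integral>\<^sup>+y. e (y - C *v x) \<partial>lborel)"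
      using nn_integral_matrix[of D "\<lambda>y. e (y - C *v x)"] D by simp
    also have "(\<integral>\<^sup>+y. e (y - C *v x) \<partial>lborel) = (\<integral>\<^sup>+y. e y \<partial>lborel)"
      by (subst (2) lborel_distr_plus[of "- (C *v x)", symmetric], subst nn_integral_distr) auto
    finally show "(\<integral>\<^sup>+y. e x * e (D *v y - C *v x) \<partial>lborel) = e x * (ennreal (inverse \<bar>det D\<bar>) * 1)"
      using gauss_nn_integral[where 'a="real^'n"] by (simp add: nn_integral_cmult e_def)
  qed
  also have "\<dots> = ennreal (inverse (det D))"
    using gauss_nn_integral[where 'a="real^'n"] D by (simp add: nn_integral_multc e_def)
  finally show ?thesis
    using D by (simp add: D_def)
qed

text \<open>A node map of at most linear growth changes the weight by at most a constant factor. The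
  coefficient \<open>a\<close> is arbitrary, and the absolute value of \<open>K\<close> spares a
  sign condition on it.\<close>

lemma gauss_moment_integrable:
  fixes \<Theta> :: "'a::euclidean_space \<Rightarrow> 'b::real_normed_vector"
  assumes a [measurable]: "a \<in> borel_measurable lborel" and \<Theta> [measurable]: "(\<lambda>w. norm (\<Theta> w)) \<in> borel_measurable lborel"
    and mom: "\<And>m. integrable lborel (\<lambda>w. cmod (a w) * (1 + norm w) ^ m)"
    and K: "\<And>w. norm (\<Theta> w) \<le> K * norm w"
  shows "integrable lborel (\<lambda>w. cmod (a w) * (1 + norm (\<Theta> w)) ^ m)"
proof (rule Bochner_Integration.integrable_bound)
  show "integrable lborel (\<lambda>w. (1 + \<bar>K\<bar>) ^ m * (cmod (a w) * (1 + norm w) ^ m))"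
    using mom by simp
  show "AE w in lborel. norm (cmod (a w) * (1 + norm (\<Theta> w)) ^ m) \<le> norm ((1 + \<bar>K\<bar>) ^ m * (cmod (a w) * (1 + norm w) ^ m))"
  proof (rule AE_I2)
    fix w
    have "norm (\<Theta> w) \<le> \<bar>K\<bar> * norm w"
      using K[of w] mult_right_mono[OF abs_ge_self, of "norm w" K] by simp
    then have "1 + norm (\<Theta> w) \<le> (1 + \<bar>K\<bar>) * (1 + norm w)"
    proof -
      have "(1 + \<bar>K\<bar>) * (1 + norm w) = 1 + \<bar>K\<bar> + norm w + \<bar>K\<bar> * norm w"
        by (simp add: algebra_simps)
      then show ?thesis
        using \<open>norm (\<Theta> w) \<le> \<bar>K\<bar> * norm w\<close> norm_ge_zero[of w] abs_ge_zero[of K] by linarith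
    qed
    then have "(1 + norm (\<Theta> w)) ^ m \<le> ((1 + \<bar>K\<bar>) * (1 + norm w)) ^ m"
      by (intro power_mono) auto
    then have "cmod (a w) * (1 + norm (\<Theta> w)) ^ m \<le> (1 + \<bar>K\<bar>) ^ m * (cmod (a w) * (1 + norm w) ^ m)"
      using mult_left_mono[OF \<open>(1 + norm (\<Theta> w)) ^ m \<le> _\<close>, of "cmod (a w)"]
      by (simp add: power_mult_distrib mult_ac)
    then show "norm (cmod (a w) * (1 + norm (\<Theta> w)) ^ m) \<le> norm ((1 + \<bar>K\<bar>) ^ m * (cmod (a w) * (1 + norm w) ^ m))"
      by (simp add: abs_mult)
  qed
qed measurable

lemma gauss_moment:
  "integrable lborel (\<lambda>w::'a::euclidean_space. cmod (gauss w) * (1 + norm w) ^ m)"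
proof -
  obtain C where C: "\<And>x::'a. (1 + norm x) ^ (2 * DIM('a) + m) * cmod (gauss x) \<le> C"
    using schwartz_decay[OF gauss_schwartz] by metis
  show ?thesis
    by (rule integrable_of_decay[of _ C]) (use C in \<open>auto simp: power_add mult_ac\<close>)
qed

lemma gauss_norm_integral: "(\<integral>x. cmod (gauss (x::'a::euclidean_space)) \<partial>lborel) = 1"
proof -
  have "complex_of_real (\<integral>x. cmod (gauss (x::'a)) \<partial>lborel) = (\<integral>x. gauss (x::'a) \<partial>lborel)"
    unfolding norm_gauss unfolding gauss_eq by (rule integral_complex_of_real[symmetric])
  then show ?thesis by (simp add: gauss_integral)
qed

text \<open>Multiplying a window by a Gaussian costs nothing, because the Fourier transform of the
  Gaussian is a probability density.\<close>

lemma window_norm_gauss_mult: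
  fixes B :: "real^'n^'n" and G :: "real^'n \<Rightarrow> complex"
  assumes p: "1 \<le> p" and q: "1 \<le> q" and f: "tempered_distribution f" and G: "G \<in> \<S>"
    and B: "inj ((*v) B)"
  shows "window_norm p q (\<lambda>y. G y * gauss (B *v y)) f \<le> window_norm p q G f"
proof -
  define \<Theta> where "\<Theta> w = (0 :: real^'n, transpose B *v w)" for w :: "real^'n"
  have [measurable]: "\<Theta> \<in> borel_measurable lborel"
    unfolding \<Theta>_def borel_prod[symmetric] by measurable
  have mom: "integrable lborel (\<lambda>w. cmod (gauss w) * (1 + norm (\<Theta> w)) ^ m)" for m
  proof (rule gauss_moment_integrable[OF _ _ gauss_moment])
    show "norm (\<Theta> w) \<le> onorm ((*v) (transpose B)) * norm w" for w
      unfolding \<Theta>_def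
      by (simp add: norm_Pair onorm matrix_vector_mul_bounded_linear)
  qed measurable
  have "window_norm p q (\<lambda>y. G y * gauss (B *v y)) f \<le> ennreal (\<integral>w. cmod (gauss (w :: real^'n)) \<partial>lborel) * window_norm p q G f"
  proof (rule window_norm_superposition[OF p q f G _ _ _ mom])
    show "(\<lambda>y. G y * gauss (B *v y)) \<in> \<S>"
      by (intro schwartz_mult G schwartz_matrix[OF gauss_schwartz] B)
    show "G y * gauss (B *v y) = (\<integral>w. gauss w * tf_shift (\<Theta> w) G y \<partial>lborel)" for y
    proof -
      have "gauss w * tf_shift (\<Theta> w) G y = G y * (gauss w * cis (2 * pi * (w \<bullet> (B *v y))))" for w
        by (simp add: \<Theta>_def tf_shift_def inner_matrix_transpose mult_ac)
      then show ?thesis by (simp only: integral_mult_right_zero gauss_fourier)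
    qed
  qed measurable
  then show ?thesis by (simp add: gauss_norm_integral)
qed

text \<open>With \<open>S = A + B\<^sup>*\<close> and \<open>B = A\<^sup>-\<^sup>1\<close> one has
  \<open>|w|\<^sup>2 + |B\<^sup>* w|\<^sup>2 + |y - A w|\<^sup>2 + |B y - w|\<^sup>2 = |B y|\<^sup>2 + |S w - y|\<^sup>2\<close>, so convolving the product of
  the two Gaussians with a third one gives back \<open>gauss \<circ> B\<close>.\<close>

lemma window_norm_gauss_conv:
  fixes A B :: "real^'n^'n"
  assumes p: "1 \<le> p" and q: "1 \<le> q" and f: "tempered_distribution f"
    and AB: "A ** B = mat 1" "B ** A = mat 1"
  shows "window_norm p q (\<lambda>y. gauss (B *v y)) f
    \<le> ennreal (sqrt (det (mat 1 + transpose A ** A))) * window_norm p q (\<lambda>y. gauss y * gauss (B *v y)) f"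
proof -
  define S where "S = A + transpose B"
  define \<Delta> where "\<Delta> = det (mat 1 + transpose A ** A)"
  have \<Delta>: "\<Delta> > 0" unfolding \<Delta>_def by (rule det_mat_1_plus_pos)
  have BtAt: "transpose B ** transpose A = mat 1"
    using AB(1) by (metis matrix_transpose_mul transpose_mat)
  have dAB: "det A * det B = 1" using arg_cong[OF AB(1), of det] by (simp add: det_mul)
  \<comment> \<open>Factoring out \<open>transpose B\<close> expresses the determinant of
    \<open>S\<close> through \<open>\<Delta>\<close>; the remaining term uses
    \<open>transpose B ** transpose A = mat 1\<close>.\<close>
  have "S = transpose B ** (mat 1 + transpose A ** A)"
    by (simp add: S_def matrix_add_ldistrib matrix_mul_assoc BtAt)
  then have detS: "det S = det B * \<Delta>" by (simp add: det_mul \<Delta>_def det_transpose)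
  have S0: "det S \<noteq> 0" using dAB \<Delta> by (auto simp: detS)
  note injB = inj_of_matrix_inverse[OF AB(1)]
  have mass: "(gauss_mass (transpose B))\<^sup>2 = (det A)\<^sup>2 / \<Delta>"
  proof -
    \<comment> \<open>Conjugating by \<open>A\<close> exchanges the two summands, which relates the
      determinant for \<open>B\<close> in \<open>gauss_mass_sq\<close> to
      \<open>\<Delta>\<close>.\<close>
    have "transpose A ** (mat 1 + transpose B ** B) ** A = mat 1 + transpose A ** A"
    proof -
      have "transpose A ** (transpose B ** B) ** A = (transpose A ** transpose B) ** (B ** A)"
        by (simp add: matrix_mul_assoc)
      also have "transpose A ** transpose B = mat 1"
        using AB(2) by (metis matrix_transpose_mul transpose_mat)
      finally show ?thesis
        by (simp add: matrix_add_ldistrib matrix_mul_add_rdistrib AB add.commute)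
    qed
    then have "det A * det (mat 1 + transpose B ** B) * det A = \<Delta>"
      unfolding \<Delta>_def by (metis det_mul det_transpose)
    moreover have "det A \<noteq> 0" using dAB by auto
    ultimately have "det (mat 1 + transpose B ** B) = \<Delta> / (det A)\<^sup>2"
      by (simp add: power2_eq_square field_simps)
    then show ?thesis using gauss_mass_sq[of "transpose B"] by simp
  qed
  have mass_nonneg: "gauss_mass (transpose B) \<ge> 0"
    unfolding gauss_mass_def by (rule integral_nonneg_AE) auto
  \<comment> \<open>This is where the square root in the final estimate arises: \<bar>det B\<bar>
    \<Delta> times \<bar>det A\<bar> / sqrt \<Delta>, with determinants of \<open>A\<close> and
    \<open>B\<close> cancelling.\<close>
  have cost: "\<bar>det S\<bar> * gauss_mass (transpose B) = sqrt \<Delta>"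
  proof (rule real_sqrt_unique[symmetric])
    have "(\<bar>det S\<bar> * gauss_mass (transpose B))\<^sup>2 = (det S)\<^sup>2 * (gauss_mass (transpose B))\<^sup>2"
      by (simp add: power_mult_distrib)
    also have "\<dots> = (det B * \<Delta>)\<^sup>2 * ((det A)\<^sup>2 / \<Delta>)"
      by (simp only: mass detS)
    also have "\<dots> = (det A * det B)\<^sup>2 * (\<Delta> * \<Delta>) / \<Delta>"
      by (simp add: power_mult_distrib power2_eq_square mult_ac)
    finally show "(\<bar>det S\<bar> * gauss_mass (transpose B))\<^sup>2 = \<Delta>" using \<Delta> by (simp add: dAB)
  qed (use mass_nonneg in simp)
  define M :: "real^'n \<Rightarrow> complex" where "M = (\<lambda>y. gauss y * gauss (B *v y))"
  have M: "M \<in> \<S>"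
    unfolding M_def by (intro schwartz_mult gauss_schwartz schwartz_matrix[OF gauss_schwartz] injB)
  \<comment> \<open>The factor \<open>\<bar>det S\<bar>\<close> normalises the integral of
    \<open>gauss (S *v w - y)\<close> over \<open>w\<close> to 1.\<close>
  define a :: "real^'n \<Rightarrow> complex" where "a w = of_real \<bar>det S\<bar> * (gauss w * gauss (transpose B *v w))" for w
  define \<Theta> where "\<Theta> w = (A *v w, 0 :: real^'n)" for w :: "real^'n"
  have [measurable]: "\<Theta> \<in> borel_measurable lborel"
    unfolding \<Theta>_def borel_prod[symmetric] by measurable
  have a_meas [measurable]: "a \<in> borel_measurable lborel" unfolding a_def by measurable
  have norm_a: "cmod (a w) = \<bar>det S\<bar> * (exp (- pi * (w \<bullet> w)) * exp (- pi * ((transpose B *v w) \<bullet> (transpose B *v w))))" for w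
    by (simp add: a_def norm_mult norm_gauss)
  have mom_a: "integrable lborel (\<lambda>w. cmod (a w) * (1 + norm w) ^ m)" for m
  proof (rule Bochner_Integration.integrable_bound)
    show "integrable lborel (\<lambda>w::real^'n. \<bar>det S\<bar> * (cmod (gauss w) * (1 + norm w) ^ m))"
      using gauss_moment by (rule integrable_mult_right)
    have "cmod (a w) \<le> \<bar>det S\<bar> * cmod (gauss w)" for w
      unfolding norm_a norm_gauss by (intro mult_left_mono) (auto simp: mult_le_cancel_left1)
    from mult_right_mono[OF this]
    show "AE w in lborel. norm (cmod (a w) * (1 + norm w) ^ m) \<le> norm (\<bar>det S\<bar> * (cmod (gauss w) * (1 + norm w) ^ m))"
      by (intro AE_I2) (simp add: abs_mult mult.assoc)
  qed measurable
  have mom: "integrable lborel (\<lambda>w. cmod (a w) * (1 + norm (\<Theta> w)) ^ m)" for m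
  proof (rule gauss_moment_integrable[OF _ _ mom_a])
    show "norm (\<Theta> w) \<le> onorm ((*v) A) * norm w" for w
      unfolding \<Theta>_def by (simp add: norm_Pair onorm matrix_vector_mul_bounded_linear)
  qed measurable
  have "window_norm p q (\<lambda>y. gauss (B *v y)) f \<le> ennreal (\<integral>w. cmod (a w) \<partial>lborel) * window_norm p q M f"
  proof (rule window_norm_superposition[OF p q f M _ _ _ mom])
    show "(\<lambda>y. gauss (B *v y)) \<in> \<S>"
      by (rule schwartz_matrix[OF gauss_schwartz injB])
    show "gauss (B *v y) = (\<integral>w. a w * tf_shift (\<Theta> w) M y \<partial>lborel)" for y
    proof -
      have id: "w \<bullet> w + (transpose B *v w) \<bullet> (transpose B *v w) + ((y - A *v w) \<bullet> (y - A *v w) + (B *v (y - A *v w)) \<bullet> (B *v (y - A *v w)))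
          = (B *v y) \<bullet> (B *v y) + (S *v w - y) \<bullet> (S *v w - y)"
        (is "?l w = _") for w
      proof -
        have 1: "B *v (y - A *v w) = B *v y - w"
          by (simp add: matrix_vector_mult_diff_distrib matrix_vector_mul_assoc AB)
        have 2: "S *v w - y = transpose B *v w - (y - A *v w)"
          by (simp add: S_def matrix_vector_mult_add_rdistrib)
        have 3: "(transpose B *v w) \<bullet> (y - A *v w) = w \<bullet> (B *v y - w)"
          using inner_matrix_transpose[of w B "y - A *v w"] 1 by simp
        show ?thesis
          unfolding 1 2 using 3
          by (simp add: inner_diff_left[of "B *v y"] inner_diff_right[of _ "B *v y"]
              inner_diff_left[of "transpose B *v w"] inner_diff_right[of _ "transpose B *v w"] inner_commute)
      qed
      have "a w * tf_shift (\<Theta> w) M y = of_real \<bar>det S\<bar> * (gauss (B *v y) * gauss (S *v w - y))" for w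
      proof -
        have "gauss w * gauss (transpose B *v w) * (gauss (y - A *v w) * gauss (B *v (y - A *v w)))
            = complex_of_real (exp (- pi * ?l w))"
          unfolding gauss_def by (simp only: distrib_left exp_add of_real_mult)
        also have "\<dots> = gauss (B *v y) * gauss (S *v w - y)"
          unfolding id gauss_def by (simp only: distrib_left exp_add of_real_mult)
        finally show ?thesis
          by (simp add: a_def \<Theta>_def tf_shift_def M_def mult.assoc)
      qed
      moreover have "(\<integral>w. gauss (S *v w - y) \<partial>lborel) = 1 /\<^sub>R \<bar>det S\<bar>"
      proof -
        have "(\<integral>w. gauss (S *v w - y) \<partial>lborel) = (\<integral>w. gauss (w - y) \<partial>lborel) /\<^sub>R \<bar>det S\<bar>"
          by (rule integral_matrix[OF S0]) measurable
        also have "(\<integral>w. gauss (w - y) \<partial>lborel) = 1"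
          using integral_translate[of gauss "- y"] by (simp add: gauss_integral)
        finally show ?thesis .
      qed
      ultimately show ?thesis
        using S0 by (simp only: integral_mult_right_zero) (simp add: scaleR_conv_of_real)
    qed
  qed measurable
  also have "(\<integral>w. cmod (a w) \<partial>lborel) = sqrt \<Delta>"
    unfolding norm_a using cost by (simp add: gauss_mass_def)
  finally show ?thesis by (simp add: M_def \<Delta>_def)
qed

text \<open>The constant depends on \<open>G\<close> and \<open>H\<close> only, because a superposition of time-frequency shifts
  of \<open>G\<close> stays one, with the same coefficients, after composition with \<open>B\<close>.\<close>

lemma window_norm_change:
  fixes G H :: "real^'n \<Rightarrow> complex"
  assumes p: "1 \<le> p" and q: "1 \<le> q"
    and G: "G \<in> \<S>" and H: "H \<in> \<S>" and nz: "G \<noteq> (\<lambda>_. 0)"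
  obtains C where "C \<ge> 0"
    "\<And>(A::real^'n^'n) B (f :: (real^'n \<Rightarrow> complex) \<Rightarrow> complex). A ** B = mat 1 \<Longrightarrow> B ** A = mat 1 \<Longrightarrow> tempered_distribution f \<Longrightarrow>
       window_norm p q (\<lambda>y. H (B *v y)) f \<le> ennreal C * window_norm p q (\<lambda>y. G (B *v y)) f"
proof -
  obtain a :: "(real^'n) \<times> (real^'n) \<Rightarrow> complex"
    where a [measurable]: "a \<in> borel_measurable lborel"
      and mom: "\<And>m. integrable lborel (\<lambda>w. cmod (a w) * (1 + norm w) ^ m)"
      and rep: "\<And>y. H y = (\<integral>w. a w * tf_shift w G y \<partial>lborel)"
    using schwartz_superposition[OF G H nz] by blast
  show thesis
  proof (rule that[of "\<integral>w. cmod (a w) \<partial>lborel"])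
    show "0 \<le> (\<integral>w. cmod (a w) \<partial>lborel)" by simp
    fix A B :: "real^'n^'n" and f :: "(real^'n \<Rightarrow> complex) \<Rightarrow> complex"
    assume AB: "A ** B = mat 1" "B ** A = mat 1" and f: "tempered_distribution f"
    note injB = inj_of_matrix_inverse[OF AB(1)]
    have comp: "(\<lambda>y. \<phi> (B *v y)) \<in> \<S>" if "\<phi> \<in> \<S>" for \<phi> :: "real^'n \<Rightarrow> complex"
      by (rule schwartz_matrix[OF that injB])
    \<comment> \<open>Forced by the composition: \<open>B *v (y - A *v x) = B *v y - x\<close> for
      the translation, and \<open>\<omega> \<bullet> (B *v y) = (transpose B *v \<omega>) \<bullet>
      y\<close> for the modulation.\<close>
    define \<Theta> where "\<Theta> w = (A *v fst w, transpose B *v snd w)" for w :: "(real^'n) \<times> (real^'n)"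
    have lin: "bounded_linear \<Theta>"
      unfolding \<Theta>_def
      by (intro bounded_linear_Pair bounded_linear_compose[OF matrix_vector_mul_bounded_linear]
          bounded_linear_fst bounded_linear_snd)
    have [measurable]: "\<Theta> \<in> borel_measurable lborel"
      using borel_measurable_continuous_onI[OF linear_continuous_on[OF lin]] by simp
    show "window_norm p q (\<lambda>y. H (B *v y)) f \<le> ennreal (\<integral>w. cmod (a w) \<partial>lborel) * window_norm p q (\<lambda>y. G (B *v y)) f"
    proof (rule window_norm_superposition[OF p q f comp[OF G] comp[OF H] a])
      show "integrable lborel (\<lambda>w. cmod (a w) * (1 + norm (\<Theta> w)) ^ m)" for m
        by (rule gauss_moment_integrable[OF a _ mom onorm[OF lin]]) measurable
      show "H (B *v y) = (\<integral>w. a w * tf_shift (\<Theta> w) (\<lambda>y. G (B *v y)) y \<partial>lborel)" for y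
      proof -
        have "tf_shift (\<Theta> w) (\<lambda>y. G (B *v y)) y = tf_shift w G (B *v y)" for w
          by (simp add: \<Theta>_def tf_shift_def inner_matrix_transpose matrix_vector_mult_diff_distrib
              matrix_vector_mul_assoc AB)
        then show ?thesis by (simp add: rep)
      qed
    qed measurable
  qed
qed

section \<open>The effect of a dilation on the norm, and the final estimate\<close>

lemma stft_eq_tf_shift: "stft g f z \<xi> = f (tf_shift (z, - \<xi>) (cnj \<circ> g))"
  unfolding stft_def tf_shift_def by (rule arg_cong[of _ _ f]) (auto simp: cis_conv_exp fun_eq_iff mult_ac)

lemma modulation_norm_eq_window_norm: "modulation_norm g p q f = window_norm p q (cnj \<circ> g) f"
  by (simp add: modulation_norm_def window_norm_def mixed_norm_def stft_eq_tf_shift)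

text \<open>The three factors are \<open>k\<close> from the pairing that defines
  \<open>dilation\<close>, \<open>kp\<close> from the substitution \<open>z \<mapsto> A *v z\<close>
  in the inner norm, and \<open>kq\<close> from \<open>\<xi> \<mapsto> transpose B *v \<xi>\<close>
  in the outer one. The last has a positive exponent because the determinant of \<open>B\<close> is
  the reciprocal of that of \<open>A\<close>.\<close>

lemma window_norm_dilation_le:
  fixes A B :: "real^'n^'n" and G :: "real^'n \<Rightarrow> complex"
  assumes p: "1 \<le> p" and q: "1 \<le> q" and f: "tempered_distribution f" and G: "G \<in> \<S>"
    and AB: "A ** B = mat 1" "B ** A = mat 1" and B: "B = matrix_inv A"
  shows "window_norm p q G (dilation A f)
    \<le> ennreal (\<bar>det A\<bar> powr (- (enn2real (1 / p) - enn2real (1 / q) + 1))) * window_norm p q (\<lambda>y. G (B *v y)) f"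
proof -
  have dAB: "det A * det B = 1" using arg_cong[OF AB(1), of det] by (simp add: det_mul)
  then have d: "det A \<noteq> 0" "det B \<noteq> 0" by auto
  have invd: "inverse \<bar>det B\<bar> = \<bar>det A\<bar>"
    using dAB by (metis abs_inverse inverse_unique mult.commute)
  note injB = inj_of_matrix_inverse[OF AB(1)]
  have GB: "(\<lambda>y. G (B *v y)) \<in> \<S>"
    by (rule schwartz_matrix[OF G injB])
  define \<Phi> where "\<Phi> z \<xi> = ennreal (cmod (f (tf_shift (z, - \<xi>) (\<lambda>y. G (B *v y)))))" for z \<xi>
  define N where "N \<xi> = eLp_norm p lborel (\<lambda>z. \<Phi> z \<xi>)" for \<xi>
  have \<Phi>: "(\<lambda>w. \<Phi> (fst w) (snd w)) \<in> borel_measurable (borel \<Otimes>\<^sub>M borel)"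
    unfolding \<Phi>_def by (rule tf_shift_measurable[OF f GB])
  have sec [measurable]: "(\<lambda>z. \<Phi> z \<xi>) \<in> borel_measurable borel" for \<xi>
    using measurable_compose[OF measurable_Pair2' \<Phi>, of \<xi>] by simp
  have N [measurable]: "N \<in> borel_measurable borel"
    unfolding N_def by (rule eLp_norm_measurable[OF p \<Phi>])
  define k where "k = ennreal (inverse \<bar>det A\<bar>)"
  define kp where "kp = ennreal (inverse \<bar>det A\<bar> powr enn2real (1 / p))"
  define kq where "kq = ennreal (\<bar>det A\<bar> powr enn2real (1 / q))"
  have eq: "ennreal (cmod (dilation A f (tf_shift (z, - \<xi>) G))) = k * \<Phi> (A *v z) (transpose B *v \<xi>)" for z \<xi>
  proof -
    have "(\<lambda>t. tf_shift (z, - \<xi>) G (matrix_inv A *v t)) = tf_shift (A *v z, - (transpose B *v \<xi>)) (\<lambda>y. G (B *v y))"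
      by (simp add: fun_eq_iff tf_shift_def B[symmetric] inner_matrix_transpose matrix_vector_mult_diff_distrib
          matrix_vector_mul_assoc AB)
    then show ?thesis
      unfolding dilation_def \<Phi>_def k_def
      by (simp add: norm_divide divide_inverse norm_mult norm_inverse mult.commute flip: ennreal_mult)
  qed
  have inner: "eLp_norm p lborel (\<lambda>z. k * \<Phi> (A *v z) \<eta>) \<le> (k * kp) * N \<eta>" for \<eta>
  proof -
    have "eLp_norm p lborel (\<lambda>z. \<Phi> (A *v z) \<eta>) = kp * N \<eta>"
      unfolding kp_def N_def
      by (rule eLp_norm_distr[OF p sec _ _ lborel_distr_matrix[OF d(1)]]) (use d in auto)
    then show ?thesis
      using eLp_norm_cmult_le[OF p, of "\<lambda>z. \<Phi> (A *v z) \<eta>" lborel k] by (simp add: mult.assoc)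
  qed
  have outer: "eLp_norm q lborel (\<lambda>\<xi>. N (transpose B *v \<xi>)) = kq * eLp_norm q lborel N"
  proof -
    have dBt: "det (transpose B) \<noteq> 0" using d by (simp add: det_transpose)
    show ?thesis
      using eLp_norm_distr[OF q N _ _ lborel_distr_matrix[OF dBt]] d
      by (simp add: kq_def det_transpose invd)
  qed
  have meas: "(\<lambda>\<xi>. eLp_norm p lborel (\<lambda>z. k * \<Phi> (A *v z) (transpose B *v \<xi>))) \<in> borel_measurable borel"
  proof (rule eLp_norm_measurable[OF p])
    have "(\<lambda>w::(real^'n) \<times> (real^'n). (A *v fst w, transpose B *v snd w)) \<in> measurable (borel \<Otimes>\<^sub>M borel) (borel \<Otimes>\<^sub>M borel)"
      by measurable
    from measurable_compose[OF this \<Phi>]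
    show "(\<lambda>w. k * \<Phi> (A *v fst w) (transpose B *v snd w)) \<in> borel_measurable (borel \<Otimes>\<^sub>M borel)"
      by simp
  qed
  have "window_norm p q G (dilation A f) = eLp_norm q lborel (\<lambda>\<xi>. eLp_norm p lborel (\<lambda>z. k * \<Phi> (A *v z) (transpose B *v \<xi>)))"
    by (simp add: window_norm_def mixed_norm_def eq)
  also have "\<dots> \<le> eLp_norm q lborel (\<lambda>\<xi>. (k * kp) * N (transpose B *v \<xi>))"
    using meas by (intro eLp_norm_mono[OF q] inner) simp
  also have "\<dots> \<le> (k * kp) * eLp_norm q lborel (\<lambda>\<xi>. N (transpose B *v \<xi>))"
    by (rule eLp_norm_cmult_le[OF q]) measurable
  also have "\<dots> = (k * kp * kq) * window_norm p q (\<lambda>y. G (B *v y)) f"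
    unfolding outer by (simp add: window_norm_def mixed_norm_def N_def [abs_def] \<Phi>_def mult.assoc)
  also have "k * kp * kq = ennreal (\<bar>det A\<bar> powr (- (enn2real (1 / p) - enn2real (1 / q) + 1)))"
  proof -
    have "inverse \<bar>det A\<bar> * inverse \<bar>det A\<bar> powr s * \<bar>det A\<bar> powr t = \<bar>det A\<bar> powr (- (s - t + 1))" for s t
    proof -
      have "\<bar>det A\<bar> powr (- (s - t + 1)) = \<bar>det A\<bar> powr (- 1) * \<bar>det A\<bar> powr (- s) * \<bar>det A\<bar> powr t"
        unfolding powr_add[symmetric] by (rule arg_cong2[of _ _ _ _ "(powr)"]) auto
      then show ?thesis using d by (simp add: powr_minus inverse_powr)
    qed
    then show ?thesis unfolding k_def kp_def kq_def by (simp flip: ennreal_mult)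
  qed
  finally show ?thesis .
qed

text \<open>Infinite exponents fit the same formula, since \<open>enn2real (1 / p)\<close> is then
  0. Choosing \<open>C\<close> before \<open>A\<close> and \<open>f\<close> expresses the uniformity
  of the implied constant.\<close>

theorem proposition3p1:
  fixes g :: "real^'n \<Rightarrow> complex" and p q :: ennreal
  assumes "g \<in> schwartz_space" and "g \<noteq> (\<lambda>_. 0)"
    and "1 \<le> p" and "1 \<le> q"
  shows "\<exists>C::real. C > 0 \<and>
    (\<forall>(A::real^'n^'n) f. invertible A \<longrightarrow> f \<in> modulation_space g p q \<longrightarrow>
       modulation_norm g p q (dilation A f) \<le>
         ennreal (C * \<bar>det A\<bar> powr (- (enn2real (1 / p) - enn2real (1 / q) + 1))
                    * sqrt (det (mat 1 + transpose A ** A)))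
         * modulation_norm g p q f)"
proof -
  note p = assms(3) and q = assms(4)
  define G where "G = cnj \<circ> g"
  have G: "G \<in> schwartz_space" unfolding G_def by (rule schwartz_cnj[OF assms(1)])
  have G0: "G \<noteq> (\<lambda>_. 0)" using assms(2) by (auto simp: G_def fun_eq_iff)
  have gauss0: "(gauss :: real^'n \<Rightarrow> complex) \<noteq> (\<lambda>_. 0)" by (auto simp: fun_eq_iff gauss_def)
  obtain C1 where C1: "C1 \<ge> 0"
    "\<And>(A::real^'n^'n) B f. A ** B = mat 1 \<Longrightarrow> B ** A = mat 1 \<Longrightarrow> tempered_distribution f \<Longrightarrow>
       window_norm p q (\<lambda>y. G (B *v y)) f \<le> ennreal C1 * window_norm p q (\<lambda>y. gauss (B *v y)) f"
    using window_norm_change[OF p q gauss_schwartz G gauss0] by blast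
  obtain C2 where C2: "C2 \<ge> 0"
    "\<And>(A::real^'n^'n) B f. A ** B = mat 1 \<Longrightarrow> B ** A = mat 1 \<Longrightarrow> tempered_distribution f \<Longrightarrow>
       window_norm p q (\<lambda>y. gauss (B *v y)) f \<le> ennreal C2 * window_norm p q (\<lambda>y. G (B *v y)) f"
    using window_norm_change[OF p q G gauss_schwartz G0] by blast
  \<comment> \<open>The summand 1 only ensures strict positivity, as \<open>C1\<close> and
    \<open>C2\<close> are merely known to be nonnegative.\<close>
  define C where "C = C1 * C2 + 1"
  have C: "C > 0" "C1 * C2 \<le> C" using C1(1) C2(1) by (auto simp: C_def add_nonneg_pos)
  have "modulation_norm g p q (dilation A f) \<le>
         ennreal (C * \<bar>det A\<bar> powr (- (enn2real (1 / p) - enn2real (1 / q) + 1))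
                    * sqrt (det (mat 1 + transpose A ** A)))
         * modulation_norm g p q f"
    if A: "invertible A" and f: "f \<in> modulation_space g p q" for A :: "real^'n^'n" and f
  proof -
    define B where "B = matrix_inv A"
    have AB: "A ** B = mat 1" "B ** A = mat 1"
      unfolding B_def using matrix_inv_mult[OF A] by auto
    note injB = inj_of_matrix_inverse[OF AB(1)]
    have f: "tempered_distribution f" using f by (simp add: modulation_space_def)
    define e where "e = \<bar>det A\<bar> powr (- (enn2real (1 / p) - enn2real (1 / q) + 1))"
    define s where "s = sqrt (det (mat 1 + transpose A ** A))"
    have nn: "e \<ge> 0" "s \<ge> 0" using det_mat_1_plus_pos[of A] by (auto simp: e_def s_def)
    have "window_norm p q G (dilation A f) \<le> ennreal e * window_norm p q (\<lambda>y. G (B *v y)) f"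
      unfolding e_def by (rule window_norm_dilation_le[OF p q f G AB B_def])
    also have "\<dots> \<le> ennreal e * (ennreal C1 * window_norm p q (\<lambda>y. gauss (B *v y)) f)"
      by (intro mult_left_mono C1(2)[OF AB f]) auto
    also have "\<dots> \<le> ennreal e * (ennreal C1 * (ennreal s * window_norm p q (\<lambda>y. gauss y * gauss (B *v y)) f))"
      unfolding s_def by (intro mult_left_mono window_norm_gauss_conv[OF p q f AB]) auto
    also have "\<dots> \<le> ennreal e * (ennreal C1 * (ennreal s * window_norm p q gauss f))"
      by (intro mult_left_mono window_norm_gauss_mult[OF p q f gauss_schwartz injB]) auto
    \<comment> \<open>The second change of window takes place without dilation, so both matrices are
      the identity.\<close>
    also have "\<dots> \<le> ennreal e * (ennreal C1 * (ennreal s * (ennreal C2 * window_norm p q G f)))"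
      using C2(2)[of "mat 1" "mat 1", OF _ _ f] by (intro mult_left_mono) auto
    also have "\<dots> = ennreal ((C1 * C2) * e * s) * window_norm p q G f"
      using nn C1(1) C2(1) by (simp add: ennreal_mult mult_ac)
    also have "\<dots> \<le> ennreal (C * e * s) * window_norm p q G f"
      using nn C(2) by (intro mult_right_mono ennreal_leI) auto
    finally show ?thesis
      unfolding modulation_norm_eq_window_norm G_def[symmetric] e_def s_def .
  qed
  with C(1) show ?thesis by blast
qed

end
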